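(* Let $N$ be a norm on $\mathbb{R}^2$ such that the restriction of $N$ to $\mathbb{R}^2\setminus\{0\}$ is of class $C^{2,\delta}$ for some $\delta>0$ and the unit circle $\partial B_N(0,1)$ has strictly positive curvature. For $v\in\mathbb{S}^1$ let $P_v:\mathbb{R}^2\to H_v$ be the closest-point projection onto $H_v$ with respect to $N$. Let $A$ be an $\mathcal{H}^1$-measurable subset of $\mathbb{R}^2$ with $\mathcal{H}^1(A)<\infty$. Then $A$ is purely $1$-unrectifiable if and only if $\mathcal{H}^1(P_v(A))=0$ for $\mathcal{L}^1$-a.e. $v\in\mathbb{S}^1$.
   Context: $\mathbb{S}^1$ is the Euclidean unit circle in $\mathbb{R}^2$, $\mathcal{H}^1$ is the $1$-dimensional Hausdorff measure, and "$\mathcal{L}^1$-a.e. $v\in\mathbb{S}^1$" refers to arc-length measure on $\mathbb{S}^1$. $B_N(0,1)=\{x\in\mathbb{R}^2:N(x)\le 1\}$. For $0<\delta\le 1$ and $k\in\mathbb{N}_0$, a map on an open set $U\subset\mathbb{R}^n$ is of class $C^{k,\delta}$ if it is $k$ times continuously differentiable and its partial derivatives of order $k$ are locally $\delta$-H\"older (i.e. $\delta$-H\"older on every compact subset of $U$). Curvature: under the hypothesis, $\partial B_N(0,1)$ is a simple closed $C^2$ curve; its curvature at $\gamma(t)$ is $\|\ddot\gamma(t)\|$, where $\gamma$ is a parametrization by Euclidean arc-length and $\|\cdot\|$ is the Euclidean norm. Strictly positive curvature implies that $B_N(0,1)$ is strictly convex. For $v\in\mathbb{S}^1$, $H_v:=\{w\in\mathbb{R}^2:v\cdot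 w=0\}$ (Euclidean scalar product). For a strictly convex norm $N$ the closest-point projection $P_v(x)$ of $x\in\mathbb{R}^2$ is the unique point of $H_v$ with $N(x-P_v(x))=\min\{N(x-q):q\in H_v\}$. A set $A\subset\mathbb{R}^2$ is purely $1$-unrectifiable if $\mathcal{H}^1(A\cap f(\mathbb{R}))=0$ for every Lipschitz map $f:\mathbb{R}\to\mathbb{R}^2$. *)

theory Defs
  imports "HOL-Analysis.Analysis"
begin

definition is_norm :: "('a::real_vector \<Rightarrow> real) \<Rightarrow> bool" where
  "is_norm N \<longleftrightarrow>
     (\<forall>x. 0 \<le> N x) \<and> (\<forall>x. N x = 0 \<longleftrightarrow> x = 0) \<and>
     (\<forall>c x. N (c *\<^sub>R x) = \<bar>c\<bar> * N x) \<and> (\<forall>x y. N (x + y) \<le> N x + N y)"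


subsection \<open>Maps of class \<open>C\<^sup>k\<close> with locally Hoelder derivatives\<close>

definition partial_deriv ::
  "'a::euclidean_space \<Rightarrow> ('a \<Rightarrow> 'b::real_normed_vector) \<Rightarrow> 'a \<Rightarrow> 'b" where
  "partial_deriv b f x = vector_derivative (\<lambda>t. f (x + t *\<^sub>R b)) (at 0)"

primrec times_cont_diff_on ::
  "nat \<Rightarrow> ('a::euclidean_space \<Rightarrow> 'b::real_normed_vector) \<Rightarrow> 'a set \<Rightarrow> bool" where
  "times_cont_diff_on 0 f U \<longleftrightarrow> continuous_on U f"
| "times_cont_diff_on (Suc k) f U \<longleftrightarrow>
     (\<forall>x\<in>U. f differentiable at x) \<and> (\<forall>b\<in>Basis. times_cont_diff_on k (partial_deriv b f) U)"

definition holder_cont_on ::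
  "real \<Rightarrow> ('a::metric_space \<Rightarrow> 'b::metric_space) \<Rightarrow> 'a set \<Rightarrow> bool" where
  "holder_cont_on \<delta> f K \<longleftrightarrow> (\<exists>C. \<forall>x\<in>K. \<forall>y\<in>K. dist (f x) (f y) \<le> C * dist x y powr \<delta>)"

text \<open>The partial derivatives of order \<open>k\<close> are indexed by the lists of \<open>k\<close> basis vectors.
  The definition is meant for \<open>0 < \<delta> \<le> 1\<close> and open \<open>U\<close>.\<close>

definition class_C_holder ::
  "nat \<Rightarrow> real \<Rightarrow> ('a::euclidean_space \<Rightarrow> 'b::real_normed_vector) \<Rightarrow> 'a set \<Rightarrow> bool" where
  "class_C_holder k \<delta> f U \<longleftrightarrow>
     times_cont_diff_on k f U \<and>
     (\<forall>bs. length bs = k \<and> set bs \<subseteq> Basis \<longrightarrow>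
        (\<forall>K. compact K \<and> K \<subseteq> U \<longrightarrow> holder_cont_on \<delta> (fold partial_deriv bs f) K))"


subsection \<open>Curvature of simple closed plane curves\<close>

text \<open>An \<open>L\<close>-periodic \<open>C\<^sup>2\<close> parametrization by Euclidean arc length of the simple closed
  curve \<open>S\<close> of length \<open>L\<close>.\<close>

definition arc_length_param :: "(real \<Rightarrow> real^2) \<Rightarrow> real \<Rightarrow> (real^2) set \<Rightarrow> bool" where
  "arc_length_param \<gamma> L S \<longleftrightarrow>
     0 < L \<and> \<gamma> C1_differentiable_on UNIV \<and>
     (\<lambda>t. vector_derivative \<gamma> (at t)) C1_differentiable_on UNIV \<and>
     (\<forall>t. norm (vector_derivative \<gamma> (at t)) = 1) \<and>
     (\<forall>t. \<gamma> (t + L) = \<gamma> t) \<and> inj_on \<gamma> {0..<L} \<and> range \<gamma> = S"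

definition curvature_along :: "(real \<Rightarrow> real^2) \<Rightarrow> real \<Rightarrow> real" where
  "curvature_along \<gamma> t = norm (vector_derivative (\<lambda>s. vector_derivative \<gamma> (at s)) (at t))"

text \<open>Arc length parametrizations of a simple closed curve are unique up to translation and
  reflection of the parameter, so the choice of \<open>\<gamma>\<close> is irrelevant.\<close>

definition strictly_positive_curvature :: "(real^2) set \<Rightarrow> bool" where
  "strictly_positive_curvature S \<longleftrightarrow>
     (\<exists>\<gamma> L. arc_length_param \<gamma> L S \<and> (\<forall>t. 0 < curvature_along \<gamma> t))"


subsection \<open>Closest-point projections\<close>

definition orth_line :: "real^2 \<Rightarrow> (real^2) set" where
  "orth_line v = {w. v \<bullet> w = 0}"

text \<open>Meaningful for strictly convex \<open>N\<close>, where the minimizer is unique.\<close>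

definition closest_point_proj :: "(real^2 \<Rightarrow> real) \<Rightarrow> real^2 \<Rightarrow> real^2 \<Rightarrow> real^2" where
  "closest_point_proj N v x = (THE p. is_arg_min (\<lambda>q. N (x - q)) (\<lambda>q. q \<in> orth_line v) p)"


subsection \<open>Hausdorff measure and rectifiability\<close>

text \<open>\<open>diameter\<close> is only meaningful for bounded sets, hence the boundedness requirement
  on the covers. No normalizing factor is needed in dimension one.\<close>

definition hausdorff1_pre :: "real \<Rightarrow> 'a::metric_space set \<Rightarrow> ennreal" where
  "hausdorff1_pre \<epsilon> A =
     (INF C \<in> {C :: nat \<Rightarrow> 'a set. A \<subseteq> (\<Union>i. C i) \<and> (\<forall>i. bounded (C i) \<and> diameter (C i) \<le> \<epsilon>)}.
        (\<Sum>i. ennreal (diameter (C i))))"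

definition hausdorff1 :: "'a::metric_space set \<Rightarrow> ennreal" where
  "hausdorff1 A = (SUP \<epsilon> \<in> {0<..}. hausdorff1_pre \<epsilon> A)"

text \<open>Caratheodory measurability with respect to the outer measure \<^const>\<open>hausdorff1\<close>.\<close>

definition hausdorff1_measurable :: "'a::metric_space set \<Rightarrow> bool" where
  "hausdorff1_measurable A \<longleftrightarrow> A \<in> lambda_system UNIV UNIV hausdorff1"

definition purely_1_unrectifiable :: "(real^2) set \<Rightarrow> bool" where
  "purely_1_unrectifiable A \<longleftrightarrow>
     (\<forall>f :: real \<Rightarrow> real^2. (\<exists>M. M-lipschitz_on UNIV f) \<longrightarrow> hausdorff1 (A \<inter> range f) = 0)"

text \<open>Arc length measure on the Euclidean unit circle, as the push-forward of Lebesgue measure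
  under the angular parametrization.\<close>

definition circle_measure :: "(real^2) measure" where
  "circle_measure =
     distr (restrict_space lborel {0..<2 * pi}) (restrict_space borel (sphere 0 1))
       (\<lambda>\<theta>. vector [cos \<theta>, sin \<theta>])"

end

(* A closest-point projection P_v is linear: its kernel is spanned by the point w of the unit circle
   of N with outer normal v, so the size of P_v(A) is that of the projection of A along w. The map
   from the direction of w to v is the normalized gradient of N, which is differentiable and hence
   maps null sets to null sets. This reduces one implication to Besicovitch's projection theorem and
   the other one to curves having two null projections in different directions.

   For the projection theorem let A be compact and purely unrectifiable and let t be a direction.
   Almost every line in direction t meets A in a finite set, so locally it suffices to treat the
   points a of A that are alone on their line. For almost every t, the density of A in narrow cones
   around the line through such a point a is either zero or infinite: a set function that vanishes on
   a set of directions and has bounded densities there has zero densities at almost every point.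
   Points of zero density form a null set since A is purely unrectifiable, and points of infinite
   density project to a null set by the weak type inequality for the maximal function. *)
theory Submission
  imports Defs
begin

subsection \<open>One-dimensional Hausdorff measure\<close>

text \<open>The zero-or-infinity alternative concerns one point \<open>a\<close> and almost every
  direction: the directions in which \<open>a\<close> is alone on its line form a set whose cone at
  \<open>a\<close> misses \<open>A\<close>, so the content of cones, as a set function of
  directions, vanishes there by construction. The projection theorem needs it for one direction and
  almost every \<open>a\<close>. The exchange is Fubini's theorem, and the joint Borel measurability
  that it requires shapes the encoding: heights of cones are rational, widths are
  \<open>1 / real k\<close>, and \<open>A\<close> is compact. Densities are suprema over all
  heights, not limits at small scale, so being alone refers to all of \<open>A\<close>; a countable
  basis of the plane supplies the localization. Directions are slopes: \<open>t\<close> stands for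
  the line spanned by \<open>(t, 1)\<close>. The horizontal direction has no slope and costs at most
  two values of \<open>v $ 1\<close>. On the circle the first coordinate determines \<open>v\<close>
  up to a reflection, so normals are compared through \<open>v $ 1\<close> alone, up to sign, and
  only null sets of real numbers are moved between directions and normals.\<close>

lemma hausdorff1_pre_le:
  assumes "A \<subseteq> (\<Union>i. C i)" "\<And>i. bounded (C i)" "\<And>i. diameter (C i) \<le> \<epsilon>"
  shows "hausdorff1_pre \<epsilon> A \<le> (\<Sum>i::nat. ennreal (diameter (C i)))"
  unfolding hausdorff1_pre_def by (rule INF_lower) (use assms in auto)

lemma hausdorff1_pre_lessE:
  assumes "hausdorff1_pre \<epsilon> A < c"
  obtains C :: "nat \<Rightarrow> 'a::metric_space set"
  where "A \<subseteq> (\<Union>i. C i)" "\<And>i. bounded (C i)" "\<And>i. diameter (C i) \<le> \<epsilon>"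
    "(\<Sum>i. ennreal (diameter (C i))) < c"
  using assms unfolding hausdorff1_pre_def by (auto simp: INF_less_iff)

lemma hausdorff1_pre_mono: "A \<subseteq> B \<Longrightarrow> hausdorff1_pre \<epsilon> A \<le> hausdorff1_pre \<epsilon> B"
  unfolding hausdorff1_pre_def by (rule INF_superset_mono) auto

lemma hausdorff1_pre_antimono: "\<epsilon> \<le> \<epsilon>' \<Longrightarrow> hausdorff1_pre \<epsilon>' A \<le> hausdorff1_pre \<epsilon> A"
  unfolding hausdorff1_pre_def by (rule INF_superset_mono) (auto intro: order_trans)

lemma hausdorff1_pre_le_hausdorff1: "0 < \<epsilon> \<Longrightarrow> hausdorff1_pre \<epsilon> A \<le> hausdorff1 A"
  unfolding hausdorff1_def by (rule SUP_upper) auto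

lemma hausdorff1_leI: "(\<And>\<epsilon>. 0 < \<epsilon> \<Longrightarrow> hausdorff1_pre \<epsilon> A \<le> c) \<Longrightarrow> hausdorff1 A \<le> c"
  unfolding hausdorff1_def by (rule SUP_least) auto

lemma hausdorff1_mono: "A \<subseteq> B \<Longrightarrow> hausdorff1 A \<le> hausdorff1 B"
  unfolding hausdorff1_def by (rule SUP_mono) (auto intro: hausdorff1_pre_mono)

lemma hausdorff1_empty [simp]: "hausdorff1 {} = 0"
proof -
  have "hausdorff1_pre \<epsilon> {} = 0" if "0 < \<epsilon>" for \<epsilon>
    using hausdorff1_pre_le[of "{}" "\<lambda>_. {}" \<epsilon>] that by (simp add: le_zero_eq)
  then have "hausdorff1 ({}::'a set) \<le> 0" by (intro hausdorff1_leI) simp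
  then show ?thesis by simp
qed

lemma suminf_ennreal_half_series:
  assumes "0 \<le> e" shows "(\<Sum>i. ennreal (e * (1/2)^Suc i)) = ennreal e"
proof (rule suminf_ennreal_eq)
  show "(\<lambda>i. e * (1/2)^Suc i) sums e" using sums_mult[OF power_half_series, of e] by simp
qed (use assms in auto)

lemma hausdorff1_pre_UN:
  "hausdorff1_pre \<epsilon> (\<Union>i::nat. A i) \<le> (\<Sum>i. hausdorff1_pre \<epsilon> (A i))"
proof (rule ennreal_le_epsilon)
  fix e :: real assume fin: "(\<Sum>i. hausdorff1_pre \<epsilon> (A i)) < top" and e: "0 < e"
  have "\<exists>C::nat\<Rightarrow>'a set. A i \<subseteq> (\<Union>j. C j) \<and> (\<forall>j. bounded (C j) \<and> diameter (C j) \<le> \<epsilon>) \<and>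
      (\<Sum>j. ennreal (diameter (C j))) \<le> hausdorff1_pre \<epsilon> (A i) + ennreal (e * (1/2)^Suc i)" for i
  proof -
    have "hausdorff1_pre \<epsilon> (A i) < top" using fin
      by (rule ennreal_suminf_lessD)
    moreover have "0 < e * (1/2)^Suc i" using e by simp
    ultimately have "hausdorff1_pre \<epsilon> (A i) < hausdorff1_pre \<epsilon> (A i) + ennreal (e * (1/2)^Suc i)"
      using ennreal_add_left_cancel_less[of "hausdorff1_pre \<epsilon> (A i)" 0 "ennreal (e * (1/2)^Suc i)"]
      by simp
    then show ?thesis by (elim hausdorff1_pre_lessE) (metis less_imp_le)
  qed
  then obtain C :: "nat \<Rightarrow> nat \<Rightarrow> 'a set" where C: "\<And>i. A i \<subseteq> (\<Union>j. C i j)"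
    "\<And>i j. bounded (C i j)" "\<And>i j. diameter (C i j) \<le> \<epsilon>"
    "\<And>i. (\<Sum>j. ennreal (diameter (C i j))) \<le> hausdorff1_pre \<epsilon> (A i) + ennreal (e * (1/2)^Suc i)"
    by metis
  have "hausdorff1_pre \<epsilon> (\<Union>i. A i) \<le> (\<Sum>n. ennreal (diameter (case_prod C (prod_decode n))))"
  proof (rule hausdorff1_pre_le)
    show "(\<Union>i. A i) \<subseteq> (\<Union>n. case_prod C (prod_decode n))"
    proof
      fix x assume "x \<in> (\<Union>i. A i)"
      then obtain i j where "x \<in> C i j" using C(1) by blast
      then have "x \<in> case_prod C (prod_decode (prod_encode (i,j)))" by simp
      then show "x \<in> (\<Union>n. case_prod C (prod_decode n))" by (rule UN_I[OF UNIV_I])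
    qed
  qed (use C in \<open>auto split: prod.split\<close>)
  also have "\<dots> = (\<Sum>i. \<Sum>j. ennreal (diameter (C i j)))"
    by (rule suminf_ennreal_2dimen[where f="\<lambda>p. ennreal (diameter (case_prod C p))"]) simp
  also have "\<dots> \<le> (\<Sum>i. hausdorff1_pre \<epsilon> (A i) + ennreal (e * (1/2)^Suc i))"
    by (intro suminf_le C(4) summableI)
  also have "\<dots> = (\<Sum>i. hausdorff1_pre \<epsilon> (A i)) + ennreal e"
    using suminf_add[OF summableI summableI, of "\<lambda>i. hausdorff1_pre \<epsilon> (A i)" "\<lambda>i. ennreal (e * (1/2)^Suc i)"]
      suminf_ennreal_half_series[of e] e by (metis less_imp_le)
  finally show "hausdorff1_pre \<epsilon> (\<Union>i. A i) \<le> (\<Sum>i. hausdorff1_pre \<epsilon> (A i)) + ennreal e" .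
qed

lemma hausdorff1_UN: "hausdorff1 (\<Union>i::nat. A i) \<le> (\<Sum>i. hausdorff1 (A i))"
proof (rule hausdorff1_leI)
  fix \<epsilon> :: real assume "0 < \<epsilon>"
  then have "(\<Sum>i. hausdorff1_pre \<epsilon> (A i)) \<le> (\<Sum>i. hausdorff1 (A i))"
    by (intro suminf_le hausdorff1_pre_le_hausdorff1 summableI)
  then show "hausdorff1_pre \<epsilon> (\<Union>i. A i) \<le> (\<Sum>i. hausdorff1 (A i))"
    using hausdorff1_pre_UN order_trans by blast
qed

lemma hausdorff1_Un: "hausdorff1 (A \<union> B) \<le> hausdorff1 A + hausdorff1 B"
proof -
  have "hausdorff1 (\<Union>i. binaryset A B i) \<le> (\<Sum>i. hausdorff1 (binaryset A B i))" by (rule hausdorff1_UN)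
  moreover have "(\<Sum>i. hausdorff1 (binaryset A B i)) = hausdorff1 A + hausdorff1 B"
    by (rule suminf_binaryset_eq) simp
  ultimately show ?thesis by (simp add: UN_binaryset_eq)
qed

lemma hausdorff1_null_subset: "hausdorff1 B = 0 \<Longrightarrow> A \<subseteq> B \<Longrightarrow> hausdorff1 A = 0"
  using hausdorff1_mono[of A B] by simp

lemma hausdorff1_UN_null:
  assumes "countable I" "\<And>i. i \<in> I \<Longrightarrow> hausdorff1 (A i) = 0"
  shows "hausdorff1 (\<Union>i\<in>I. A i) = 0"
proof (cases "I = {}")
  case False
  have "hausdorff1 (\<Union>n. A (from_nat_into I n)) \<le> (\<Sum>n. hausdorff1 (A (from_nat_into I n)))"
    by (rule hausdorff1_UN)
  also have "\<dots> = 0" using assms(2) from_nat_into[OF False] by simp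
  also have "(\<Union>n. A (from_nat_into I n)) = (\<Union>i\<in>I. A i)"
    using range_from_nat_into[OF False assms(1)] by (metis image_image)
  finally show ?thesis by simp
qed simp

text \<open>A covering set of diameter below the separation \<open>d\<close> meets at most one of \<open>A\<close>, \<open>B\<close>.\<close>

lemma hausdorff1_separated:
  assumes d: "0 < d" "\<And>x y. x \<in> A \<Longrightarrow> y \<in> B \<Longrightarrow> d \<le> dist x y"
  shows "hausdorff1 A + hausdorff1 B \<le> hausdorff1 (A \<union> B)"
proof -
  have main: "hausdorff1_pre \<epsilon> A + hausdorff1_pre \<epsilon> B \<le> hausdorff1 (A \<union> B)" if \<epsilon>: "0 < \<epsilon>" "\<epsilon> < d" for \<epsilon>
  proof -
    have "hausdorff1_pre \<epsilon> A + hausdorff1_pre \<epsilon> B \<le> hausdorff1_pre \<epsilon> (A \<union> B)"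
      unfolding hausdorff1_pre_def[of \<epsilon> "A \<union> B"]
    proof (rule INF_greatest, clarify)
      fix C :: "nat \<Rightarrow> 'a set"
      assume C: "A \<union> B \<subseteq> (\<Union>i. C i)" "\<forall>i. bounded (C i) \<and> diameter (C i) \<le> \<epsilon>"
      have small: "diameter (C i \<inter> A) \<le> \<epsilon>" "diameter (C i \<inter> B) \<le> \<epsilon>" for i
        using C(2) by (meson Int_lower1 diameter_subset order_trans)+
      have "hausdorff1_pre \<epsilon> A \<le> (\<Sum>i. ennreal (diameter (C i \<inter> A)))"
        by (rule hausdorff1_pre_le) (use C small in \<open>auto intro: bounded_subset\<close>)
      moreover have "hausdorff1_pre \<epsilon> B \<le> (\<Sum>i. ennreal (diameter (C i \<inter> B)))"
        by (rule hausdorff1_pre_le) (use C small in \<open>auto intro: bounded_subset\<close>)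
      ultimately have "hausdorff1_pre \<epsilon> A + hausdorff1_pre \<epsilon> B
          \<le> (\<Sum>i. ennreal (diameter (C i \<inter> A)) + ennreal (diameter (C i \<inter> B)))"
        by (simp add: suminf_add[symmetric] add_mono summableI)
      also have "\<dots> \<le> (\<Sum>i. ennreal (diameter (C i)))"
      proof (intro suminf_le summableI)
        fix i
        have "C i \<inter> A = {} \<or> C i \<inter> B = {}"
        proof (rule ccontr)
          assume "\<not> ?thesis"
          then obtain x y where "x \<in> C i" "x \<in> A" "y \<in> C i" "y \<in> B" by blast
          then have "d \<le> dist x y" "dist x y \<le> diameter (C i)"
            using d(2) C(2) diameter_bounded_bound[of "C i" x y] by auto
          moreover have "diameter (C i) \<le> \<epsilon>" using C(2) by blast
          ultimately show False using \<epsilon> by linarith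
        qed
        moreover have "diameter (C i \<inter> A) \<le> diameter (C i)" "diameter (C i \<inter> B) \<le> diameter (C i)"
          using C(2) by (simp_all add: diameter_subset)
        ultimately show "ennreal (diameter (C i \<inter> A)) + ennreal (diameter (C i \<inter> B)) \<le> ennreal (diameter (C i))"
          by (auto intro: ennreal_leI)
      qed
      finally show "hausdorff1_pre \<epsilon> A + hausdorff1_pre \<epsilon> B \<le> (\<Sum>i. ennreal (diameter (C i)))" .
    qed
    then show ?thesis using hausdorff1_pre_le_hausdorff1[OF \<epsilon>(1)] order_trans by blast
  qed
  have "hausdorff1_pre \<epsilon> A + hausdorff1_pre \<epsilon>' B \<le> hausdorff1 (A \<union> B)" if "0 < \<epsilon>" "0 < \<epsilon>'" for \<epsilon> \<epsilon>'
  proof -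
    define m where "m = min (min \<epsilon> \<epsilon>') (d/2)"
    have "0 < m" "m < d" "m \<le> \<epsilon>" "m \<le> \<epsilon>'" using that d(1) by (auto simp: m_def)
    then show ?thesis
      using main[of m] hausdorff1_pre_antimono[of m \<epsilon> A] hausdorff1_pre_antimono[of m \<epsilon>' B]
      by (meson add_mono order_trans)
  qed
  then have "hausdorff1 A + hausdorff1_pre \<epsilon>' B \<le> hausdorff1 (A \<union> B)" if "0 < \<epsilon>'" for \<epsilon>'
    unfolding hausdorff1_def[of A] using that
    by (subst ennreal_SUP_add_left[symmetric]) (auto intro!: SUP_least)
  then show ?thesis
    unfolding hausdorff1_def[of B]
    by (subst ennreal_SUP_add_right) (auto intro!: SUP_least)
qed

lemma hausdorff1_separated_sum:
  fixes n :: nat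
  assumes d: "0 < d"
    "\<And>i j x y. i < j \<Longrightarrow> j < n \<Longrightarrow> x \<in> A i \<Longrightarrow> y \<in> A j \<Longrightarrow> d \<le> dist x y"
  shows "(\<Sum>i<n. hausdorff1 (A i)) \<le> hausdorff1 (\<Union>i<n. A i)"
proof -
  have *: "\<forall>i j x y. i < j \<longrightarrow> j < n \<longrightarrow> x \<in> A i \<longrightarrow> y \<in> A j \<longrightarrow> d \<le> dist x y"
    using d(2) by blast
  then show ?thesis
  proof (induction n)
    case 0
    then show ?case by simp
  next
    case (Suc n)
    have "(\<Sum>i<Suc n. hausdorff1 (A i)) \<le> hausdorff1 (\<Union>i<n. A i) + hausdorff1 (A n)"
      using Suc.IH Suc.prems by (simp add: add_mono)
    also have "\<dots> \<le> hausdorff1 ((\<Union>i<n. A i) \<union> A n)"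
      by (rule hausdorff1_separated[OF d(1)]) (use Suc.prems in auto)
    also have "(\<Union>i<n. A i) \<union> A n = (\<Union>i<Suc n. A i)" by (auto simp: less_Suc_eq)
    finally show ?case .
  qed
qed

lemma ennreal_suminf_tail:
  fixes f :: "nat \<Rightarrow> ennreal"
  assumes "(\<Sum>k. f k) < top" "0 < e"
  obtains n where "(\<Sum>k. f (k + n)) < ennreal e"
proof -
  have fin: "f k < top" for k using ennreal_suminf_lessD[OF assms(1)] .
  then have f: "f k = ennreal (enn2real (f k))" for k by simp
  have "(\<Sum>k. ennreal (enn2real (f k))) \<noteq> top" using assms(1) f by simp
  then have sm: "summable (\<lambda>k. enn2real (f k))"
    by (intro summable_suminf_not_top) auto
  then have "(\<lambda>n. \<Sum>k. enn2real (f (k + n))) \<longlonglongrightarrow> 0" by (rule suminf_exist_split2)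
  then have "eventually (\<lambda>n. (\<Sum>k. enn2real (f (k + n))) < e) sequentially"
    using assms(2) by (rule order_tendstoD)
  then obtain n where n: "(\<Sum>k. enn2real (f (k + n))) < e" by (auto simp: eventually_sequentially)
  have "(\<Sum>k. f (k + n)) = (\<Sum>k. ennreal (enn2real (f (k + n))))" using fin by simp
  also have "\<dots> = ennreal (\<Sum>k. enn2real (f (k + n)))"
    using sm by (intro suminf_ennreal2) (auto intro: summable_ignore_initial_segment)
  also have "\<dots> < ennreal e" using n assms(2) by (rule ennreal_lessI[rotated])
  finally show ?thesis by (rule that)
qed

text \<open>Caratheodory's criterion: the shells \<open>D k\<close> of points of \<open>E\<close> at distance about \<open>1/k\<close>
  from \<open>F\<close> are positively separated as soon as their indices have the same parity.\<close>

lemma hausdorff1_closed_split: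
  fixes F E :: "'a::metric_space set"
  assumes F: "closed F" "F \<noteq> {}" and fin: "hausdorff1 E < top"
  shows "hausdorff1 (E \<inter> F) + hausdorff1 (E - F) \<le> hausdorff1 E"
proof -
  define d where "d x = infdist x F" for x
  define D where "D k = {x\<in>E. 1 / (real k + 2) \<le> d x \<and> d x < 1 / (real k + 1)}" for k :: nat
  define E' where "E' n = {x\<in>E. 1 / (real n + 1) \<le> d x}" for n :: nat
  have d_lip: "d x - d y \<le> dist x y" for x y
    using infdist_triangle_abs[of x F y] by (simp add: d_def)
  have parity: "(\<Sum>i<n. hausdorff1 (D (2*i+p))) \<le> hausdorff1 E" if "p \<le> 1" for p n
  proof -
    have "(\<Sum>i<n. hausdorff1 (D (2*i+p))) \<le> hausdorff1 (\<Union>i<n. D (2*i+p))"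
    proof (rule hausdorff1_separated_sum)
      show "0 < 1 / ((2 * real n + 3) * (2 * real n + 4))" by simp
      fix i j x y assume ij: "i < j" "j < n" "x \<in> D (2*i+p)" "y \<in> D (2*j+p)"
      \<comment> \<open>Skipping one shell leaves a gap of at least
        \<open>1 / m - 1 / (m + 1)\<close>; it is bounded below uniformly because only
        \<open>n\<close> shells of each parity are involved.\<close>
      define m where "m = real (2*i+p) + 2"
      have m: "0 < m" "m \<le> 2 * real n + 3" "m + 1 \<le> 2 * real j + p + 1"
        using ij(1,2) \<open>p \<le> 1\<close> by (auto simp: m_def)
      have "1 / (2 * real j + p + 1) \<le> 1 / (m + 1)" using m by (intro divide_left_mono) auto
      then have "1 / m - 1 / (m + 1) \<le> d x - d y" using ij(3,4) by (simp add: D_def m_def)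
      also have "\<dots> \<le> dist x y" by (rule d_lip)
      also have "1 / m - 1 / (m + 1) = 1 / (m * (m + 1))" using m by (simp add: field_simps)
      finally have "1 / (m * (m + 1)) \<le> dist x y" .
      moreover have "1 / ((2 * real n + 3) * (2 * real n + 4)) \<le> 1 / (m * (m + 1))"
        using m by (intro divide_left_mono mult_mono) auto
      ultimately show "1 / ((2 * real n + 3) * (2 * real n + 4)) \<le> dist x y" by linarith
    qed
    also have "\<dots> \<le> hausdorff1 E" by (rule hausdorff1_mono) (auto simp: D_def)
    finally show ?thesis .
  qed
  \<comment> \<open>The even and the odd shells each contribute at most \<open>hausdorff1 E\<close>.
    Convergence of the series makes its tail, the part of \<open>E - F\<close> close to
    \<open>F\<close>, negligible.\<close>
  have "(\<Sum>k. hausdorff1 (D k)) \<le> hausdorff1 E + hausdorff1 E"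
  proof (rule suminf_le_const[OF summableI])
    fix n
    have "(\<Sum>k<2*n. hausdorff1 (D k)) = (\<Sum>i<n. hausdorff1 (D (2*i+0))) + (\<Sum>i<n. hausdorff1 (D (2*i+1)))"
      by (induction n) (auto simp: algebra_simps)
    then have "(\<Sum>k<2*n. hausdorff1 (D k)) \<le> hausdorff1 E + hausdorff1 E"
      using parity[of 0 n] parity[of 1 n] add_mono by fastforce
    moreover have "(\<Sum>k<n. hausdorff1 (D k)) \<le> (\<Sum>k<2*n. hausdorff1 (D k))"
      by (rule sum_mono2) auto
    ultimately show "(\<Sum>k<n. hausdorff1 (D k)) \<le> hausdorff1 E + hausdorff1 E" by order
  qed
  also have "\<dots> < top" using fin by simp
  finally have shells: "(\<Sum>k. hausdorff1 (D k)) < top" .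
  have split: "E - F \<subseteq> E' n \<union> (\<Union>k. D (k + n))" for n
  proof
    fix x assume x: "x \<in> E - F"
    then have pos: "0 < d x" using F infdist_pos_not_in_closed by (auto simp: d_def)
    show "x \<in> E' n \<union> (\<Union>k. D (k + n))"
    proof (cases "1 / (real n + 1) \<le> d x")
      case False
      define k where "k = (LEAST k. 1 / (real k + 2) \<le> d x)"
      have "\<exists>k. 1 / (real k + 2) \<le> d x"
      proof -
        obtain k :: nat where "1 / d x < real k" using reals_Archimedean2 by blast
        then have "1 / (real k + 2) \<le> d x" using pos by (simp add: field_simps)
        then show ?thesis ..
      qed
      then have k: "1 / (real k + 2) \<le> d x" unfolding k_def by (rule LeastI_ex)
      have kn: "n \<le> k"
      proof (rule ccontr)
        assume "\<not> n \<le> k"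
        then have "1 / (real n + 1) \<le> 1 / (real k + 2)" by (intro divide_left_mono) auto
        with k False show False by linarith
      qed
      have "d x < 1 / (real k + 1)"
      proof (cases "k = n")
        case False
        then have "\<not> 1 / (real (k - 1) + 2) \<le> d x" using kn
          by (intro not_less_Least[where P="\<lambda>k. 1 / (real k + 2) \<le> d x"]) (auto simp: k_def[symmetric])
        moreover have eq: "real (k - 1) + 2 = real k + 1" using kn False by (simp add: of_nat_diff)
        ultimately show ?thesis unfolding eq by simp
      qed (use False in simp)
      then have "x \<in> D ((k - n) + n)" using k x kn by (simp add: D_def)
      then show ?thesis by blast
    qed (use x in \<open>auto simp: E'_def\<close>)
  qed
  have "hausdorff1 (E \<inter> F) + hausdorff1 (E - F) \<le> hausdorff1 E + ennreal e" if e: "0 < e" for e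
  proof -
    obtain n where n: "(\<Sum>k. hausdorff1 (D (k + n))) < ennreal e"
      using ennreal_suminf_tail[OF shells e] .
    have "hausdorff1 (E - F) \<le> hausdorff1 (E' n) + hausdorff1 (\<Union>k. D (k + n))"
      using hausdorff1_mono[OF split] hausdorff1_Un order_trans by blast
    also have "\<dots> \<le> hausdorff1 (E' n) + ennreal e"
      using n hausdorff1_UN[of "\<lambda>k. D (k + n)"] by (intro add_left_mono) order
    finally have "hausdorff1 (E \<inter> F) + hausdorff1 (E - F)
        \<le> (hausdorff1 (E \<inter> F) + hausdorff1 (E' n)) + ennreal e"
      by (simp add: add.assoc add_left_mono)
    moreover have "hausdorff1 (E \<inter> F) + hausdorff1 (E' n) \<le> hausdorff1 (E \<inter> F \<union> E' n)"
    proof (rule hausdorff1_separated)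
      fix x y assume "x \<in> E \<inter> F" "y \<in> E' n"
      then show "1 / (real n + 1) \<le> dist x y"
        using d_lip[of y x] by (simp add: d_def E'_def dist_commute)
    qed simp
    moreover have "hausdorff1 (E \<inter> F \<union> E' n) \<le> hausdorff1 E"
      by (rule hausdorff1_mono) (auto simp: E'_def)
    ultimately show ?thesis by (meson add_right_mono order_trans)
  qed
  then show ?thesis by (rule ennreal_le_epsilon)
qed

section \<open>Caratheodory's construction and the resulting Borel measure\<close>

lemma outer_measure_space_hausdorff1: "outer_measure_space UNIV (hausdorff1 :: 'a::metric_space set \<Rightarrow> ennreal)"
  unfolding outer_measure_space_def positive_def increasing_def countably_subadditive_def
  using hausdorff1_mono hausdorff1_UN by auto

lemma sigma_algebra_UNIV: "sigma_algebra UNIV (UNIV :: 'a set set)"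
  using sigma_algebra_Pow[of "UNIV :: 'a set"] by simp

lemma hausdorff1_measure_space:
  "measure_space UNIV (lambda_system UNIV UNIV hausdorff1) (hausdorff1 :: 'a::metric_space set \<Rightarrow> ennreal)"
  by (rule sigma_algebra.caratheodory_lemma[OF sigma_algebra_UNIV outer_measure_space_hausdorff1])

text \<open>Closed sets generate the Borel sets, and for test sets of infinite measure the critical
  inequality is trivial, so the finite case in \<open>hausdorff1_closed_split\<close> is
  enough.\<close>

lemma borel_hausdorff1_measurable:
  "sets borel \<subseteq> lambda_system UNIV UNIV (hausdorff1 :: 'a::metric_space set \<Rightarrow> ennreal)"
proof -
  have "F \<in> lambda_system UNIV UNIV hausdorff1" if "closed F" for F :: "'a set"
  proof -
    have "hausdorff1 (F \<inter> E) + hausdorff1 ((UNIV - F) \<inter> E) = hausdorff1 E" for E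
    proof (rule antisym)
      have eq: "F \<inter> E = E \<inter> F" "(UNIV - F) \<inter> E = E - F" by auto
      show "hausdorff1 (F \<inter> E) + hausdorff1 ((UNIV - F) \<inter> E) \<le> hausdorff1 E"
      proof (cases "F = {} \<or> hausdorff1 E = top")
        case False
        then show ?thesis unfolding eq
          using hausdorff1_closed_split[of F E] that by (auto simp: less_top)
      qed auto
      have "hausdorff1 E \<le> hausdorff1 (F \<inter> E \<union> ((UNIV - F) \<inter> E))" by (rule hausdorff1_mono) auto
      then show "hausdorff1 E \<le> hausdorff1 (F \<inter> E) + hausdorff1 ((UNIV - F) \<inter> E)"
        using hausdorff1_Un order_trans by blast
    qed
    then show ?thesis by (simp add: lambda_system_def)
  qed
  then have "sigma_sets UNIV (Collect closed) \<subseteq> lambda_system UNIV UNIV (hausdorff1 :: 'a set \<Rightarrow> ennreal)"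
    using hausdorff1_measure_space[where ?'a='a]
    by (intro sigma_algebra.sigma_sets_subset) (auto simp: measure_space_def)
  then show ?thesis by (simp add: borel_eq_closed)
qed

definition hausdorff1_measure :: "'a::metric_space measure" where
  "hausdorff1_measure = measure_of UNIV (sets borel) hausdorff1"

lemma sets_hausdorff1_measure [measurable_cong, simp]: "sets hausdorff1_measure = sets borel"
  unfolding hausdorff1_measure_def by (metis sets.sets_measure_of_eq space_borel)

lemma space_hausdorff1_measure [simp]: "space hausdorff1_measure = UNIV"
  using sets_eq_imp_space_eq[OF sets_hausdorff1_measure] by simp

lemma emeasure_hausdorff1_measure:
  "B \<in> sets borel \<Longrightarrow> emeasure hausdorff1_measure B = hausdorff1 B"
proof -
  have "measure_space UNIV (sets borel) (hausdorff1 :: 'a set \<Rightarrow> ennreal)"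
    using sets.sigma_algebra_axioms[of borel]
    by (intro measure_down[OF hausdorff1_measure_space _ borel_hausdorff1_measurable]) auto
  then show "B \<in> sets borel \<Longrightarrow> emeasure hausdorff1_measure B = hausdorff1 B"
    unfolding hausdorff1_measure_def measure_space_def
    by (intro emeasure_measure_of_sigma) auto
qed

subsection \<open>Covering lemmas on the line\<close>

lemma AE_lborel_iff_negligible:
  "(AE x in lborel. P (x::'a::euclidean_space)) \<longleftrightarrow> negligible {x. \<not> P x}"
proof -
  have "(AE x in lborel. P x) \<longleftrightarrow> (AE x in lebesgue. P x)" by (simp add: AE_completion_iff)
  also have "\<dots> \<longleftrightarrow> {x. \<not> P x} \<in> null_sets lebesgue"
  proof
    assume "AE x in lebesgue. P x"
    then obtain N where N: "N \<in> null_sets lebesgue" "{x \<in> space lebesgue. \<not> P x} \<subseteq> N"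
      unfolding eventually_ae_filter by blast
    then show "{x. \<not> P x} \<in> null_sets lebesgue"
      using negligible_subset[of N "{x. \<not> P x}"] by (simp add: negligible_iff_null_sets)
  qed (rule AE_I', auto)
  finally show ?thesis by (simp add: negligible_iff_null_sets)
qed

lemma negligible_borel_superset:
  assumes "negligible (S :: 'a::euclidean_space set)"
  obtains G where "G \<in> null_sets lborel" "S \<subseteq> G"
proof -
  have "AE x in lborel. x \<notin> S" using assms by (simp add: AE_lborel_iff_negligible)
  then show ?thesis using that unfolding eventually_ae_filter by auto
qed

text \<open>Intersecting Borel covers of small measure gives a Borel null superset, so
  \<open>S\<close> itself need not be measurable; projections and exceptional sets are treated in
  this form.\<close>

lemma negligible_if_covers:
  fixes S :: "'a::euclidean_space set"
  assumes "\<And>e. 0 < e \<Longrightarrow> \<exists>V\<in>sets borel. S \<subseteq> V \<and> emeasure lborel V \<le> ennreal e"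
  shows "negligible S"
proof -
  have "\<exists>V\<in>sets borel. S \<subseteq> V \<and> emeasure lborel V \<le> ennreal (1 / real (Suc n))" for n
    using assms[of "1 / real (Suc n)"] by simp
  then obtain V where V: "\<And>n. V n \<in> sets borel" "\<And>n. S \<subseteq> V n"
    "\<And>n. emeasure lborel (V n) \<le> ennreal (1 / real (Suc n))" by metis
  have "emeasure lborel (\<Inter>n. V n) \<le> ennreal e" if "0 < e" for e
  proof -
    obtain n where "1 / real (Suc n) < e" using \<open>0 < e\<close> nat_approx_posE by blast
    then have "emeasure lborel (V n) \<le> ennreal e"
      using V(3)[of n] by (meson ennreal_leI less_imp_le order_trans)
    moreover have "emeasure lborel (\<Inter>n. V n) \<le> emeasure lborel (V n)"
      using V(1) by (intro emeasure_mono) auto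
    ultimately show ?thesis by order
  qed
  then have "emeasure lborel (\<Inter>n. V n) \<le> 0"
    by (intro ennreal_le_epsilon[of 0 "emeasure lborel (\<Inter>n. V n)"]) simp
  then have "(\<Inter>n. V n) \<in> null_sets lborel" using V(1) by (intro null_setsI) auto
  then have "(\<Inter>n. V n) \<in> null_sets lebesgue" by (rule null_sets_completionI)
  then show ?thesis
    using negligible_subset V(2) by (metis INT_greatest negligible_iff_null_sets)
qed

lemma disjoint_suminf_emeasure_le:
  fixes X :: "nat \<Rightarrow> 'a set"
  assumes "disjoint_family_on X J" "\<And>n. n \<in> J \<Longrightarrow> X n \<in> sets M" "\<And>n. n \<in> J \<Longrightarrow> X n \<subseteq> U" "U \<in> sets M"
  shows "(\<Sum>n. if n \<in> J then emeasure M (X n) else 0) \<le> emeasure M U"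
proof -
  define Y where "Y n = (if n \<in> J then X n else {})" for n
  have "(\<Sum>n. if n \<in> J then emeasure M (X n) else 0) = (\<Sum>n. emeasure M (Y n))"
    by (intro suminf_cong) (simp add: Y_def)
  also have "\<dots> = emeasure M (\<Union>n. Y n)"
    using assms(1,2) by (intro suminf_emeasure) (auto simp: Y_def disjoint_family_on_def)
  also have "\<dots> \<le> emeasure M U" using assms(3,4) by (intro emeasure_mono) (auto simp: Y_def)
  finally show ?thesis .
qed

text \<open>The countable subfamily from the covering lemma is re-indexed by a set \<open>J\<close>
  of natural numbers, so that measures can be added with \<open>suminf\<close>, with trivial terms
  outside \<open>J\<close>. Centres are functions of an index because in
  \<open>sparse_cones_small\<close> they are projections of points of the plane.\<close>

lemma vitali_sequence:
  fixes a :: "'i \<Rightarrow> real"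
  assumes r: "\<And>i. i \<in> K \<Longrightarrow> 0 < r i \<and> r i \<le> B"
  shows "\<exists>(x :: nat \<Rightarrow> 'i) J. (\<forall>n\<in>J. x n \<in> K) \<and> disjoint_family_on (\<lambda>n. cball (a (x n)) (r (x n))) J \<and>
    (\<forall>i\<in>K. \<exists>n\<in>J. a i \<in> cball (a (x n)) (5 * r (x n)))"
proof -
  have "a ` K \<subseteq> (\<Union>i\<in>K. cball (a i) (r i))" using r by force
  then obtain C where C: "countable C" "C \<subseteq> K"
    "pairwise (\<lambda>i j. disjnt (cball (a i) (r i)) (cball (a j) (r j))) C"
    "a ` K \<subseteq> (\<Union>i\<in>C. cball (a i) (5 * r i))"
    by (rule Vitali_covering_lemma_cballs[where S="a ` K" and K=K and a=a and r=r and B=B]) (use r in auto)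
  show ?thesis
  proof (intro exI[of _ "from_nat_into C"] exI[of _ "to_nat_on C ` C"] conjI ballI)
    have inv: "from_nat_into C (to_nat_on C i) = i" if "i \<in> C" for i
      using that C(1) by simp
    show "from_nat_into C n \<in> K" if "n \<in> to_nat_on C ` C" for n
      using that inv C(2) by auto
    show "disjoint_family_on (\<lambda>n. cball (a (from_nat_into C n)) (r (from_nat_into C n))) (to_nat_on C ` C)"
      unfolding disjoint_family_on_def
    proof (intro ballI impI)
      fix m n assume "m \<in> to_nat_on C ` C" "n \<in> to_nat_on C ` C" "m \<noteq> n"
      then obtain i j where "i \<in> C" "j \<in> C" "m = to_nat_on C i" "n = to_nat_on C j" "i \<noteq> j" by blast
      then show "cball (a (from_nat_into C m)) (r (from_nat_into C m)) \<inter>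
          cball (a (from_nat_into C n)) (r (from_nat_into C n)) = {}"
        using C(3) by (simp add: inv pairwise_def disjnt_def)
    qed
    show "\<exists>n\<in>to_nat_on C ` C. a i \<in> cball (a (from_nat_into C n)) (5 * r (from_nat_into C n))" if "i \<in> K" for i
      using that C(4) inv by force
  qed
qed

lemma emeasure_lborel_cball_real: "0 \<le> r \<Longrightarrow> emeasure lborel (cball (a::real) r) = ennreal (2 * r)"
  by (simp add: cball_eq_atLeastAtMost)

text \<open>The Hardy-Littlewood argument: the disjoint balls carry mass at most that of
  \<open>U\<close>, and the constant 10 is the enlargement factor 5 times the length 2 of a ball of
  radius 1. The Borel set \<open>V\<close> stands in for \<open>Y\<close>, which may fail to be
  measurable.\<close>

lemma weak_type:
  fixes \<nu> :: "real measure"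
  assumes sets: "sets \<nu> = sets borel" and U: "U \<in> sets borel" and l: "0 < l"
    and Y: "\<And>y. y \<in> Y \<Longrightarrow> \<exists>r. 0 < r \<and> r \<le> B \<and> cball y r \<subseteq> U \<and> ennreal (l * r) \<le> emeasure \<nu> (cball y r)"
  obtains V where "V \<in> sets borel" "Y \<subseteq> V" "ennreal l * emeasure lborel V \<le> 10 * emeasure \<nu> U"
proof -
  obtain r where r: "\<And>y. y \<in> Y \<Longrightarrow> 0 < r y \<and> r y \<le> B"
    "\<And>y. y \<in> Y \<Longrightarrow> cball y (r y) \<subseteq> U" "\<And>y. y \<in> Y \<Longrightarrow> ennreal (l * r y) \<le> emeasure \<nu> (cball y (r y))"
    using Y by metis
  obtain x :: "nat \<Rightarrow> real" and J :: "nat set" where x: "\<And>n. n \<in> J \<Longrightarrow> x n \<in> Y"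
    "disjoint_family_on (\<lambda>n. cball (x n) (r (x n))) J"
    "\<And>i. i \<in> Y \<Longrightarrow> \<exists>n\<in>J. i \<in> cball (x n) (5 * r (x n))"
    using vitali_sequence[where a="\<lambda>y. y" and K=Y and r=r, OF r(1)] by blast
  define W where "W n = (if n \<in> J then cball (x n) (5 * r (x n)) else {})" for n
  have "ennreal l * emeasure lborel (\<Union>n. W n) \<le> ennreal l * (\<Sum>n. emeasure lborel (W n))"
    by (intro mult_left_mono emeasure_subadditive_countably) (auto simp: W_def)
  also have "\<dots> = (\<Sum>n. ennreal l * emeasure lborel (W n))" by simp
  also have "\<dots> \<le> (\<Sum>n. 10 * (if n \<in> J then emeasure \<nu> (cball (x n) (r (x n))) else 0))"
  proof (intro suminf_le summableI)
    fix n
    show "ennreal l * emeasure lborel (W n) \<le> 10 * (if n \<in> J then emeasure \<nu> (cball (x n) (r (x n))) else 0)"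
    proof (cases "n \<in> J")
      case True
      have "ennreal l * emeasure lborel (W n) = ennreal l * ennreal (10 * r (x n))"
        using True r(1)[OF x(1)[OF True]] by (simp add: W_def emeasure_lborel_cball_real)
      also have "\<dots> = 10 * ennreal (l * r (x n))"
        using l r(1)[OF x(1)[OF True]] by (simp add: ennreal_mult'' ennreal_mult' mult_ac)
      also have "\<dots> \<le> 10 * emeasure \<nu> (cball (x n) (r (x n)))"
        by (intro mult_left_mono r(3) x(1) True) auto
      finally show ?thesis using True by simp
    qed (simp add: W_def)
  qed
  also have "\<dots> = 10 * (\<Sum>n. if n \<in> J then emeasure \<nu> (cball (x n) (r (x n))) else 0)" by simp
  also have "\<dots> \<le> 10 * emeasure \<nu> U"
    by (intro mult_left_mono disjoint_suminf_emeasure_le[OF x(2)]) (use x(1) r(2) U sets in auto)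
  finally show ?thesis
    by (intro that[of "\<Union>n. W n"]) (use x(3) in \<open>auto simp: W_def\<close>)
qed

text \<open>At a bad point the complement of \<open>C\<close> has large averages at arbitrarily
  small scales, hence on balls inside an open \<open>U\<close> barely larger than \<open>C\<close>;
  there its total mass is small and the weak type inequality applies.\<close>

lemma lebesgue_density:
  fixes C :: "real set"
  assumes C: "C \<in> sets borel" and \<eta>: "0 < \<eta>"
  shows "AE t in lborel. t \<in> C \<longrightarrow>
    (\<exists>s0>0. \<forall>s. 0 < s \<and> s \<le> s0 \<longrightarrow> emeasure lborel (cball t s - C) \<le> ennreal (\<eta> * s))"
  unfolding AE_lborel_iff_negligible
proof (rule negligible_if_covers)
  fix e :: real assume e: "0 < e"
  let ?Bad = "{t. \<not> (t \<in> C \<longrightarrow>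
    (\<exists>s0>0. \<forall>s. 0 < s \<and> s \<le> s0 \<longrightarrow> emeasure lborel (cball t s - C) \<le> ennreal (\<eta> * s)))}"
  have "C \<in> sets lebesgue" using C by (simp add: sets_completionI_sets)
  \<comment> \<open>The factor \<open>\<eta> / 10\<close> cancels the constant of
    \<open>weak_type\<close> at level \<open>\<eta>\<close>.\<close>
  moreover have "0 < e * \<eta> / 10" using e \<eta> by simp
  ultimately obtain U where U: "open U" "C \<subseteq> U" "emeasure lebesgue (U - C) < ennreal (e * \<eta> / 10)"
    using sets_lebesgue_outer_open by metis
  define \<nu> where "\<nu> = density lborel (indicator (- C))"
  have \<nu>: "emeasure \<nu> B = emeasure lborel (B - C)" if "B \<in> sets borel" for B
    using that C emeasure_restricted[of "- C" lborel B] by (simp add: \<nu>_def Diff_eq Int_commute)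
  have "\<exists>r. 0 < r \<and> r \<le> 1 \<and> cball t r \<subseteq> U \<and> ennreal (\<eta> * r) \<le> emeasure \<nu> (cball t r)" if "t \<in> ?Bad" for t
  proof -
    have t: "t \<in> C" "\<And>s0. 0 < s0 \<Longrightarrow> \<exists>s. 0 < s \<and> s \<le> s0 \<and> ennreal (\<eta> * s) < emeasure lborel (cball t s - C)"
      using that by (auto simp: not_le)
    obtain d where d: "0 < d" "cball t d \<subseteq> U" using U t(1) open_contains_cball by blast
    obtain s where s: "0 < s" "s \<le> min d 1" "ennreal (\<eta> * s) < emeasure lborel (cball t s - C)"
      using t(2)[of "min d 1"] d(1) by auto
    have "cball t s \<subseteq> cball t d" using s by (intro subset_cball) auto
    then show ?thesis using s d by (intro exI[of _ s]) (auto simp: \<nu>)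
  qed
  then obtain V where V: "V \<in> sets borel" "?Bad \<subseteq> V" "ennreal \<eta> * emeasure lborel V \<le> 10 * emeasure \<nu> U"
    using weak_type[of \<nu> U \<eta> ?Bad 1] U(1) \<eta> by (auto simp: \<nu>_def)
  have "emeasure \<nu> U = emeasure lebesgue (U - C)" using U(1) C by (simp add: \<nu>)
  also have "\<dots> \<le> ennreal (e * \<eta> / 10)" using U(3) by simp
  finally have "10 * emeasure \<nu> U \<le> 10 * ennreal (e * \<eta> / 10)" by (intro mult_left_mono) auto
  also have "\<dots> = ennreal \<eta> * ennreal e"
    using e \<eta> by (simp add: ennreal_mult'[symmetric] ennreal_numeral[symmetric] mult.commute del: ennreal_numeral)
  finally have "ennreal \<eta> * emeasure lborel V \<le> ennreal \<eta> * ennreal e" using V(3) by order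
  then have "emeasure lborel V \<le> ennreal e"
    using \<eta> by (subst (asm) ennreal_mult_le_mult_iff) auto
  then show "\<exists>V\<in>sets borel. ?Bad \<subseteq> V \<and> emeasure lborel V \<le> ennreal e" using V by blast
qed

text \<open>The images of the enlarged Vitali balls form a cover whose diameters are controlled by
  the lengths of disjoint balls inside \<open>U\<close>. The radius may be chosen anew for each
  \<open>\<epsilon>\<close>, and the \<open>min\<close> keeps the cover admissible at that scale.
  Both Lipschitz images and the differentiation argument for curves are instances.\<close>

lemma hausdorff1_image_le:
  fixes g :: "real \<Rightarrow> 'b::metric_space"
  assumes U: "U \<in> sets borel" and \<eta>: "0 \<le> \<eta>"
    and S: "\<And>x \<epsilon>. x \<in> S \<Longrightarrow> 0 < \<epsilon> \<Longrightarrow> \<exists>r. 0 < r \<and> r \<le> 1 \<and> cball x r \<subseteq> U \<and>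
      (\<forall>u\<in>cball x (5 * r) \<inter> S. \<forall>v\<in>cball x (5 * r) \<inter> S. dist (g u) (g v) \<le> min \<epsilon> (\<eta> * r))"
  shows "hausdorff1 (g ` S) \<le> ennreal \<eta> * emeasure lborel U"
proof (rule hausdorff1_leI)
  fix \<epsilon> :: real assume \<epsilon>: "0 < \<epsilon>"
  obtain r where r: "\<And>y. y \<in> S \<Longrightarrow> 0 < r y \<and> r y \<le> 1"
    "\<And>y. y \<in> S \<Longrightarrow> cball y (r y) \<subseteq> U"
    "\<And>y u v. y \<in> S \<Longrightarrow> u \<in> cball y (5 * r y) \<inter> S \<Longrightarrow> v \<in> cball y (5 * r y) \<inter> S \<Longrightarrow>
      dist (g u) (g v) \<le> min \<epsilon> (\<eta> * r y)"
    using S[OF _ \<epsilon>] by metis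
  obtain x :: "nat \<Rightarrow> real" and J :: "nat set" where x: "\<And>n. n \<in> J \<Longrightarrow> x n \<in> S"
    "disjoint_family_on (\<lambda>n. cball (x n) (r (x n))) J"
    "\<And>i. i \<in> S \<Longrightarrow> \<exists>n\<in>J. i \<in> cball (x n) (5 * r (x n))"
    using vitali_sequence[where a="\<lambda>y. y" and K=S and r=r, OF r(1)] by blast
  define W where "W n = (if n \<in> J then g ` (cball (x n) (5 * r (x n)) \<inter> S) else {})" for n
  have W: "bounded (W n) \<and> diameter (W n) \<le> \<epsilon> \<and> diameter (W n) \<le> (if n \<in> J then \<eta> * r (x n) else 0)" for n
  proof (cases "n \<in> J")
    case True
    have xin: "x n \<in> cball (x n) (5 * r (x n)) \<inter> S" using r(1) x(1) True by (auto simp: less_imp_le)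
    have *: "\<And>p q. p \<in> W n \<Longrightarrow> q \<in> W n \<Longrightarrow> dist p q \<le> min \<epsilon> (\<eta> * r (x n))"
      using r(3)[OF x(1)[OF True]] True by (auto simp: W_def)
    then have b: "bounded (W n)" unfolding bounded_two_points by blast
    have ne: "W n \<noteq> {}" using imageI[OF xin, of g] True unfolding W_def by (metis empty_iff)
    have "diameter (W n) \<le> min \<epsilon> (\<eta> * r (x n))"
      using ne * unfolding diameter_def by (auto intro!: cSUP_least)
    then show ?thesis using b True by auto
  qed (use \<epsilon> in \<open>auto simp: W_def\<close>)
  have "hausdorff1_pre \<epsilon> (g ` S) \<le> (\<Sum>n. ennreal (diameter (W n)))"
  proof (rule hausdorff1_pre_le)
    show "g ` S \<subseteq> (\<Union>n. W n)"
    proof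
      fix y assume "y \<in> g ` S"
      then obtain u where u: "u \<in> S" "y = g u" by blast
      then obtain n where "n \<in> J" "u \<in> cball (x n) (5 * r (x n))" using x(3) by blast
      then have "y \<in> W n" using u unfolding W_def by auto
      then show "y \<in> (\<Union>n. W n)" by blast
    qed
  qed (use W in blast)+
  also have "\<dots> \<le> (\<Sum>n. ennreal \<eta> * (if n \<in> J then emeasure lborel (cball (x n) (r (x n))) else 0))"
  proof (intro suminf_le summableI)
    fix n
    show "ennreal (diameter (W n)) \<le> ennreal \<eta> * (if n \<in> J then emeasure lborel (cball (x n) (r (x n))) else 0)"
    proof (cases "n \<in> J")
      case True
      then have rn: "0 < r (x n)" using r(1) x(1) by auto
      have "diameter (W n) \<le> \<eta> * (2 * r (x n))" using W[of n] True rn \<eta>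
        by (smt (verit) mult_nonneg_nonneg mult_left_mono)
      then have "ennreal (diameter (W n)) \<le> ennreal \<eta> * ennreal (2 * r (x n))"
        using \<eta> rn by (simp add: ennreal_mult[symmetric] ennreal_leI)
      then show ?thesis using True rn by (simp add: emeasure_lborel_cball_real)
    qed (simp add: W_def)
  qed
  also have "\<dots> = ennreal \<eta> * (\<Sum>n. if n \<in> J then emeasure lborel (cball (x n) (r (x n))) else 0)" by simp
  also have "\<dots> \<le> ennreal \<eta> * emeasure lborel U"
    by (intro mult_left_mono disjoint_suminf_emeasure_le[OF x(2)]) (use x(1) r(2) U in auto)
  finally show "hausdorff1_pre \<epsilon> (g ` S) \<le> ennreal \<eta> * emeasure lborel U" .
qed

text \<open>The factor 10 arises since two points of a ball of radius \<open>5 * r\<close> are at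
  most \<open>10 * r\<close> apart.\<close>

lemma hausdorff1_lipschitz_image_le:
  fixes g :: "real \<Rightarrow> 'b::metric_space"
  assumes g: "L-lipschitz_on S g" and U: "open U" "S \<subseteq> U"
  shows "hausdorff1 (g ` S) \<le> ennreal (10 * L) * emeasure lborel U"
proof (rule hausdorff1_image_le)
  have L: "0 \<le> L" using g by (rule lipschitz_on_nonneg)
  then show "0 \<le> 10 * L" by simp
  fix x \<epsilon> :: real assume x: "x \<in> S" and \<epsilon>: "0 < \<epsilon>"
  obtain d where d: "0 < d" "cball x d \<subseteq> U" using U x open_contains_cball by blast
  define r where "r = min (min d 1) (\<epsilon> / (10 * L + 1))"
  have r: "0 < r" "r \<le> d" "r \<le> 1" "r \<le> \<epsilon> / (10 * L + 1)" using d \<epsilon> L by (auto simp: r_def)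
  have rL: "10 * L * r \<le> \<epsilon>"
  proof -
    have "(10 * L + 1) * r \<le> \<epsilon>" using r(4) L by (simp add: pos_le_divide_eq mult.commute)
    then show ?thesis using r(1) by (simp add: algebra_simps)
  qed
  have "dist (g u) (g v) \<le> 10 * L * r" if "u \<in> cball x (5 * r) \<inter> S" "v \<in> cball x (5 * r) \<inter> S" for u v
  proof -
    have "dist u v \<le> 10 * r" using that dist_triangle2[of u v x] by (auto simp: dist_commute)
    then have "L * dist u v \<le> L * (10 * r)" using L by (intro mult_left_mono)
    then show ?thesis using lipschitz_onD[OF g, of u v] that by simp
  qed
  moreover have "cball x r \<subseteq> U" using d(2) r(2) subset_cball by blast
  ultimately show "\<exists>r. 0 < r \<and> r \<le> 1 \<and> cball x r \<subseteq> U \<and>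
      (\<forall>u\<in>cball x (5 * r) \<inter> S. \<forall>v\<in>cball x (5 * r) \<inter> S. dist (g u) (g v) \<le> min \<epsilon> (10 * L * r))"
    using r rL by (intro exI[of _ r]) (auto intro: order_trans)
qed (use U in auto)

lemma hausdorff1_lipschitz_image_negligible:
  fixes g :: "real \<Rightarrow> 'b::metric_space"
  assumes g: "L-lipschitz_on S g" and S: "negligible S"
  shows "hausdorff1 (g ` S) = 0"
proof -
  have L: "0 \<le> L" using g by (rule lipschitz_on_nonneg)
  have "hausdorff1 (g ` S) \<le> 0 + ennreal e" if e: "0 < e" for e
  proof -
    have "S \<in> sets lebesgue" "emeasure lebesgue S = 0"
      using S by (auto simp: negligible_iff_null_sets)
    moreover have "0 < e / (10 * L + 1)" using e L by simp
    ultimately obtain U where U: "open U" "S \<subseteq> U" "emeasure lebesgue (U - S) < ennreal (e / (10 * L + 1))"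
      using sets_lebesgue_outer_open by metis
    have "emeasure lborel U = emeasure lebesgue U" using U(1) by simp
    also have "\<dots> \<le> emeasure lebesgue (U - S) + emeasure lebesgue S"
      using U \<open>S \<in> sets lebesgue\<close> by (intro order_trans[OF emeasure_mono emeasure_subadditive]) auto
    also have "\<dots> \<le> ennreal (e / (10 * L + 1))" using U(3) \<open>emeasure lebesgue S = 0\<close> by simp
    finally have "hausdorff1 (g ` S) \<le> ennreal (10 * L) * ennreal (e / (10 * L + 1))"
      by (intro order_trans[OF hausdorff1_lipschitz_image_le[OF g U(1,2)] mult_left_mono]) auto
    also have "\<dots> = ennreal (10 * L * (e / (10 * L + 1)))" using L e by (intro ennreal_mult[symmetric]) auto
    also have "\<dots> \<le> ennreal e" using L e by (intro ennreal_leI) (simp add: field_simps)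
    finally show ?thesis by simp
  qed
  then have "hausdorff1 (g ` S) \<le> 0" by (rule ennreal_le_epsilon)
  then show ?thesis by simp
qed

lemma lipschitz_image_interval:
  fixes p :: "'a::metric_space \<Rightarrow> real"
  assumes p: "L-lipschitz_on UNIV p" and C: "bounded C"
  shows "\<exists>I\<in>sets borel. p ` C \<subseteq> I \<and> emeasure lborel I \<le> ennreal (2 * L) * ennreal (diameter C)"
proof (cases "C = {}")
  case False
  have L: "0 \<le> L" using p by (rule lipschitz_on_nonneg)
  from False obtain c where c: "c \<in> C" by blast
  have "dist (p c) (p x) \<le> L * diameter C" if "x \<in> C" for x
  proof -
    have "dist (p c) (p x) \<le> L * dist c x" using p by (auto intro: lipschitz_onD)
    also have "\<dots> \<le> L * diameter C" using diameter_bounded_bound[OF C c that] L by (rule mult_left_mono)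
    finally show ?thesis .
  qed
  moreover have "emeasure lborel (cball (p c) (L * diameter C)) = ennreal (2 * L) * ennreal (diameter C)"
    using L diameter_ge_0[OF C] by (simp add: emeasure_lborel_cball_real ennreal_mult[symmetric] mult.assoc)
  ultimately show ?thesis by (intro bexI[of _ "cball (p c) (L * diameter C)"]) auto
qed auto

lemma lipschitz_image_cover:
  fixes p :: "'a::metric_space \<Rightarrow> real"
  assumes p: "L-lipschitz_on UNIV p" and A: "hausdorff1 A < c"
  obtains V where "V \<in> sets borel" "p ` A \<subseteq> V" "emeasure lborel V \<le> ennreal (2 * L) * c"
proof -
  have "hausdorff1_pre 1 A < c" using A hausdorff1_pre_le_hausdorff1[of 1 A] by simp
  then obtain C where C: "A \<subseteq> (\<Union>i::nat. C i)" "\<And>i. bounded (C i)"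
    "(\<Sum>i. ennreal (diameter (C i))) < c" by (elim hausdorff1_pre_lessE) blast
  obtain I where I: "\<And>i. I i \<in> sets borel" "\<And>i. p ` C i \<subseteq> I i"
    "\<And>i. emeasure lborel (I i) \<le> ennreal (2 * L) * ennreal (diameter (C i))"
    using lipschitz_image_interval[OF p C(2)] by metis
  have "emeasure lborel (\<Union>i. I i) \<le> (\<Sum>i. emeasure lborel (I i))"
    using I(1) by (intro emeasure_subadditive_countably) auto
  also have "\<dots> \<le> (\<Sum>i. ennreal (2 * L) * ennreal (diameter (C i)))" by (intro suminf_le I summableI)
  also have "\<dots> \<le> ennreal (2 * L) * c" using C(3) by (simp add: mult_left_mono)
  finally show ?thesis
  proof (intro that[of "\<Union>i. I i"])
    show "p ` A \<subseteq> (\<Union>i. I i)" using C(1) I(2) by (fastforce simp: image_subset_iff)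
  qed (use I in auto)
qed

lemma lipschitz_image_negligible:
  fixes p :: "'a::metric_space \<Rightarrow> real"
  assumes p: "L-lipschitz_on UNIV p" and A: "hausdorff1 A = 0"
  shows "negligible (p ` A)"
proof (rule negligible_if_covers)
  have L: "0 \<le> L" using p by (rule lipschitz_on_nonneg)
  fix e :: real assume e: "0 < e"
  have "hausdorff1 A < ennreal (e / (2 * L + 1))" using A e L by simp
  then obtain V where V: "V \<in> sets borel" "p ` A \<subseteq> V"
    "emeasure lborel V \<le> ennreal (2 * L) * ennreal (e / (2 * L + 1))" by (rule lipschitz_image_cover[OF p])
  have "ennreal (2 * L) * ennreal (e / (2 * L + 1)) \<le> ennreal e"
    using L e by (simp add: ennreal_mult[symmetric] ennreal_leI field_simps del: ennreal_mult)
  then show "\<exists>V\<in>sets borel. p ` A \<subseteq> V \<and> emeasure lborel V \<le> ennreal e" using V order_trans by blast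
qed

section \<open>Finiteness of almost all fibres of a Lipschitz function\<close>

lemma finite_separated:
  assumes "finite (F :: 'a::metric_space set)"
  obtains d where "0 < d" "\<And>x y. x \<in> F \<Longrightarrow> y \<in> F \<Longrightarrow> x \<noteq> y \<Longrightarrow> d \<le> dist x y"
proof -
  define D where "D = insert 1 ((\<lambda>(x, y). dist x y) ` {(x, y). x \<in> F \<and> y \<in> F \<and> x \<noteq> y})"
  have "finite {(x, y). x \<in> F \<and> y \<in> F \<and> x \<noteq> y}"
    by (rule finite_subset[OF _ finite_cartesian_product[OF assms assms]]) auto
  then have "finite D" by (simp add: D_def)
  moreover have "0 < Min D" using \<open>finite D\<close> by (subst Min_gr_iff) (auto simp: D_def)
  ultimately show ?thesis by (intro that[of "Min D"]) (auto simp: D_def intro!: Min_le)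
qed

text \<open>For covers of mesh \<open>1 / (real k + 1)\<close> let \<open>g k y\<close> count the
  covering sets whose image intervals contain \<open>y\<close>. Its integral is bounded
  independently of \<open>k\<close>, so by Fatou's lemma the lower limit is finite almost
  everywhere. On an infinite fibre it is infinite: \<open>m\<close> points of the fibre lie in
  different covering sets once the mesh is below their separation. Counting intervals instead of
  points avoids any measurability question about \<open>A\<close>.\<close>

lemma AE_finite_fibers:
  fixes p :: "'a::metric_space \<Rightarrow> real"
  assumes p: "L-lipschitz_on UNIV p" and A: "hausdorff1 A < \<infinity>"
  shows "AE y in lborel. finite {x\<in>A. p x = y}"
proof -
  define h where "h = hausdorff1 A + 1"
  have h: "h < top" using A by (simp add: h_def)
  have "\<exists>C::nat\<Rightarrow>'a set. A \<subseteq> (\<Union>i. C i) \<and> (\<forall>i. bounded (C i) \<and> diameter (C i) \<le> 1 / (real k + 1)) \<and>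
      (\<Sum>i. ennreal (diameter (C i))) < h" for k :: nat
  proof -
    have "hausdorff1_pre (1 / (real k + 1)) A \<le> hausdorff1 A" by (rule hausdorff1_pre_le_hausdorff1) simp
    also have "\<dots> < h" using A ennreal_add_left_cancel_less[of "hausdorff1 A" 0 1] by (simp add: h_def)
    finally show ?thesis by (elim hausdorff1_pre_lessE) blast
  qed
  then obtain C :: "nat \<Rightarrow> nat \<Rightarrow> 'a set" where C: "\<And>k. A \<subseteq> (\<Union>i. C k i)" "\<And>k i. bounded (C k i)"
    "\<And>k i. diameter (C k i) \<le> 1 / (real k + 1)" "\<And>k. (\<Sum>i. ennreal (diameter (C k i))) < h"
    by metis
  obtain I where I: "\<And>k i. I k i \<in> sets borel" "\<And>k i. p ` C k i \<subseteq> I k i"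
    "\<And>k i. emeasure lborel (I k i) \<le> ennreal (2 * L) * ennreal (diameter (C k i))"
    using lipschitz_image_interval[OF p C(2)] by metis
  define g where "g k y = (\<Sum>i. indicator (I k i) y :: ennreal)" for k y
  have meas[measurable]: "g k \<in> borel_measurable lborel" for k
    unfolding g_def using I(1) by measurable
  have int: "(\<integral>\<^sup>+y. g k y \<partial>lborel) \<le> ennreal (2 * L) * h" for k
  proof -
    have "(\<integral>\<^sup>+y. g k y \<partial>lborel) = (\<Sum>i. emeasure lborel (I k i))"
      unfolding g_def using I(1) by (subst nn_integral_suminf) auto
    also have "\<dots> \<le> (\<Sum>i. ennreal (2 * L) * ennreal (diameter (C k i)))" by (intro suminf_le I summableI)
    also have "\<dots> \<le> ennreal (2 * L) * h" using C(4)[of k] by (simp add: mult_left_mono)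
    finally show ?thesis .
  qed
  have "(\<integral>\<^sup>+y. liminf (\<lambda>k. g k y) \<partial>lborel) \<le> liminf (\<lambda>k. \<integral>\<^sup>+y. g k y \<partial>lborel)"
    by (intro nn_integral_liminf) measurable
  also have "\<dots> \<le> limsup (\<lambda>k. \<integral>\<^sup>+y. g k y \<partial>lborel)" by (rule Liminf_le_Limsup) simp
  also have "\<dots> \<le> ennreal (2 * L) * h" by (rule Limsup_bounded) (simp add: int)
  also have "\<dots> < top" using h by (simp add: ennreal_mult_less_top)
  finally have "AE y in lborel. liminf (\<lambda>k. g k y) \<noteq> \<infinity>"
    by (intro nn_integral_PInf_AE) auto
  then show ?thesis
  proof (rule AE_mp, intro AE_I2 impI)
    fix y assume fin: "liminf (\<lambda>k. g k y) \<noteq> \<infinity>"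
    show "finite {x\<in>A. p x = y}"
    proof (rule ccontr)
      assume inf: "infinite {x\<in>A. p x = y}"
      have "of_nat m \<le> liminf (\<lambda>k. g k y)" for m :: nat
      proof (rule Liminf_bounded)
        obtain F where F: "finite F" "card F = m" "F \<subseteq> {x\<in>A. p x = y}"
          using inf infinite_arbitrarily_large by metis
        obtain d where d: "0 < d" "\<And>x x'. x \<in> F \<Longrightarrow> x' \<in> F \<Longrightarrow> x \<noteq> x' \<Longrightarrow> d \<le> dist x x'"
          using finite_separated[OF F(1)] by blast
        obtain k0 where k0: "1 / real (Suc k0) < d" using d(1) nat_approx_posE by blast
        have "of_nat m \<le> g k y" if k: "k0 \<le> k" for k
        proof -
          have "1 / (real k + 1) \<le> 1 / real (Suc k0)" using k by (intro divide_left_mono) auto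
          with k0 have kd: "1 / (real k + 1) < d" by linarith
          have "\<forall>x\<in>F. \<exists>i. x \<in> C k i" using F(3) C(1)[of k] by blast
          then obtain i where i: "\<And>x. x \<in> F \<Longrightarrow> x \<in> C k (i x)" by metis
          have inj: "inj_on i F"
          proof (rule inj_onI, rule ccontr)
            fix x x' assume x: "x \<in> F" "x' \<in> F" "i x = i x'" "x \<noteq> x'"
            then have "dist x x' \<le> diameter (C k (i x))"
              using i[of x] i[of x'] C(2) by (intro diameter_bounded_bound) auto
            with d(2)[of x x'] x C(3)[of k "i x"] kd show False by linarith
          qed
          have "(of_nat m :: ennreal) = (\<Sum>j\<in>i ` F. indicator (I k j) y)"
          proof -
            have "(\<Sum>j\<in>i ` F. indicator (I k j) y :: ennreal) = (\<Sum>j\<in>i ` F. 1)"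
              by (intro sum.cong refl) (use I(2) i F(3) in \<open>force simp: indicator_def\<close>)
            then show ?thesis using card_image[OF inj] F(2) by simp
          qed
          also have "\<dots> \<le> g k y" unfolding g_def using F(1) by (intro sum_le_suminf summableI) auto
          finally show ?thesis .
        qed
        then show "\<forall>\<^sub>F k in sequentially. of_nat m \<le> g k y" by (auto simp: eventually_sequentially)
      qed
      moreover obtain m :: nat where "liminf (\<lambda>k. g k y) < of_nat m"
        using fin ennreal_Ex_less_of_nat by (auto simp: less_top)
      ultimately show False by (meson leD)
    qed
  qed
qed

section \<open>Regularity of the Hausdorff measure: Borel hulls and compact subsets\<close>

lemma borel_superset_hausdorff1:
  fixes A :: "'a::metric_space set"
  assumes "hausdorff1 A < \<infinity>"
  obtains G where "G \<in> sets borel" "A \<subseteq> G" "hausdorff1 G = hausdorff1 A"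
proof -
  have "\<exists>C::nat\<Rightarrow>'a set. A \<subseteq> (\<Union>i. C i) \<and> (\<forall>i. bounded (C i) \<and> diameter (C i) \<le> 1 / real (Suc m)) \<and>
      (\<Sum>i. ennreal (diameter (C i))) < hausdorff1 A + ennreal (1 / real (Suc m))" for m
  proof -
    have "hausdorff1_pre (1 / real (Suc m)) A \<le> hausdorff1 A" by (rule hausdorff1_pre_le_hausdorff1) simp
    also have "\<dots> < hausdorff1 A + ennreal (1 / real (Suc m))"
      using assms ennreal_add_left_cancel_less[of "hausdorff1 A" 0 "ennreal (1 / real (Suc m))"] by simp
    finally show ?thesis by (elim hausdorff1_pre_lessE) blast
  qed
  then obtain C :: "nat \<Rightarrow> nat \<Rightarrow> 'a set" where C: "\<And>m. A \<subseteq> (\<Union>i. C m i)" "\<And>m i. bounded (C m i)"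
    "\<And>m i. diameter (C m i) \<le> 1 / real (Suc m)"
    "\<And>m. (\<Sum>i. ennreal (diameter (C m i))) < hausdorff1 A + ennreal (1 / real (Suc m))"
    by metis
  \<comment> \<open>Closures have the same diameter, so the nearly optimal covers may be replaced by
    closed ones; \<open>G\<close> is then Borel and still covered nearly optimally at every
    scale.\<close>
  define G where "G = (\<Inter>m. \<Union>i. closure (C m i))"
  have sub: "A \<subseteq> G" unfolding G_def
  proof (rule INT_greatest)
    show "A \<subseteq> (\<Union>i. closure (C m i))" for m
      using C(1)[of m] by (rule order_trans) (intro UN_mono closure_subset order_refl)
  qed
  have "hausdorff1 G \<le> hausdorff1 A"
  proof (rule hausdorff1_leI)
    fix \<epsilon> :: real assume \<epsilon>: "0 < \<epsilon>"
    have "hausdorff1_pre \<epsilon> G \<le> hausdorff1 A + ennreal e" if e: "0 < e" for e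
    proof -
      obtain m where m: "1 / real (Suc m) < min \<epsilon> e" using \<epsilon> e nat_approx_posE[of "min \<epsilon> e"] by auto
      have "hausdorff1_pre \<epsilon> G \<le> (\<Sum>i. ennreal (diameter (closure (C m i))))"
      proof (rule hausdorff1_pre_le)
        show "G \<subseteq> (\<Union>i. closure (C m i))" unfolding G_def by blast
        show "bounded (closure (C m i))" "diameter (closure (C m i)) \<le> \<epsilon>" for i
          using C(2)[of m i] C(3)[of m i] m by (auto simp: diameter_closure)
      qed
      also have "\<dots> \<le> hausdorff1 A + ennreal (1 / real (Suc m))"
        using C(2) less_imp_le[OF C(4)[of m]] by (simp add: diameter_closure)
      also have "\<dots> \<le> hausdorff1 A + ennreal e" using m by (intro add_left_mono ennreal_leI) simp
      finally show ?thesis .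
    qed
    then show "hausdorff1_pre \<epsilon> G \<le> hausdorff1 A" by (rule ennreal_le_epsilon)
  qed
  then have "hausdorff1 G = hausdorff1 A" using hausdorff1_mono[OF sub] by (rule antisym)
  moreover have "G \<in> sets borel" unfolding G_def by (intro sets.countable_INT' sets.countable_UN) auto
  ultimately show ?thesis using sub that by blast
qed

text \<open>Lives on the Borel sets of the whole space instead of a subspace, so that Fubini's
  theorem and inner regularity apply directly.\<close>

definition hausdorff1_on :: "'a::metric_space set \<Rightarrow> 'a measure" where
  "hausdorff1_on A = density hausdorff1_measure (indicator A)"

lemma sets_hausdorff1_on [measurable_cong, simp]: "sets (hausdorff1_on A) = sets borel"
  by (simp add: hausdorff1_on_def)

lemma space_hausdorff1_on [simp]: "space (hausdorff1_on A) = UNIV"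
  by (simp add: hausdorff1_on_def)

lemma emeasure_hausdorff1_on:
  "A \<in> sets borel \<Longrightarrow> B \<in> sets borel \<Longrightarrow> emeasure (hausdorff1_on A) B = hausdorff1 (A \<inter> B)"
  unfolding hausdorff1_on_def
  by (subst emeasure_restricted) (auto simp: emeasure_hausdorff1_measure)

lemma finite_measure_hausdorff1_on:
  "A \<in> sets borel \<Longrightarrow> hausdorff1 A < \<infinity> \<Longrightarrow> finite_measure (hausdorff1_on A)"
  by (rule finite_measureI) (simp add: emeasure_hausdorff1_on)

text \<open>Caratheodory measurability makes the difference between a Borel hull and
  \<open>A\<close> null. Removing a Borel null hull of that difference leaves a Borel subset of
  \<open>A\<close> of full measure, to which inner regularity of finite Borel measures on Polish
  spaces applies.\<close>

lemma hausdorff1_measurable_compact_approx: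
  fixes A :: "'a::polish_space set"
  assumes A: "hausdorff1_measurable A" "hausdorff1 A < \<infinity>"
  obtains K :: "nat \<Rightarrow> 'a set" where "\<And>n. compact (K n)" "\<And>n. K n \<subseteq> A" "hausdorff1 (A - (\<Union>n. K n)) = 0"
proof -
  have split: "hausdorff1 (A \<inter> X) + hausdorff1 (X - A) = hausdorff1 X" for X
  proof -
    have "hausdorff1 (A \<inter> X) + hausdorff1 ((UNIV - A) \<inter> X) = hausdorff1 X"
      using A(1) unfolding hausdorff1_measurable_def lambda_system_def by blast
    moreover have "(UNIV - A) \<inter> X = X - A" by auto
    ultimately show ?thesis by (simp only:)
  qed
  obtain G where G: "G \<in> sets borel" "A \<subseteq> G" "hausdorff1 G = hausdorff1 A"
    using borel_superset_hausdorff1[OF A(2)] .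
  have "A \<inter> G = A" using G(2) by auto
  then have "hausdorff1 A + hausdorff1 (G - A) = hausdorff1 A + 0" using split[of G] G(3) by simp
  then have null: "hausdorff1 (G - A) = 0" using A(2) by (subst (asm) ennreal_add_left_cancel) auto
  obtain G' where G': "G' \<in> sets borel" "G - A \<subseteq> G'" "hausdorff1 G' = 0"
    using borel_superset_hausdorff1[of "G - A"] null by auto
  define B where "B = G - G'"
  have B: "B \<in> sets borel" "B \<subseteq> A" "A - B \<subseteq> G'" using G G' by (auto simp: B_def)
  let ?\<mu> = "hausdorff1_on B"
  have Bfin: "hausdorff1 B < \<infinity>" using hausdorff1_mono[OF B(2)] A(2) by order
  have \<mu>: "emeasure ?\<mu> X = hausdorff1 (B \<inter> X)" if "X \<in> sets borel" for X
    using that B(1) by (rule emeasure_hausdorff1_on[rotated])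
  have sup: "emeasure ?\<mu> B = (SUP K\<in>{K. K \<subseteq> B \<and> compact K}. emeasure ?\<mu> K)"
    using B(1) Bfin by (intro inner_regular) (auto simp: \<mu>)
  have "\<exists>K. compact K \<and> K \<subseteq> B \<and> hausdorff1 (B - K) \<le> ennreal (1 / real (Suc n))" for n
  proof (cases "hausdorff1 B = 0")
    case True
    then show ?thesis by (intro exI[of _ "{}"]) auto
  next
    case False
    have "hausdorff1 B - ennreal (1 / real (Suc n)) < hausdorff1 B"
      using False Bfin by (intro ennreal_between) (auto simp: zero_less_iff_neq_zero)
    also have "hausdorff1 B = emeasure ?\<mu> B" using B(1) by (simp add: \<mu>)
    finally obtain K where K: "K \<subseteq> B" "compact K" "hausdorff1 B - ennreal (1 / real (Suc n)) < emeasure ?\<mu> K"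
      unfolding sup less_SUP_iff by auto
    have Kb: "K \<in> sets borel" using K(2) by (simp add: compact_imp_closed)
    have "hausdorff1 K < top" using hausdorff1_mono[OF K(1)] Bfin by (metis infinity_ennreal_def order_le_less_trans)
    have "hausdorff1 (B - K) = emeasure ?\<mu> (B - K)"
      using B(1) Kb by (subst \<mu>) (auto simp: Int_absorb1)
    also have "\<dots> = hausdorff1 B - emeasure ?\<mu> K"
      using K(1) B(1) Kb Bfin \<open>hausdorff1 K < top\<close>
      by (subst emeasure_Diff) (auto simp: \<mu> Int_absorb1 Int_absorb2 less_top)
    also have "\<dots> \<le> ennreal (1 / real (Suc n))"
      using less_imp_le[OF K(3)] Bfin by (auto simp: ennreal_minus_le_iff add.commute)
    finally show ?thesis using K by blast
  qed
  then obtain K where K: "\<And>n. compact (K n)" "\<And>n. K n \<subseteq> B" "\<And>n. hausdorff1 (B - K n) \<le> ennreal (1 / real (Suc n))"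
    by metis
  have "hausdorff1 (B - (\<Union>n. K n)) \<le> 0 + ennreal e" if e: "0 < e" for e
  proof -
    obtain n where n: "1 / real (Suc n) < e" using e nat_approx_posE by blast
    have "hausdorff1 (B - (\<Union>n. K n)) \<le> hausdorff1 (B - K n)" by (rule hausdorff1_mono) auto
    also have "\<dots> \<le> ennreal (1 / real (Suc n))" by (rule K)
    also have "\<dots> \<le> ennreal e" using n by (intro ennreal_leI) simp
    finally show ?thesis by simp
  qed
  then have "hausdorff1 (B - (\<Union>n. K n)) \<le> 0" by (rule ennreal_le_epsilon)
  then have "hausdorff1 (G' \<union> (B - (\<Union>n. K n))) = 0"
    using hausdorff1_Un[of G' "B - (\<Union>n. K n)"] G'(3) by simp
  then have "hausdorff1 (A - (\<Union>n. K n)) = 0"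
    by (rule hausdorff1_null_subset) (use B in auto)
  then show ?thesis using K B(2) by (intro that[of K]) blast+
qed

text \<open>McShane's extension, the infimum of the upward cones \<open>g v + L * dist u v\<close>.
  It turns a graph over an arbitrary set of reals into part of a curve defined on the whole line, as
  the definition of unrectifiability demands.\<close>

lemma lipschitz_real_extension:
  fixes g :: "'a::metric_space \<Rightarrow> real"
  assumes g: "L-lipschitz_on S g"
  obtains G where "L-lipschitz_on UNIV G" "\<And>x. x \<in> S \<Longrightarrow> G x = g x"
proof (cases "S = {}")
  case True
  have "L-lipschitz_on UNIV (\<lambda>_::'a. 0::real)"
    using lipschitz_on_nonneg[OF g] by (auto intro: lipschitz_onI)
  then show ?thesis using True that by blast
next
  case False
  have L: "0 \<le> L" using g by (rule lipschitz_on_nonneg)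
  have gl: "g v - g w \<le> L * dist v w" if "v \<in> S" "w \<in> S" for v w
    using lipschitz_onD[OF g that] by (simp add: dist_real_def)
  define G where "G u = (INF v\<in>S. g v + L * dist u v)" for u
  have below: "bdd_below ((\<lambda>v. g v + L * dist u v) ` S)" for u
  proof -
    obtain v0 where v0: "v0 \<in> S" using False by blast
    have "g v0 - L * dist u v0 \<le> g v + L * dist u v" if "v \<in> S" for v
    proof -
      have "L * dist v0 v \<le> L * (dist u v0 + dist u v)"
        using L by (intro mult_left_mono) (metis dist_commute dist_triangle)
      then show ?thesis using gl[OF v0 that] by (simp add: algebra_simps)
    qed
    then show ?thesis by (intro bdd_belowI2)
  qed
  have step: "G u - G w \<le> L * dist u w" for u w
  proof -
    have "G u - L * dist u w \<le> g v + L * dist w v" if "v \<in> S" for v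
    proof -
      have "G u \<le> g v + L * dist u v" unfolding G_def by (rule cINF_lower[OF below that])
      moreover have "L * dist u v \<le> L * (dist u w + dist w v)" using L by (intro mult_left_mono dist_triangle)
      ultimately show ?thesis by (simp add: algebra_simps)
    qed
    then have "G u - L * dist u w \<le> G w" unfolding G_def[of w] using False by (intro cINF_greatest)
    then show ?thesis by simp
  qed
  show ?thesis
  proof (rule that)
    show "L-lipschitz_on UNIV G"
      using step L by (intro lipschitz_onI) (auto simp: dist_real_def abs_le_iff, metis dist_commute step minus_diff_eq)
    fix x assume x: "x \<in> S"
    have "G x \<le> g x" unfolding G_def using cINF_lower[OF below[of x] x] by simp
    moreover have "g x \<le> G x" unfolding G_def
    proof (rule cINF_greatest)
      show "g x \<le> g v + L * dist x v" if "v \<in> S" for v using gl[OF x that] by simp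
    qed (rule False)
    ultimately show "G x = g x" by simp
  qed
qed

subsection \<open>Oblique projections and sectors\<close>

text \<open>The first coordinate of the point where the line through \<open>x\<close> with direction
  \<open>(t, 1)\<close> meets the horizontal axis.\<close>

definition oblique :: "real \<Rightarrow> real^2 \<Rightarrow> real" where
  "oblique t x = x $ 1 - t * x $ 2"

text \<open>A double cone at \<open>a\<close> without its apex; slopes are horizontal over vertical
  increments, as in \<open>oblique\<close>. Because the cutoff is by height and not by distance,
  slopes within \<open>s\<close> of \<open>t\<close> yield a cone that \<open>oblique t\<close> maps
  into an interval of radius \<open>s * r\<close>.\<close>

definition sector :: "real^2 \<Rightarrow> real set \<Rightarrow> real \<Rightarrow> (real^2) set" where
  "sector a S r = {z. z $ 2 \<noteq> a $ 2 \<and> \<bar>z $ 2 - a $ 2\<bar> \<le> r \<and> (z $ 1 - a $ 1) / (z $ 2 - a $ 2) \<in> S}"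

lemma oblique_diff: "oblique t x - oblique t y = (x $ 1 - y $ 1) - t * (x $ 2 - y $ 2)"
  by (simp add: oblique_def algebra_simps)

lemma lipschitz_oblique: "(1 + \<bar>t\<bar>)-lipschitz_on UNIV (oblique t)"
proof (rule lipschitz_onI)
  fix x y :: "real^2"
  have "\<bar>(x - y) $ 1 - t * (x - y) $ 2\<bar> \<le> \<bar>(x - y) $ 1\<bar> + \<bar>t\<bar> * \<bar>(x - y) $ 2\<bar>"
    by (metis abs_mult abs_triangle_ineq4)
  also have "\<dots> \<le> norm (x - y) + \<bar>t\<bar> * norm (x - y)"
    by (intro add_mono mult_left_mono component_le_norm_cart) auto
  finally show "dist (oblique t x) (oblique t y) \<le> (1 + \<bar>t\<bar>) * dist x y"
    by (simp add: dist_real_def oblique_diff dist_norm distrib_right)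
qed simp

lemma sector_ball:
  assumes "0 < s"
  shows "z \<in> sector a (ball t s) r \<longleftrightarrow>
    \<bar>z $ 2 - a $ 2\<bar> \<le> r \<and> \<bar>oblique t z - oblique t a\<bar> < s * \<bar>z $ 2 - a $ 2\<bar>"
proof (cases "z $ 2 = a $ 2")
  case False
  have "(z $ 1 - a $ 1) / (z $ 2 - a $ 2) - t = (oblique t z - oblique t a) / (z $ 2 - a $ 2)"
    using False by (simp add: oblique_diff field_simps)
  then have "dist t ((z $ 1 - a $ 1) / (z $ 2 - a $ 2)) = \<bar>oblique t z - oblique t a\<bar> / \<bar>z $ 2 - a $ 2\<bar>"
    by (metis abs_divide dist_commute dist_real_def)
  then show ?thesis using False by (auto simp: sector_def pos_divide_less_eq)
qed (simp add: sector_def)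

text \<open>The bound makes \<open>oblique t\<close> injective on \<open>F\<close> and the height a
  Lipschitz function of it, so that \<open>F\<close> lies on a Lipschitz curve.\<close>

lemma purely_unrectifiable_graph_null:
  assumes pu: "purely_1_unrectifiable A" "F \<subseteq> A"
    and L: "0 \<le> L" "\<And>x z. x \<in> F \<Longrightarrow> z \<in> F \<Longrightarrow> \<bar>z $ 2 - x $ 2\<bar> \<le> L * \<bar>oblique t z - oblique t x\<bar>"
  shows "hausdorff1 F = 0"
proof -
  define g where "g = (\<lambda>u. (inv_into F (oblique t) u) $ 2)"
  have inj: "x = z" if "x \<in> F" "z \<in> F" "oblique t x = oblique t z" for x z
  proof -
    have "x $ 2 = z $ 2" using L(2)[OF that(2,1)] that(3) by simp
    moreover from this have "x $ 1 = z $ 1" using that(3) by (simp add: oblique_def)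
    ultimately show ?thesis by (simp add: vec_eq_iff forall_2)
  qed
  have g: "g (oblique t x) = x $ 2" if "x \<in> F" for x
    using that inj unfolding g_def by (subst inv_into_f_f) (auto simp: inj_on_def)
  have "L-lipschitz_on (oblique t ` F) g"
  proof (rule lipschitz_onI, clarify)
    fix x z assume "x \<in> F" "z \<in> F"
    then show "dist (g (oblique t x)) (g (oblique t z)) \<le> L * dist (oblique t x) (oblique t z)"
      using L(2)[of z x] by (simp add: g dist_real_def)
  qed (use L in simp_all)
  then obtain G where G: "L-lipschitz_on UNIV G" "\<And>x. x \<in> oblique t ` F \<Longrightarrow> G x = g x"
    using lipschitz_real_extension by metis
  \<comment> \<open>The inverse change of coordinates: the point with oblique coordinate
    \<open>u\<close> and height \<open>G u\<close>.\<close>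
  define f :: "real \<Rightarrow> real^2" where "f u = vector [u + t * G u, G u]" for u
  have "(1 + \<bar>t\<bar> * L + L)-lipschitz_on UNIV f"
  proof (rule lipschitz_onI)
    fix u v :: real
    have Gd: "\<bar>G u - G v\<bar> \<le> L * \<bar>u - v\<bar>" using lipschitz_onD[OF G(1), of u v] by (simp add: dist_real_def)
    have "dist (f u) (f v) \<le> \<bar>(f u - f v) $ 1\<bar> + \<bar>(f u - f v) $ 2\<bar>"
      using norm_le_l1_cart[of "f u - f v"] by (simp add: dist_norm sum_2)
    also have "\<dots> = \<bar>(u - v) + t * (G u - G v)\<bar> + \<bar>G u - G v\<bar>"
      by (simp add: f_def algebra_simps)
    also have "\<dots> \<le> \<bar>u - v\<bar> + \<bar>t\<bar> * \<bar>G u - G v\<bar> + \<bar>G u - G v\<bar>"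
      by (metis abs_mult abs_triangle_ineq add_right_mono)
    also have "\<dots> \<le> \<bar>u - v\<bar> + \<bar>t\<bar> * (L * \<bar>u - v\<bar>) + L * \<bar>u - v\<bar>"
      using Gd by (intro add_mono mult_left_mono) auto
    finally show "dist (f u) (f v) \<le> (1 + \<bar>t\<bar> * L + L) * dist u v"
      by (simp add: dist_real_def algebra_simps)
  qed (use L in simp)
  then have "hausdorff1 (A \<inter> range f) = 0" using pu(1) unfolding purely_1_unrectifiable_def by blast
  moreover have "F \<subseteq> A \<inter> range f"
  proof
    fix x assume x: "x \<in> F"
    have "f (oblique t x) = x"
      using x g[OF x] G(2)[of "oblique t x"] by (simp add: f_def vec_eq_iff forall_2 oblique_def)
    then show "x \<in> A \<inter> range f" using x pu(2) by (metis IntI rangeI subsetD)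
  qed
  ultimately show ?thesis by (rule hausdorff1_null_subset)
qed

text \<open>For \<open>x\<close> in \<open>F\<close> let \<open>h x\<close> be the height up to which the
  narrow cone at \<open>x\<close> meets \<open>F\<close>; where there is no such point, \<open>F\<close> is a Lipschitz graph. Otherwise
  a point \<open>x'\<close> of \<open>F\<close> in the narrow cone near the height \<open>h x\<close> and \<open>x\<close> itself have wider cones
  that together cover the part of \<open>F\<close> in a strip around \<open>x\<close>.\<close>

lemma sparse_cones_small:
  assumes pu: "purely_1_unrectifiable A" and FA: "F \<subseteq> A"
    and R: "0 < R" "\<And>x. x \<in> A \<Longrightarrow> \<bar>x $ 1\<bar> \<le> R \<and> \<bar>x $ 2\<bar> \<le> R"
    and s: "0 < s" "s \<le> 1" and \<epsilon>: "0 < \<epsilon>"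
    and F: "\<And>a r. a \<in> F \<Longrightarrow> r \<in> \<rat> \<Longrightarrow> 0 < r \<Longrightarrow> hausdorff1 (A \<inter> sector a (ball t s) r) \<le> ennreal (\<epsilon> * s * r)"
  shows "hausdorff1 F \<le> ennreal (80 * (2 + \<bar>t\<bar>) * R * \<epsilon>)"
proof -
  \<comment> \<open>A quarter of the width \<open>s\<close> for which the cone bound is assumed; the
    rest is the room needed for moving the apex from \<open>x\<close> to \<open>x'\<close>.\<close>
  define N where "N x = {z\<in>F. \<bar>oblique t z - oblique t x\<bar> < s/4 * \<bar>z $ 2 - x $ 2\<bar>}" for x
  define h where "h x = (SUP z\<in>N x. \<bar>z $ 2 - x $ 2\<bar>)" for x
  define F1 where "F1 = {x\<in>F. N x = {}}"
  define F2 where "F2 = {x\<in>F. N x \<noteq> {}}"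
  have height: "\<bar>z $ 2 - x $ 2\<bar> \<le> 2 * R" if "z \<in> F" "x \<in> F" for x z
  proof -
    have "x \<in> A" "z \<in> A" using that FA by auto
    then show ?thesis using R(2)[of x] R(2)[of z] by linarith
  qed
  have bdd: "bdd_above ((\<lambda>z. \<bar>z $ 2 - x $ 2\<bar>) ` N x)" if "x \<in> F" for x
    using height that by (intro bdd_aboveI2[of _ _ "2*R"]) (auto simp: N_def)
  have hub: "\<bar>z $ 2 - x $ 2\<bar> \<le> h x" if "x \<in> F" "z \<in> N x" for x z
    unfolding h_def using bdd that by (intro cSUP_upper)
  have h: "0 < h x" "h x \<le> 2 * R" if "x \<in> F2" for x
  proof -
    from that obtain z where z: "z \<in> N x" "x \<in> F" by (auto simp: F2_def)
    then have "0 < \<bar>z $ 2 - x $ 2\<bar>" using s by (auto simp: N_def)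
    then show "0 < h x" using hub[OF z(2,1)] by linarith
    show "h x \<le> 2 * R" unfolding h_def using z height by (intro cSUP_least) (auto simp: N_def)
  qed
  have null: "hausdorff1 F1 = 0"
  proof (rule purely_unrectifiable_graph_null[OF pu])
    fix x z assume "x \<in> F1" "z \<in> F1"
    then have "\<not> \<bar>oblique t z - oblique t x\<bar> < s/4 * \<bar>z $ 2 - x $ 2\<bar>" by (auto simp: F1_def N_def)
    then show "\<bar>z $ 2 - x $ 2\<bar> \<le> 4/s * \<bar>oblique t z - oblique t x\<bar>" using s by (simp add: field_simps)
  qed (use FA s in \<open>auto simp: F1_def\<close>)
  have strip: "hausdorff1 {z\<in>F. \<bar>oblique t z - oblique t x\<bar> \<le> s * h x / 4} \<le> ennreal (4 * \<epsilon> * s * h x)"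
    if x: "x \<in> F2" for x
  proof -
    have xF: "x \<in> F" using x by (simp add: F2_def)
    \<comment> \<open>A point of the strip outside the wide cone at \<open>x\<close> differs from
      \<open>x\<close> in height by at most \<open>h x / 4\<close>, hence from \<open>x'\<close> by
      more than \<open>h x / 2\<close>. Its oblique distance from \<open>x'\<close> is below
      \<open>s * h x / 2\<close>, one half of this coming from the strip and one half from the
      narrow cone, so it lies in the wide cone at \<open>x'\<close>.\<close>
    have "3/4 * h x < h x" using h(1)[OF x] by simp
    then obtain x' where x': "x' \<in> N x" "3/4 * h x < \<bar>x' $ 2 - x $ 2\<bar>"
      unfolding h_def[of x] using bdd[OF xF] x by (subst (asm) less_cSUP_iff) (auto simp: F2_def)
    have x'F: "x' \<in> F" and x'N: "\<bar>oblique t x' - oblique t x\<bar> < s/4 * \<bar>x' $ 2 - x $ 2\<bar>"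
      using x'(1) by (auto simp: N_def)
    have x'h: "\<bar>x' $ 2 - x $ 2\<bar> \<le> h x" by (rule hub[OF xF x'(1)])
    \<comment> \<open>Heights relative to \<open>x'\<close> reach \<open>h x / 4 + h x\<close>; the
      upper bound leaves room for a rational number.\<close>
    obtain r where r: "r \<in> \<rat>" "5/4 * h x < r" "r < 2 * h x"
      using Rats_dense_in_real[of "5/4 * h x" "2 * h x"] h(1)[OF x] by auto
    have r0: "0 < r" using r(2) h(1)[OF x] by linarith
    have "{z\<in>F. \<bar>oblique t z - oblique t x\<bar> \<le> s * h x / 4} \<subseteq>
        (A \<inter> sector x (ball t s) r) \<union> (A \<inter> sector x' (ball t s) r)"
    proof
      fix z assume "z \<in> {z\<in>F. \<bar>oblique t z - oblique t x\<bar> \<le> s * h x / 4}"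
      then have z: "z \<in> F" "\<bar>oblique t z - oblique t x\<bar> \<le> s * h x / 4" by auto
      have zh: "\<bar>z $ 2 - x $ 2\<bar> \<le> h x"
      proof (rule ccontr)
        assume *: "\<not> \<bar>z $ 2 - x $ 2\<bar> \<le> h x"
        then have "z \<notin> N x" using hub[OF xF] by blast
        then have "s/4 * \<bar>z $ 2 - x $ 2\<bar> \<le> \<bar>oblique t z - oblique t x\<bar>" using z(1) by (auto simp: N_def)
        moreover have "s/4 * h x < s/4 * \<bar>z $ 2 - x $ 2\<bar>" using * s by (intro mult_strict_left_mono) auto
        ultimately show False using z(2) by simp
      qed
      show "z \<in> (A \<inter> sector x (ball t s) r) \<union> (A \<inter> sector x' (ball t s) r)"
      proof (cases "\<bar>oblique t z - oblique t x\<bar> < s * \<bar>z $ 2 - x $ 2\<bar>")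
        case True
        then have "z \<in> sector x (ball t s) r" using zh r h(1)[OF x] s by (simp add: sector_ball)
        then show ?thesis using z(1) FA by auto
      next
        case False
        then have "s * \<bar>z $ 2 - x $ 2\<bar> \<le> s * (h x / 4)" using z(2) by simp
        then have small: "\<bar>z $ 2 - x $ 2\<bar> \<le> h x / 4" using s(1) by (simp only: mult_le_cancel_left_pos)
        have lower: "h x / 2 < \<bar>z $ 2 - x' $ 2\<bar>" using small x'(2) by linarith
        have "s/4 * \<bar>x' $ 2 - x $ 2\<bar> \<le> s/4 * h x" using s x'h by (intro mult_left_mono) auto
        then have "\<bar>oblique t z - oblique t x'\<bar> < s * (h x / 2)" using z(2) x'N by (simp add: abs_if split: if_splits)
        also have "\<dots> < s * \<bar>z $ 2 - x' $ 2\<bar>" using lower s(1) by (intro mult_strict_left_mono)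
        finally have "\<bar>oblique t z - oblique t x'\<bar> < s * \<bar>z $ 2 - x' $ 2\<bar>" .
        moreover have "\<bar>z $ 2 - x' $ 2\<bar> \<le> r" using small x'h r(2) by linarith
        ultimately have "z \<in> sector x' (ball t s) r" using s by (simp add: sector_ball)
        then show ?thesis using z(1) FA by auto
      qed
    qed
    then have "hausdorff1 {z\<in>F. \<bar>oblique t z - oblique t x\<bar> \<le> s * h x / 4}
        \<le> hausdorff1 (A \<inter> sector x (ball t s) r) + hausdorff1 (A \<inter> sector x' (ball t s) r)"
      by (rule order_trans[OF hausdorff1_mono hausdorff1_Un])
    also have "\<dots> \<le> ennreal (\<epsilon> * s * r) + ennreal (\<epsilon> * s * r)"
      by (intro add_mono F xF x'F r r0)
    also have "\<dots> = ennreal (2 * (\<epsilon> * s * r))"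
      using \<epsilon> s r0 by (simp add: ennreal_plus[symmetric] del: ennreal_plus)
    also have "\<dots> \<le> ennreal (2 * (\<epsilon> * s * (2 * h x)))"
      using \<epsilon> s r(3) by (intro ennreal_leI mult_left_mono) auto
    finally show ?thesis by (simp add: mult_ac)
  qed
  \<comment> \<open>Enlarged five times, this radius becomes the half-width
    \<open>s * h x / 4\<close> of the strip.\<close>
  define \<rho> where "\<rho> x = s * h x / 20" for x
  have \<rho>: "0 < \<rho> x \<and> \<rho> x \<le> R" if "x \<in> F2" for x
  proof -
    have "s * h x \<le> 1 * (2 * R)" using h[OF that] s by (intro mult_mono) auto
    then show ?thesis using h[OF that] s R(1) by (simp add: \<rho>_def)
  qed
  obtain x :: "nat \<Rightarrow> real^2" and J :: "nat set" where x: "\<And>n. n \<in> J \<Longrightarrow> x n \<in> F2"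
    "disjoint_family_on (\<lambda>n. cball (oblique t (x n)) (\<rho> (x n))) J"
    "\<And>i. i \<in> F2 \<Longrightarrow> \<exists>n\<in>J. oblique t i \<in> cball (oblique t (x n)) (5 * \<rho> (x n))"
    using vitali_sequence[where a="oblique t" and K=F2 and r=\<rho>, OF \<rho>] by blast
  define D where "D n = (if n \<in> J then {z\<in>F. \<bar>oblique t z - oblique t (x n)\<bar> \<le> s * h (x n) / 4} else {})" for n
  \<comment> \<open>On \<open>A\<close> the oblique coordinate is at most
    \<open>(1 + \<bar>t\<bar>) * R\<close> in absolute value, and the radii are at most
    \<open>R\<close>. The length of \<open>U\<close> times \<open>40 * \<epsilon>\<close> is the
    final bound.\<close>
  define U where "U = cball (0::real) ((2 + \<bar>t\<bar>) * R)"
  have "F2 \<subseteq> (\<Union>n. D n)"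
  proof
    fix z assume z: "z \<in> F2"
    then obtain n where n: "n \<in> J" "oblique t z \<in> cball (oblique t (x n)) (5 * \<rho> (x n))" by (rule bexE[OF x(3)])
    then have "\<bar>oblique t z - oblique t (x n)\<bar> \<le> s * h (x n) / 4"
      by (simp add: \<rho>_def dist_real_def abs_minus_commute)
    then have "z \<in> D n" using z n(1) by (simp add: D_def F2_def)
    then show "z \<in> (\<Union>n. D n)" by blast
  qed
  then have "hausdorff1 F2 \<le> (\<Sum>n. hausdorff1 (D n))"
    using hausdorff1_mono hausdorff1_UN order_trans by blast
  also have "\<dots> \<le> (\<Sum>n. ennreal (40 * \<epsilon>) * (if n \<in> J then emeasure lborel (cball (oblique t (x n)) (\<rho> (x n))) else 0))"
  proof (intro suminf_le summableI)
    fix n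
    show "hausdorff1 (D n) \<le> ennreal (40 * \<epsilon>) * (if n \<in> J then emeasure lborel (cball (oblique t (x n)) (\<rho> (x n))) else 0)"
    proof (cases "n \<in> J")
      case True
      have "hausdorff1 (D n) \<le> ennreal (4 * \<epsilon> * s * h (x n))" using strip[OF x(1)[OF True]] True by (simp add: D_def)
      also have "4 * \<epsilon> * s * h (x n) = (40 * \<epsilon>) * (2 * \<rho> (x n))" by (simp add: \<rho>_def)
      also have "ennreal \<dots> = ennreal (40 * \<epsilon>) * emeasure lborel (cball (oblique t (x n)) (\<rho> (x n)))"
        using \<epsilon> \<rho>[OF x(1)[OF True]] by (subst ennreal_mult) (auto simp: emeasure_lborel_cball_real)
      finally show ?thesis using True by simp
    qed (simp add: D_def)
  qed
  also have "\<dots> = ennreal (40 * \<epsilon>) * (\<Sum>n. if n \<in> J then emeasure lborel (cball (oblique t (x n)) (\<rho> (x n))) else 0)"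
    by simp
  also have "\<dots> \<le> ennreal (40 * \<epsilon>) * emeasure lborel U"
  proof (intro mult_left_mono disjoint_suminf_emeasure_le[OF x(2)])
    fix n assume "n \<in> J"
    then have xn: "x n \<in> A" "\<rho> (x n) \<le> R" using x(1) FA \<rho> by (auto simp: F2_def)
    have "\<bar>t * x n $ 2\<bar> \<le> \<bar>t\<bar> * R" using R(2)[OF xn(1)] by (simp add: abs_mult mult_left_mono)
    then have "\<bar>oblique t (x n)\<bar> \<le> R + \<bar>t\<bar> * R" using R(2)[OF xn(1)] by (simp add: oblique_def abs_le_iff)
    then show "cball (oblique t (x n)) (\<rho> (x n)) \<subseteq> U"
      using xn(2) by (auto simp: U_def dist_real_def algebra_simps)
  qed (auto simp: U_def)
  also have "\<dots> = ennreal (80 * (2 + \<bar>t\<bar>) * R * \<epsilon>)"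
    using \<epsilon> R(1) by (simp add: U_def emeasure_lborel_cball_real ennreal_mult[symmetric] mult_ac del: ennreal_mult)
  finally have F2: "hausdorff1 F2 \<le> ennreal (80 * (2 + \<bar>t\<bar>) * R * \<epsilon>)" .
  have "F = F1 \<union> F2" by (auto simp: F1_def F2_def)
  then have "hausdorff1 F \<le> hausdorff1 F1 + hausdorff1 F2" using hausdorff1_Un by simp
  then show ?thesis using null F2 by simp
qed

section \<open>Cone densities of a measure as set functions of directions\<close>

lemma measurable_component [measurable]: "(\<lambda>x::real^2. x $ i) \<in> borel_measurable borel"
  by (intro borel_measurable_continuous_onI continuous_intros)

lemma continuous_on_oblique: "continuous_on UNIV (oblique t)"
  unfolding oblique_def by (intro continuous_intros)

lemma measurable_oblique [measurable]: "oblique t \<in> borel_measurable borel"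
  by (rule borel_measurable_continuous_onI[OF continuous_on_oblique])

lemma sector_borel [measurable]:
  assumes [measurable]: "S \<in> sets borel" shows "sector a S r \<in> sets borel"
proof -
  have "{z \<in> space borel. z $ 2 \<noteq> a $ 2 \<and> \<bar>z $ 2 - a $ 2\<bar> \<le> r \<and> (z $ 1 - a $ 1) / (z $ 2 - a $ 2) \<in> S}
      \<in> sets (borel :: (real^2) measure)" by measurable
  then show ?thesis by (simp add: sector_def)
qed

lemma sector_mono: "S \<subseteq> T \<Longrightarrow> sector a S r \<subseteq> sector a T r"
  by (auto simp: sector_def)

text \<open>The supremum runs over all heights, so a bound holds at every scale at once; rational
  heights make it countable and hence measurable in the apex and the direction.\<close>

definition sector_density :: "(real^2) measure \<Rightarrow> real^2 \<Rightarrow> real set \<Rightarrow> ennreal" where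
  "sector_density \<mu> a S = (SUP r\<in>{r\<in>\<rat>. 0 < r}. emeasure \<mu> (sector a S r) / ennreal r)"

lemma sector_density_upper:
  "r \<in> \<rat> \<Longrightarrow> 0 < r \<Longrightarrow> emeasure \<mu> (sector a S r) / ennreal r \<le> sector_density \<mu> a S"
  unfolding sector_density_def by (rule SUP_upper) auto

lemma sector_density_mono:
  assumes "sets \<mu> = sets borel" "S \<subseteq> T" "T \<in> sets borel"
  shows "sector_density \<mu> a S \<le> sector_density \<mu> a T"
  unfolding sector_density_def
  using assms by (intro SUP_mono' divide_right_mono_ennreal emeasure_mono sector_mono) auto

lemma sector_density_UN:
  assumes sets: "sets \<mu> = sets borel" and S: "\<And>n::nat. S n \<in> sets borel"
  shows "sector_density \<mu> a (\<Union>n. S n) \<le> (\<Sum>n. sector_density \<mu> a (S n))"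
  unfolding sector_density_def[of \<mu> a "\<Union>n. S n"]
proof (rule SUP_least)
  fix r :: real assume r: "r \<in> {r\<in>\<rat>. 0 < r}"
  have "sector a (\<Union>n. S n) r = (\<Union>n. sector a (S n) r)" by (auto simp: sector_def)
  then have "emeasure \<mu> (sector a (\<Union>n. S n) r) \<le> (\<Sum>n. emeasure \<mu> (sector a (S n) r))"
    using S sets by (simp add: emeasure_subadditive_countably image_subset_iff)
  then have "emeasure \<mu> (sector a (\<Union>n. S n) r) / ennreal r \<le> (\<Sum>n. emeasure \<mu> (sector a (S n) r) / ennreal r)"
    unfolding divide_ennreal_def ennreal_suminf_multc by (rule mult_right_mono) simp
  also have "\<dots> \<le> (\<Sum>n. sector_density \<mu> a (S n))"
    using r by (intro suminf_le summableI sector_density_upper) auto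
  finally show "emeasure \<mu> (sector a (\<Union>n. S n) r) / ennreal r \<le> (\<Sum>n. sector_density \<mu> a (S n))" .
qed

section \<open>The zero-or-infinity alternative for set functions on the line\<close>

lemma ex_nat_inverse_between:
  assumes "0 < x" "x \<le> 1"
  obtains k :: nat where "1 \<le> k" "x \<le> 1 / real k" "1 / real k \<le> 2 * x"
proof -
  define k where "k = nat \<lfloor>1 / x\<rfloor>"
  have x1: "1 \<le> 1 / x" using assms by simp
  have "1 \<le> \<lfloor>1 / x\<rfloor>" using x1 by (simp add: le_floor_iff)
  then have k1: "1 \<le> k" unfolding k_def by linarith
  have rk: "real k = of_int \<lfloor>1 / x\<rfloor>" unfolding k_def using \<open>1 \<le> \<lfloor>1 / x\<rfloor>\<close> by (intro of_nat_nat) linarith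
  then have "real k \<le> 1 / x" "1 / x < real k + 1" by linarith+
  then have "real k * x \<le> 1" "1 < (real k + 1) * x" using assms(1) by (simp_all add: field_simps)
  moreover have "(real k + 1) * x \<le> (2 * real k) * x" using k1 assms(1) by (intro mult_right_mono) auto
  ultimately have "1 \<le> (2 * x) * real k" "x * real k \<le> 1" by (simp_all add: mult_ac)
  then show ?thesis using k1 by (intro that[of k]) (simp_all add: pos_divide_le_eq pos_le_divide_eq)
qed

text \<open>At a density point \<open>t\<close> of \<open>C\<close> the part of a small ball outside of \<open>C\<close> is covered by
  balls of comparable size centred in \<open>C\<close>, whose total length is small compared with the radius.\<close>

lemma zero_infinity_closed:
  fixes \<psi> :: "real set \<Rightarrow> ennreal"
  assumes mono: "\<And>S T. S \<subseteq> T \<Longrightarrow> T \<in> sets borel \<Longrightarrow> \<psi> S \<le> \<psi> T"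
    and sub: "\<And>S :: nat \<Rightarrow> real set. (\<And>n. S n \<in> sets borel) \<Longrightarrow> \<psi> (\<Union>n. S n) \<le> (\<Sum>n. \<psi> (S n))"
    and C: "closed C" "\<psi> C = 0" and M: "0 \<le> M"
    "\<And>t k. t \<in> C \<Longrightarrow> 1 \<le> k \<Longrightarrow> \<psi> (ball t (1 / real k)) \<le> ennreal (M / real k)"
    and e: "0 < e"
  shows "AE t in lborel. t \<in> C \<longrightarrow> (\<exists>K. \<forall>k\<ge>K. \<psi> (ball t (1 / real k)) \<le> ennreal (e / real k))"
proof -
  have Cb: "C \<in> sets borel" using C(1) by simp
  have psi0: "\<psi> {} = 0" using mono[of "{}" C] C(2) Cb by simp
  have psi_Un: "\<psi> (S \<union> T) \<le> \<psi> S + \<psi> T" if "S \<in> sets borel" "T \<in> sets borel" for S T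
  proof -
    have "\<psi> (\<Union>n. binaryset S T n) \<le> (\<Sum>n. \<psi> (binaryset S T n))"
      using that by (intro sub) (simp add: binaryset_def)
    also have "\<dots> = \<psi> S + \<psi> T" by (rule suminf_binaryset_eq) (rule psi0)
    finally show ?thesis by (simp add: UN_binaryset_eq)
  qed
  \<comment> \<open>The constant 32 is 16 from the estimate of a single Vitali ball times 2 from the
    doubled ball \<open>cball t (2 * s)\<close>; the summand 1 covers \<open>M = 0\<close>.\<close>
  define \<eta> where "\<eta> = e / (32 * M + 1)"
  have \<eta>: "0 < \<eta>" "32 * M * \<eta> \<le> e"
    using e M(1) by (auto simp: \<eta>_def field_simps)
  have main: "\<psi> (ball t (1 / real k)) \<le> ennreal (e / real k)"
    if t: "t \<in> C" and k: "2 \<le> k" and dens: "emeasure lborel (cball t (2 / real k) - C) \<le> ennreal (\<eta> * (2 / real k))"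
    for t and k :: nat
  proof -
    define s where "s = 1 / real k"
    have s: "0 < s" "s \<le> 1/2" using k by (auto simp: s_def field_simps)
    define G where "G = ball t s - C"
    \<comment> \<open>The ball of radius \<open>r u\<close> stays off \<open>C\<close>, while some
      point of \<open>C\<close> is only \<open>10 * r u\<close> away; so the enlarged ball lies in a
      ball of comparable size centred in \<open>C\<close>.\<close>
    define r where "r u = infdist u C / 10" for u
    have Cne: "C \<noteq> {}" using t by blast
    have G: "0 < r u" "r u \<le> s / 10" "cball u (r u) \<subseteq> cball t (2 * s) - C" if "u \<in> G" for u
    proof -
      have du: "dist u t < s" "u \<notin> C" using that by (auto simp: G_def dist_commute)
      have pos: "0 < infdist u C" using C(1) du(2) Cne by (metis infdist_pos_not_in_closed)
      have le: "infdist u C \<le> dist u t" using t by (rule infdist_le)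
      show "0 < r u" "r u \<le> s / 10" using pos le du by (auto simp: r_def)
      show "cball u (r u) \<subseteq> cball t (2 * s) - C"
      proof
        fix v assume "v \<in> cball u (r u)"
        then have v: "dist u v \<le> infdist u C / 10" by (simp add: r_def)
        have "v \<notin> C" using infdist_le[of v C u] v pos by fastforce
        moreover have "dist t v \<le> 2 * s"
          using dist_triangle[of t v u] v le du s(1) by (simp add: dist_commute)
        ultimately show "v \<in> cball t (2 * s) - C" by simp
      qed
    qed
    obtain x :: "nat \<Rightarrow> real" and J :: "nat set" where x: "\<And>n. n \<in> J \<Longrightarrow> x n \<in> G"
      "disjoint_family_on (\<lambda>n. cball (x n) (r (x n))) J"
      "\<And>i. i \<in> G \<Longrightarrow> \<exists>n\<in>J. i \<in> cball (x n) (5 * r (x n))"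
      using vitali_sequence[where a="\<lambda>y. y" and K=G and r=r and B="s/10"] G(1,2) by blast
    define W where "W n = (if n \<in> J then cball (x n) (5 * r (x n)) else {})" for n
    have Wb: "W n \<in> sets borel" for n by (simp add: W_def)
    have W: "\<psi> (W n) \<le> ennreal (16 * M) * (if n \<in> J then emeasure lborel (cball (x n) (r (x n))) else 0)" for n
    proof (cases "n \<in> J")
      case True
      define \<rho> where "\<rho> = r (x n)"
      have \<rho>: "0 < \<rho>" "\<rho> \<le> s / 10" using G x(1)[OF True] by (auto simp: \<rho>_def)
      obtain c where c: "c \<in> C" "infdist (x n) C = dist (x n) c"
        using infdist_attains_inf[OF C(1) Cne] by metis
      have dc: "dist (x n) c = 10 * \<rho>" using c(2) by (simp add: \<rho>_def r_def)
      \<comment> \<open>Points of \<open>W n\<close> are within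
        \<open>5 * \<rho> + 10 * \<rho>\<close> of \<open>c\<close>, and 16 makes the ball around
        \<open>c\<close> strictly larger. As bounds are available only for radii
        \<open>1 / real k'\<close>, the radius is rounded up by at most a factor 2;
        \<open>2 \<le> k\<close> ensures \<open>16 * \<rho> \<le> 1\<close>.\<close>
      obtain k' :: nat where k': "1 \<le> k'" "16 * \<rho> \<le> 1 / real k'" "1 / real k' \<le> 2 * (16 * \<rho>)"
        by (rule ex_nat_inverse_between[of "16 * \<rho>"]) (use \<rho> s in auto)
      have "W n \<subseteq> ball c (1 / real k')"
      proof
        fix v assume "v \<in> W n"
        then have "dist (x n) v \<le> 5 * \<rho>" using True by (simp add: W_def \<rho>_def)
        then have "dist c v \<le> 15 * \<rho>" using dist_triangle[of c v "x n"] dc by (simp add: dist_commute)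
        then show "v \<in> ball c (1 / real k')" using k'(2) \<rho>(1) by simp
      qed
      then have "\<psi> (W n) \<le> \<psi> (ball c (1 / real k'))" by (intro mono) auto
      also have "\<dots> \<le> ennreal (M / real k')" by (rule M(2)[OF c(1) k'(1)])
      also have "\<dots> \<le> ennreal (16 * M * (2 * \<rho>))"
      proof (rule ennreal_leI)
        have "M * (1 / real k') \<le> M * (2 * (16 * \<rho>))" using k'(3) M(1) by (rule mult_left_mono)
        then show "M / real k' \<le> 16 * M * (2 * \<rho>)" by simp
      qed
      also have "\<dots> = ennreal (16 * M) * emeasure lborel (cball (x n) \<rho>)"
        using M(1) \<rho> by (subst ennreal_mult) (auto simp: emeasure_lborel_cball_real)
      finally show ?thesis using True by (simp add: \<rho>_def)
    qed (simp add: W_def psi0)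
    have "ball t s \<subseteq> C \<union> (\<Union>n. W n)"
    proof
      fix v assume v: "v \<in> ball t s"
      show "v \<in> C \<union> (\<Union>n. W n)"
      proof (cases "v \<in> C")
        case False
        then have "v \<in> G" using v by (simp add: G_def)
        then obtain n where "n \<in> J" "v \<in> cball (x n) (5 * r (x n))" by (rule bexE[OF x(3)])
        then have "v \<in> W n" by (simp add: W_def)
        then show ?thesis by blast
      qed simp
    qed
    then have "\<psi> (ball t s) \<le> \<psi> (C \<union> (\<Union>n. W n))" using Cb Wb by (intro mono) auto
    also have "\<dots> \<le> \<psi> C + \<psi> (\<Union>n. W n)" using Cb Wb by (intro psi_Un) auto
    also have "\<dots> \<le> (\<Sum>n. \<psi> (W n))" using sub[OF Wb] C(2) by simp
    also have "\<dots> \<le> (\<Sum>n. ennreal (16 * M) * (if n \<in> J then emeasure lborel (cball (x n) (r (x n))) else 0))"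
      by (intro suminf_le W summableI)
    also have "\<dots> = ennreal (16 * M) * (\<Sum>n. if n \<in> J then emeasure lborel (cball (x n) (r (x n))) else 0)"
      by simp
    also have "\<dots> \<le> ennreal (16 * M) * emeasure lborel (cball t (2 * s) - C)"
      using x(1) G(3) C(1) by (intro mult_left_mono disjoint_suminf_emeasure_le[OF x(2)]) auto
    also have "\<dots> \<le> ennreal (16 * M) * ennreal (\<eta> * (2 * s))"
      using dens by (intro mult_left_mono) (auto simp: s_def)
    also have "\<dots> = ennreal (32 * M * \<eta> * s)"
      using M(1) \<eta>(1) s(1) by (subst ennreal_mult[symmetric]) (auto simp: mult_ac)
    also have "\<dots> \<le> ennreal (e * s)" using \<eta>(2) s(1) by (intro ennreal_leI mult_right_mono) auto
    finally show ?thesis by (simp add: s_def)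
  qed
  show ?thesis using lebesgue_density[OF Cb \<eta>(1)]
  proof (rule AE_mp, intro AE_I2 impI)
    fix t assume *: "t \<in> C \<longrightarrow> (\<exists>s0>0. \<forall>s. 0 < s \<and> s \<le> s0 \<longrightarrow> emeasure lborel (cball t s - C) \<le> ennreal (\<eta> * s))"
      and t: "t \<in> C"
    then obtain s0 where s0: "0 < s0"
      "\<And>s. 0 < s \<Longrightarrow> s \<le> s0 \<Longrightarrow> emeasure lborel (cball t s - C) \<le> ennreal (\<eta> * s)" by blast
    obtain k0 :: nat where k0: "2 / s0 < real k0" using reals_Archimedean2 by blast
    have "\<psi> (ball t (1 / real k)) \<le> ennreal (e / real k)" if "max 2 k0 \<le> k" for k
    proof (rule main[OF t])
      have "2 / s0 < real k" using k0 that by simp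
      then show "emeasure lborel (cball t (2 / real k) - C) \<le> ennreal (\<eta> * (2 / real k))"
        using that s0(1) by (intro s0(2)) (auto simp: field_simps)
    qed (use that in simp)
    then show "\<exists>K. \<forall>k\<ge>K. \<psi> (ball t (1 / real k)) \<le> ennreal (e / real k)" by blast
  qed
qed

text \<open>Up to a null set \<open>T\<close> is a countable union of closed sets, which inherit
  from \<open>T\<close> both the vanishing and the bound; the tolerance runs through a
  sequence.\<close>

lemma zero_infinity:
  fixes \<psi> :: "real set \<Rightarrow> ennreal"
  assumes mono: "\<And>S T. S \<subseteq> T \<Longrightarrow> T \<in> sets borel \<Longrightarrow> \<psi> S \<le> \<psi> T"
    and sub: "\<And>S :: nat \<Rightarrow> real set. (\<And>n. S n \<in> sets borel) \<Longrightarrow> \<psi> (\<Union>n. S n) \<le> (\<Sum>n. \<psi> (S n))"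
    and T: "T \<in> sets borel" "\<psi> T = 0" and M: "0 \<le> M"
    "\<And>t k. t \<in> T \<Longrightarrow> 1 \<le> k \<Longrightarrow> \<psi> (ball t (1 / real k)) \<le> ennreal (M / real k)"
  shows "AE t in lborel. t \<in> T \<longrightarrow>
    (\<forall>j. \<exists>K. \<forall>k\<ge>K. \<psi> (ball t (1 / real k)) \<le> ennreal (1 / real (Suc j) / real k))"
proof -
  have "T \<in> sets lebesgue" using T(1) by (simp add: sets_completionI_sets)
  then obtain C Z where CZ: "fsigma C" "Z \<in> null_sets lebesgue" "C \<union> Z = T"
    using lebesgue_set_almost_fsigma by metis
  obtain F :: "nat \<Rightarrow> real set" where F: "\<And>n. closed (F n)" "C = (\<Union>n. F n)"
    using CZ(1) by (auto elim!: fsigma.cases)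
  have FT: "F n \<subseteq> T" for n using F(2) CZ(3) by blast
  have "AE t in lborel. t \<in> F n \<longrightarrow>
      (\<exists>K. \<forall>k\<ge>K. \<psi> (ball t (1 / real k)) \<le> ennreal (1 / real (Suc j) / real k))" for n j
  proof (rule zero_infinity_closed[OF mono sub F(1) _ M(1)])
    show "\<psi> (F n) = 0" using mono[OF FT T(1)] T(2) by simp
  qed (use M(2) FT in auto)
  then have "AE t in lborel. \<forall>n j. t \<in> F n \<longrightarrow>
      (\<exists>K. \<forall>k\<ge>K. \<psi> (ball t (1 / real k)) \<le> ennreal (1 / real (Suc j) / real k))"
    by (simp only: AE_all_countable) blast
  moreover have "AE t in lborel. t \<notin> Z"
    using CZ(2) by (simp add: AE_lborel_iff_negligible negligible_iff_null_sets)
  ultimately show ?thesis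
    by eventually_elim (use CZ(3) F(2) in blast)
qed

text \<open>A cone of width \<open>1 / real k\<close> and height \<open>r\<close> at
  \<open>a\<close> projects into an interval of radius \<open>r / real k\<close>, exactly the
  quantity by which its mass is normalized. So the projected measure has unbounded averages at the
  projections of these points.\<close>

lemma infinite_density_null:
  fixes \<mu> :: "(real^2) measure"
  assumes fin: "finite_measure \<mu>" and sets: "sets \<mu> = sets borel"
  shows "negligible (oblique t ` {a. \<forall>M::nat. \<exists>k\<ge>1::nat. ennreal (real M / real k) < sector_density \<mu> a (ball t (1 / real k))})"
    (is "negligible (_ ` ?E)")
proof (rule negligible_if_covers)
  interpret finite_measure \<mu> by (rule fin)
  have space: "space \<mu> = UNIV" using sets_eq_imp_space_eq[OF sets] by simp
  define \<nu> where "\<nu> = distr \<mu> borel (oblique t)"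
  have ob: "oblique t \<in> measurable \<mu> borel" using sets by (simp cong: measurable_cong_sets)
  have \<nu>: "emeasure \<nu> B = emeasure \<mu> (oblique t -` B)" if "B \<in> sets borel" for B
    using that ob by (simp add: \<nu>_def emeasure_distr space)
  define m where "m = measure \<mu> UNIV"
  have m: "0 \<le> m" "emeasure \<mu> UNIV = ennreal m" by (auto simp: m_def emeasure_eq_measure)
  fix e :: real assume e: "0 < e"
  \<comment> \<open>Large enough for the weak type bound \<open>10 * m / real M\<close> to be at
    most \<open>e\<close>. The summand 1 forces \<open>1 < real M\<close>, by which the radii
    \<open>r / real k\<close> are at most the total mass \<open>m\<close>, as the covering lemma
    needs bounded radii.\<close>
  obtain M :: nat where M: "10 * m / e + 1 < real M" using reals_Archimedean2 by blast
  have "0 \<le> 10 * m / e" using m(1) e by simp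
  with M have M1: "1 < real M" by linarith
  have Me: "10 * m \<le> real M * e" using M e by (simp add: field_simps)
  have key: "\<exists>r. 0 < r \<and> r \<le> m \<and> cball y r \<subseteq> UNIV \<and> ennreal (real M * r) \<le> emeasure \<nu> (cball y r)"
    if "y \<in> oblique t ` ?E" for y
  proof -
    from that obtain a where a: "y = oblique t a" "a \<in> ?E" by (rule imageE)
    then obtain k :: nat where k: "1 \<le> k" "ennreal (real M / real k) < sector_density \<mu> a (ball t (1 / real k))" by fast
    then obtain r where r: "r \<in> \<rat>" "0 < r" "ennreal (real M / real k) < emeasure \<mu> (sector a (ball t (1 / real k)) r) / ennreal r"
      unfolding sector_density_def less_SUP_iff by auto
    have "ennreal (real M * (r / real k)) = ennreal (real M / real k) * ennreal r"
      using r(2) by (subst ennreal_mult[symmetric]) auto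
    also have "\<dots> \<le> emeasure \<mu> (sector a (ball t (1 / real k)) r) / ennreal r * ennreal r"
      using r(3) by (intro mult_right_mono) auto
    also have "\<dots> = emeasure \<mu> (sector a (ball t (1 / real k)) r)"
      using r(2) by (simp add: ennreal_divide_times divide_mult_eq ennreal_zero_less_divide less_top)
    finally have big: "ennreal (real M * (r / real k)) \<le> emeasure \<mu> (sector a (ball t (1 / real k)) r)" .
    have "emeasure \<mu> (sector a (ball t (1 / real k)) r) \<le> emeasure \<mu> UNIV"
      using emeasure_space[of \<mu>] by (simp add: space)
    then have "ennreal (real M * (r / real k)) \<le> ennreal m" using big m(2) by simp
    then have "real M * (r / real k) \<le> m" using m(1) by simp
    moreover have "1 * (r / real k) \<le> real M * (r / real k)" using M1 r(2) by (intro mult_right_mono) auto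
    ultimately have rk: "r / real k \<le> m" by linarith
    have "sector a (ball t (1 / real k)) r \<subseteq> oblique t -` cball y (r / real k)"
    proof
      fix z assume "z \<in> sector a (ball t (1 / real k)) r"
      then have z: "\<bar>z $ 2 - a $ 2\<bar> \<le> r" "\<bar>oblique t z - oblique t a\<bar> < 1 / real k * \<bar>z $ 2 - a $ 2\<bar>"
        using k(1) by (simp_all add: sector_ball)
      have "1 / real k * \<bar>z $ 2 - a $ 2\<bar> \<le> 1 / real k * r" using z(1) by (intro mult_left_mono) auto
      then show "z \<in> oblique t -` cball y (r / real k)"
        using z(2) a(1) by (simp add: dist_real_def abs_minus_commute)
    qed
    then have "emeasure \<mu> (sector a (ball t (1 / real k)) r) \<le> emeasure \<nu> (cball y (r / real k))"
      using measurable_sets[OF ob, of "cball y (r / real k)"] by (subst \<nu>) (auto intro!: emeasure_mono simp: space)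
    then show ?thesis using big rk r(2) k(1) by (intro exI[of _ "r / real k"]) auto
  qed
  have s\<nu>: "sets \<nu> = sets borel" and M0: "0 < real M" using M1 by (simp_all add: \<nu>_def)
  obtain V where V: "V \<in> sets borel" "oblique t ` ?E \<subseteq> V" "ennreal (real M) * emeasure lborel V \<le> 10 * emeasure \<nu> UNIV"
    by (rule weak_type[OF s\<nu> space_in_borel M0 key])
  have "10 * emeasure \<nu> UNIV = ennreal (10 * m)" using m by (simp add: \<nu> ennreal_mult)
  also have "\<dots> \<le> ennreal (real M) * ennreal e" using Me e by (subst ennreal_mult[symmetric]) (auto intro: ennreal_leI)
  finally have "ennreal (real M) * emeasure lborel V \<le> ennreal (real M) * ennreal e" using V(3) by order
  then have "emeasure lborel V \<le> ennreal e"
    using M1 by (subst (asm) ennreal_mult_le_mult_iff) auto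
  then show "\<exists>V\<in>sets borel. oblique t ` ?E \<subseteq> V \<and> emeasure lborel V \<le> ennreal e" using V by blast
qed

text \<open>All cones are sections of one Borel set of triples \<open>((a, t), z)\<close>, described
  without division by \<open>sector_ball\<close>; measures of sections are measurable.\<close>

lemma measurable_sector_density:
  fixes \<mu> :: "(real^2) measure"
  assumes fin: "finite_measure \<mu>" and sets[measurable_cong]: "sets \<mu> = sets borel" and s: "0 < s"
  shows "(\<lambda>p. sector_density \<mu> (fst p) (ball (snd p) s)) \<in> borel_measurable (borel \<Otimes>\<^sub>M borel)"
proof -
  interpret finite_measure \<mu> by (rule fin)
  have space: "space \<mu> = UNIV" using sets_eq_imp_space_eq[OF sets] by simp
  have "(\<lambda>p. emeasure \<mu> (sector (fst p) (ball (snd p) s) r)) \<in> borel_measurable (borel \<Otimes>\<^sub>M borel)" for r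
  proof -
    let ?Q = "{w \<in> space (((borel :: (real^2) measure) \<Otimes>\<^sub>M (borel :: real measure)) \<Otimes>\<^sub>M \<mu>). \<bar>snd w $ 2 - fst (fst w) $ 2\<bar> \<le> r \<and>
        \<bar>(snd w $ 1 - snd (fst w) * snd w $ 2) - (fst (fst w) $ 1 - snd (fst w) * fst (fst w) $ 2)\<bar>
          < s * \<bar>snd w $ 2 - fst (fst w) $ 2\<bar>}"
    have "?Q \<in> sets ((borel \<Otimes>\<^sub>M borel) \<Otimes>\<^sub>M \<mu>)" by measurable
    then have "(\<lambda>p. emeasure \<mu> (Pair p -` ?Q)) \<in> borel_measurable (borel \<Otimes>\<^sub>M borel)"
      by (rule measurable_emeasure_Pair)
    moreover have "Pair p -` ?Q = sector (fst p) (ball (snd p) s) r" for p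
      using s by (auto simp: sector_ball space space_pair_measure oblique_def)
    ultimately show ?thesis by simp
  qed
  then show ?thesis unfolding sector_density_def
    by (intro borel_measurable_SUP borel_measurable_divide_ennreal) (auto intro: countable_subset[OF _ countable_rat])
qed

subsection \<open>The Besicovitch projection theorem\<close>

text \<open>Phrased with the same quotient as \<open>sector\<close>, so that a cone at
  \<open>a\<close> over directions isolating \<open>a\<close> contains no point of
  \<open>A\<close>.\<close>

definition isolated_along :: "(real^2) set \<Rightarrow> real \<Rightarrow> (real^2) set" where
  "isolated_along A t = {a\<in>A. \<forall>z\<in>A. z $ 2 \<noteq> a $ 2 \<longrightarrow> (z $ 1 - a $ 1) / (z $ 2 - a $ 2) \<noteq> t}"

text \<open>Failure of isolation means that a second point of \<open>A\<close> lies on the line.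
  With slopes bounded by \<open>n\<close> and height differences at least
  \<open>1 / real (Suc n)\<close>, such pairs \<open>(a, t)\<close> form the projection of a compact
  set, which is compact.\<close>

lemma borel_isolated_along:
  assumes A: "compact A"
  shows "{p. fst p \<in> isolated_along A (snd p)} \<in> sets (borel \<Otimes>\<^sub>M borel)"
proof -
  define Q where "Q n = {(a, t). a \<in> A \<and> \<bar>t\<bar> \<le> real n \<and>
    (\<exists>z\<in>A. 1 / real (Suc n) \<le> \<bar>z $ 2 - a $ 2\<bar> \<and> z $ 1 - a $ 1 = t * (z $ 2 - a $ 2))}" for n
  have "compact (Q n)" for n
  proof -
    let ?K = "(A \<times> cball (0::real) (real n)) \<times> A"
    let ?C = "{w. 1 / real (Suc n) \<le> \<bar>snd w $ 2 - fst (fst w) $ 2\<bar> \<and>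
      snd w $ 1 - fst (fst w) $ 1 = snd (fst w) * (snd w $ 2 - fst (fst w) $ 2)} :: (((real^2) \<times> real) \<times> (real^2)) set"
    have "closed ?C" by (intro closed_Collect_conj closed_Collect_le closed_Collect_eq continuous_intros)
    moreover have "compact ?K" using A by (intro compact_Times) auto
    ultimately have "compact (?K \<inter> ?C)" by (intro compact_Int_closed)
    then have "compact (fst ` (?K \<inter> ?C))" by (intro compact_continuous_image continuous_intros)
    moreover have "fst ` (?K \<inter> ?C) = Q n"
    proof (intro set_eqI iffI)
      fix p assume "p \<in> Q n"
      then obtain a t z where "p = (a, t)" "a \<in> A" "\<bar>t\<bar> \<le> real n" "z \<in> A" "1 / real (Suc n) \<le> \<bar>z $ 2 - a $ 2\<bar>"
        "z $ 1 - a $ 1 = t * (z $ 2 - a $ 2)" by (auto simp: Q_def)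
      then show "p \<in> fst ` (?K \<inter> ?C)" by (intro image_eqI[of _ _ "(p, z)"]) auto
    qed (auto simp: Q_def)
    ultimately show ?thesis by simp
  qed
  then have Qb: "(\<Union>n. Q n) \<in> sets (borel \<Otimes>\<^sub>M borel)"
    by (subst borel_prod) (intro sets.countable_UN', auto intro: borel_compact)
  have "{p. fst p \<in> isolated_along A (snd p)} = (A \<times> UNIV) - (\<Union>n. Q n)"
  proof (intro set_eqI iffI)
    fix p assume p: "p \<in> {p. fst p \<in> isolated_along A (snd p)}"
    have "p \<notin> Q n" for n
    proof
      assume "p \<in> Q n"
      then obtain z where z: "z \<in> A" "1 / real (Suc n) \<le> \<bar>z $ 2 - fst p $ 2\<bar>"
        "z $ 1 - fst p $ 1 = snd p * (z $ 2 - fst p $ 2)" by (auto simp: Q_def)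
      have "0 < 1 / real (Suc n)" by simp
      then have "z $ 2 \<noteq> fst p $ 2" using z(2) by fastforce
      then show False using p z by (auto simp: isolated_along_def field_simps)
    qed
    then show "p \<in> (A \<times> UNIV) - (\<Union>n. Q n)" using p by (auto simp: isolated_along_def mem_Times_iff)
  next
    fix p assume p: "p \<in> (A \<times> UNIV) - (\<Union>n. Q n)"
    have "(z $ 1 - fst p $ 1) / (z $ 2 - fst p $ 2) \<noteq> snd p" if z: "z \<in> A" "z $ 2 \<noteq> fst p $ 2" for z
    proof
      assume eq: "(z $ 1 - fst p $ 1) / (z $ 2 - fst p $ 2) = snd p"
      obtain n1 where n1: "1 / real (Suc n1) < \<bar>z $ 2 - fst p $ 2\<bar>" using nat_approx_posE[of "\<bar>z $ 2 - fst p $ 2\<bar>"] z(2) by auto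
      obtain n2 :: nat where n2: "\<bar>snd p\<bar> < real n2" using reals_Archimedean2 by blast
      define n where "n = max n1 n2"
      have "1 / real (Suc n) \<le> 1 / real (Suc n1)" by (intro divide_left_mono) (auto simp: n_def)
      then have "1 / real (Suc n) \<le> \<bar>z $ 2 - fst p $ 2\<bar>" "\<bar>snd p\<bar> \<le> real n"
        using n1 n2 by (auto simp: n_def)
      moreover have "z $ 1 - fst p $ 1 = snd p * (z $ 2 - fst p $ 2)" using eq z(2) by (simp add: field_simps)
      moreover have "fst p \<in> A" using p by auto
      ultimately have "p \<in> Q n" using z(1) unfolding Q_def by (cases p) auto
      then show False using p by blast
    qed
    then show "p \<in> {p. fst p \<in> isolated_along A (snd p)}" using p by (auto simp: isolated_along_def mem_Times_iff)
  qed
  also have "\<dots> \<in> sets (borel \<Otimes>\<^sub>M borel)" by (rule sets.Diff[OF pair_measureI[OF borel_compact[OF A] space_in_borel] Qb])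
  finally show ?thesis .
qed

text \<open>How narrow the cones must be depends on the point, but the bound of
  \<open>sparse_cones_small\<close> does not depend on the width. So the sets \<open>F n\<close> on
  which width \<open>1 / real (Suc n)\<close> works are uniformly small, and this passes to their
  increasing union.\<close>

lemma sparse_density_null:
  fixes A :: "(real^2) set"
  assumes A: "compact A" "hausdorff1 A < \<infinity>" and pu: "purely_1_unrectifiable A"
  shows "hausdorff1 {a\<in>A. \<forall>j. \<exists>K. \<forall>k\<ge>K. sector_density (hausdorff1_on A) a (ball t (1 / real k)) \<le> ennreal (1 / real (Suc j) / real k)} = 0"
    (is "hausdorff1 ?E = 0")
proof -
  have Ab: "A \<in> sets borel" using A(1) by (rule borel_compact)
  let ?\<mu> = "hausdorff1_on A"
  have fin: "finite_measure ?\<mu>" by (rule finite_measure_hausdorff1_on[OF Ab A(2)])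
  obtain R0 where R0: "\<And>x. x \<in> A \<Longrightarrow> norm x \<le> R0" using compact_imp_bounded[OF A(1)] by (auto simp: bounded_iff)
  define R where "R = max R0 1"
  have R: "0 < R" "\<And>x. x \<in> A \<Longrightarrow> \<bar>x $ 1\<bar> \<le> R \<and> \<bar>x $ 2\<bar> \<le> R"
  proof -
    show "\<bar>x $ 1\<bar> \<le> R \<and> \<bar>x $ 2\<bar> \<le> R" if "x \<in> A" for x
      using R0[OF that] component_le_norm_cart[of x 1] component_le_norm_cart[of x 2] unfolding R_def by linarith
  qed (simp add: R_def)
  have "hausdorff1 ?E \<le> 0 + ennreal e" if e: "0 < e" for e
  proof -
    have c: "0 < 80 * (2 + \<bar>t\<bar>) * R" using R(1) by simp
    obtain j where j: "1 / real (Suc j) < e / (80 * (2 + \<bar>t\<bar>) * R)"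
      using nat_approx_posE[of "e / (80 * (2 + \<bar>t\<bar>) * R)"] e c by auto
    define F where "F n = {a\<in>A. \<forall>k\<ge>Suc n. sector_density ?\<mu> a (ball t (1 / real k)) \<le> ennreal (1 / real (Suc j) / real k)}" for n
    have Fb: "F n \<in> sets borel" for n
    proof -
      have sm: "(\<lambda>a. sector_density ?\<mu> a (ball t (1 / real k))) \<in> borel_measurable borel" if "0 < k" for k
        using measurable_compose[OF measurable_Pair2'[of t borel borel] measurable_sector_density[OF fin, of "1 / real k"]]
          that by simp
      have "F n = (\<Inter>k. A \<inter> {a \<in> space borel. sector_density ?\<mu> a (ball t (1 / real (Suc n + k))) \<le> ennreal (1 / real (Suc j) / real (Suc n + k))})"
      proof -
        have all_ge: "(\<forall>k\<ge>m. P k) \<longleftrightarrow> (\<forall>k. P (m + k))" for m :: nat and P by (metis le_add1 le_iff_add)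
        show ?thesis unfolding F_def all_ge by (intro set_eqI) (simp del: of_nat_Suc of_nat_add)
      qed
      also have "\<dots> \<in> sets borel"
      proof (rule sets.countable_INT'')
        fix k
        have "(\<lambda>a. sector_density ?\<mu> a (ball t (1 / real (Suc n + k)))) \<in> borel_measurable borel" by (rule sm) simp
        then show "A \<inter> {a \<in> space borel. sector_density ?\<mu> a (ball t (1 / real (Suc n + k))) \<le> ennreal (1 / real (Suc j) / real (Suc n + k))} \<in> sets borel"
          using Ab by (intro sets.Int borel_measurable_le borel_measurable_const)
      qed (auto intro: countableI_type)
      finally show ?thesis .
    qed
    have Fsmall: "hausdorff1 (F n) \<le> ennreal (80 * (2 + \<bar>t\<bar>) * R * (1 / real (Suc j)))" for n
    proof (rule sparse_cones_small[OF pu _ R, where s="1 / real (Suc n)"])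
      fix a and r :: real assume a: "a \<in> F n" and r: "r \<in> \<rat>" "0 < r"
      let ?S = "sector a (ball t (1 / real (Suc n))) r"
      have "emeasure ?\<mu> ?S / ennreal r \<le> ennreal (1 / real (Suc j) / real (Suc n))"
        using a sector_density_upper[OF r] unfolding F_def by (blast intro: order_trans order_refl)
      then have "emeasure ?\<mu> ?S / ennreal r * ennreal r \<le> ennreal (1 / real (Suc j) / real (Suc n)) * ennreal r"
        by (intro mult_right_mono) auto
      also have "emeasure ?\<mu> ?S / ennreal r * ennreal r = emeasure ?\<mu> ?S"
        using r(2) by (simp add: ennreal_divide_times divide_mult_eq)
      also have "emeasure ?\<mu> ?S = hausdorff1 (A \<inter> ?S)" using Ab by (intro emeasure_hausdorff1_on sector_borel) auto
      also have "ennreal (1 / real (Suc j) / real (Suc n)) * ennreal r = ennreal (1 / real (Suc j) * (1 / real (Suc n)) * r)"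
        using r(2) by (subst ennreal_mult[symmetric]) auto
      finally show "hausdorff1 (A \<inter> ?S) \<le> ennreal (1 / real (Suc j) * (1 / real (Suc n)) * r)" .
    qed (auto simp: F_def)
    have "incseq F" unfolding F_def incseq_def by auto
    then have "emeasure ?\<mu> (\<Union>n. F n) = (SUP n. emeasure ?\<mu> (F n))"
      using Fb by (intro SUP_emeasure_incseq[symmetric]) auto
    also have "\<dots> \<le> ennreal (80 * (2 + \<bar>t\<bar>) * R * (1 / real (Suc j)))"
    proof (rule SUP_least)
      fix n
      have "emeasure ?\<mu> (F n) = hausdorff1 (A \<inter> F n)" using Ab Fb by (rule emeasure_hausdorff1_on)
      also have "\<dots> \<le> hausdorff1 (F n)" by (rule hausdorff1_mono) auto
      finally show "emeasure ?\<mu> (F n) \<le> ennreal (80 * (2 + \<bar>t\<bar>) * R * (1 / real (Suc j)))" using Fsmall order_trans by blast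
    qed
    also have "\<dots> \<le> ennreal e" using j c e by (intro ennreal_leI) (simp add: field_simps)
    finally have small: "emeasure ?\<mu> (\<Union>n. F n) \<le> ennreal e" .
    have "?E \<subseteq> A \<inter> (\<Union>n. F n)"
    proof
      fix a assume "a \<in> ?E"
      then obtain K where K: "a \<in> A" "\<And>k. K \<le> k \<Longrightarrow> sector_density ?\<mu> a (ball t (1 / real k)) \<le> ennreal (1 / real (Suc j) / real k)"
        by auto
      then have "a \<in> F K" by (auto simp: F_def)
      then show "a \<in> A \<inter> (\<Union>n. F n)" using K(1) by blast
    qed
    then have "hausdorff1 ?E \<le> hausdorff1 (A \<inter> (\<Union>n. F n))" by (rule hausdorff1_mono)
    also have "\<dots> = emeasure ?\<mu> (\<Union>n. F n)" using Ab Fb by (intro emeasure_hausdorff1_on[symmetric]) auto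
    finally show ?thesis using small by simp
  qed
  then have "hausdorff1 ?E \<le> 0" by (rule ennreal_le_epsilon)
  then show ?thesis by simp
qed

lemma isolated_projection_null:
  assumes A: "compact A" "hausdorff1 A < \<infinity>" and pu: "purely_1_unrectifiable A"
  shows "AE t in lborel. negligible (oblique t ` isolated_along A t)"
proof -
  have Ab[measurable]: "A \<in> sets borel" using A(1) by (rule borel_compact)
  define \<mu> where "\<mu> = hausdorff1_on A"
  have fin: "finite_measure \<mu>" unfolding \<mu>_def by (rule finite_measure_hausdorff1_on[OF Ab A(2)])
  interpret finite_measure \<mu> by (rule fin)
  have sets\<mu>[measurable_cong]: "sets \<mu> = sets borel" and space\<mu>: "space \<mu> = UNIV" by (simp_all add: \<mu>_def)
  define d where "d k a t = sector_density \<mu> a (ball t (1 / real k))" for k a t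
  \<comment> \<open>Indices start at \<open>Suc k\<close> since \<open>1 / real 0\<close> is 0 and
    the ball would be empty. In \<open>zero\<close>, the sum \<open>K + k\<close> replaces a bounded
    quantifier by an unrestricted one, which suits the measurability proof.\<close>
  define bdd where "bdd a t \<longleftrightarrow> (\<exists>M::nat. \<forall>k::nat. d (Suc k) a t \<le> ennreal (real M / real (Suc k)))" for a t
  define zero where "zero a t \<longleftrightarrow> (\<forall>j. \<exists>K. \<forall>k. d (Suc (K + k)) a t \<le> ennreal (1 / real (Suc j) / real (Suc (K + k))))" for a t
  have zeroI: "zero a t \<longleftrightarrow> (\<forall>j. \<exists>K. \<forall>k\<ge>K. d k a t \<le> ennreal (1 / real (Suc j) / real k))" for a t
  proof
    assume "zero a t"
    then show "\<forall>j. \<exists>K. \<forall>k\<ge>K. d k a t \<le> ennreal (1 / real (Suc j) / real k)"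
      unfolding zero_def by (metis add_Suc le_iff_add)
  next
    assume "\<forall>j. \<exists>K. \<forall>k\<ge>K. d k a t \<le> ennreal (1 / real (Suc j) / real k)"
    then show "zero a t" unfolding zero_def by (meson le_SucI le_add1)
  qed
  have dm: "(\<lambda>p. d (Suc k) (fst p) (snd p)) \<in> borel_measurable (borel \<Otimes>\<^sub>M borel)" for k
    unfolding d_def by (rule measurable_sector_density[OF fin sets\<mu>]) simp
  have dm': "d (Suc k) a \<in> borel_measurable borel" for k a
    using measurable_compose[OF measurable_Pair1'[of a borel borel] dm] by simp
  define Bad where "Bad a t \<longleftrightarrow> a \<in> isolated_along A t \<and> bdd a t \<and> \<not> zero a t" for a t
  have meas: "{p. Bad (fst p) (snd p)} \<in> sets (borel \<Otimes>\<^sub>M borel)"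
  proof -
    note [measurable] = dm borel_isolated_along[OF A(1)]
    have "{p \<in> space (borel \<Otimes>\<^sub>M borel). p \<in> {p. fst p \<in> isolated_along A (snd p)} \<and>
      (\<exists>M::nat. \<forall>k::nat. d (Suc k) (fst p) (snd p) \<le> ennreal (real M / real (Suc k))) \<and>
      \<not> (\<forall>j. \<exists>K. \<forall>k. d (Suc (K + k)) (fst p) (snd p) \<le> ennreal (1 / real (Suc j) / real (Suc (K + k))))}
      \<in> sets (borel \<Otimes>\<^sub>M borel)" by measurable
    then show ?thesis by (simp add: Bad_def bdd_def zero_def space_pair_measure)
  qed
  have each: "AE t in lborel. \<not> Bad a t" for a
  proof (cases "a \<in> A")
    case True
    \<comment> \<open>Splitting by \<open>M\<close> yields the uniform constant required by
      \<open>zero_infinity\<close>. The cone at \<open>a\<close> over \<open>T M\<close> misses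
      \<open>A\<close>, so the density of \<open>T M\<close> vanishes.\<close>
    define T where "T M = {t. a \<in> isolated_along A t \<and> (\<forall>k. d (Suc k) a t \<le> ennreal (real M / real (Suc k)))}" for M :: nat
    have isoB: "{t. a \<in> isolated_along A t} \<in> sets borel"
    proof -
      have "Pair a -` {p. fst p \<in> isolated_along A (snd p)} \<in> sets borel"
        by (rule sets_Pair1[OF borel_isolated_along[OF A(1)]])
      then show ?thesis by (simp add: vimage_def)
    qed
    have "AE t in lborel. t \<in> T M \<longrightarrow> (\<forall>j. \<exists>K. \<forall>k\<ge>K. sector_density \<mu> a (ball t (1 / real k)) \<le> ennreal (1 / real (Suc j) / real k))" for M
    proof (rule zero_infinity)
      show "T M \<in> sets borel"
      proof -
        note [measurable] = isoB dm'
        have "{t \<in> space borel. t \<in> {t. a \<in> isolated_along A t} \<and> (\<forall>k. d (Suc k) a t \<le> ennreal (real M / real (Suc k)))} \<in> sets borel"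
          by measurable
        then show ?thesis by (simp add: T_def)
      qed
      have "emeasure \<mu> (sector a (T M) r) = 0" for r
      proof -
        have "emeasure \<mu> (sector a (T M) r) = hausdorff1 (A \<inter> sector a (T M) r)"
          unfolding \<mu>_def using \<open>T M \<in> sets borel\<close> by (intro emeasure_hausdorff1_on sector_borel Ab)
        also have "A \<inter> sector a (T M) r = {}" by (auto simp: T_def sector_def isolated_along_def)
        finally show ?thesis by simp
      qed
      then show "sector_density \<mu> a (T M) = 0"
        unfolding sector_density_def by (intro antisym SUP_least) auto
      show "sector_density \<mu> a (ball t (1 / real k)) \<le> ennreal (real M / real k)" if "t \<in> T M" "1 \<le> k" for t k
        using that unfolding T_def d_def by (cases k) auto
    qed (auto intro: sector_density_mono[OF sets\<mu>] sector_density_UN[OF sets\<mu>])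
    then have "AE t in lborel. \<forall>M. t \<in> T M \<longrightarrow> zero a t"
      unfolding zeroI d_def by (simp only: AE_all_countable) blast
    then show ?thesis
    proof eventually_elim
      case (elim t)
      show ?case
      proof
        assume bad: "Bad a t"
        then obtain M :: nat where "\<forall>k. d (Suc k) a t \<le> ennreal (real M / real (Suc k))"
          unfolding Bad_def bdd_def by blast
        then have "t \<in> T M" using bad unfolding T_def Bad_def by blast
        then show False using elim bad unfolding Bad_def by blast
      qed
    qed
  qed (auto simp: Bad_def isolated_along_def)
  interpret P: pair_sigma_finite \<mu> lborel ..
  \<comment> \<open>Fubini: until here the point was fixed and the bad directions were null; from
    here on the direction is fixed and the bad points are null.\<close>
  have "AE t in lborel. AE a in \<mu>. \<not> Bad a t"
  proof (subst P.AE_commute[symmetric])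
    have "{p. Bad (fst p) (snd p)} \<in> sets (\<mu> \<Otimes>\<^sub>M lborel)"
      using meas sets_pair_measure_cong[OF sets\<mu> sets_lborel] by simp
    then have "UNIV - {p. Bad (fst p) (snd p)} \<in> sets (\<mu> \<Otimes>\<^sub>M lborel)"
      using sets.compl_sets[of "{p. Bad (fst p) (snd p)}" "\<mu> \<Otimes>\<^sub>M lborel"] by (simp add: space_pair_measure space\<mu>)
    moreover have "UNIV - {p. Bad (fst p) (snd p)} = {p \<in> space (\<mu> \<Otimes>\<^sub>M lborel). \<not> Bad (fst p) (snd p)}"
      by (auto simp: space_pair_measure space\<mu>)
    ultimately show "{p \<in> space (\<mu> \<Otimes>\<^sub>M lborel). \<not> Bad (fst p) (snd p)} \<in> sets (\<mu> \<Otimes>\<^sub>M lborel)" by simp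
  qed (simp add: each)
  then show ?thesis
  proof (rule AE_mp, intro AE_I2 impI)
    fix t assume "AE a in \<mu>. \<not> Bad a t"
    then obtain N where N: "N \<in> null_sets \<mu>" "{a. Bad a t} \<subseteq> N"
      unfolding eventually_ae_filter space\<mu> by auto
    have "hausdorff1 (A \<inter> N) = 0"
      using N(1) Ab unfolding null_sets_def \<mu>_def by (auto simp: emeasure_hausdorff1_on)
    then have 1: "hausdorff1 {a\<in>A. Bad a t} = 0" by (rule hausdorff1_null_subset) (use N(2) in auto)
    have 2: "hausdorff1 {a\<in>A. zero a t} = 0"
      unfolding zeroI d_def \<mu>_def by (rule sparse_density_null[OF A pu])
    have 3: "negligible (oblique t ` {a. \<not> bdd a t})"
    proof (rule negligible_subset[OF infinite_density_null[OF fin sets\<mu>, of t]], rule image_mono, clarify)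
      fix a M assume "\<not> bdd a t"
      then obtain k where "\<not> d (Suc k) a t \<le> ennreal (real M / real (Suc k))" unfolding bdd_def by blast
      then show "\<exists>k\<ge>1. ennreal (real M / real k) < sector_density \<mu> a (ball t (1 / real k))"
        unfolding d_def by (intro exI[of _ "Suc k"]) auto
    qed
    \<comment> \<open>The first two sets are themselves null and so have null Lipschitz images; of
      the third only the projection is known to be null.\<close>
    have "isolated_along A t \<subseteq> {a\<in>A. Bad a t} \<union> {a\<in>A. zero a t} \<union> {a. \<not> bdd a t}"
      by (auto simp: Bad_def isolated_along_def)
    from image_mono[OF this, of "oblique t"] have "oblique t ` isolated_along A t \<subseteq>
      oblique t ` {a\<in>A. Bad a t} \<union> oblique t ` {a\<in>A. zero a t} \<union> oblique t ` {a. \<not> bdd a t}"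
      by (simp only: image_Un)
    then show "negligible (oblique t ` isolated_along A t)"
      by (rule negligible_subset[rotated])
        (intro negligible_Un 3 lipschitz_image_negligible[OF lipschitz_oblique] 1 2)
  qed
qed

lemma purely_1_unrectifiable_subset:
  "purely_1_unrectifiable A \<Longrightarrow> B \<subseteq> A \<Longrightarrow> purely_1_unrectifiable B"
  unfolding purely_1_unrectifiable_def by (meson Int_mono hausdorff1_null_subset order_refl)

text \<open>A point of a finite fibre is separated from the rest of the fibre, hence isolated within
  \<open>A \<inter> closure U\<close> for a small basic open \<open>U\<close>. Countability of the
  basis lets one null set of directions serve all neighbourhoods; closures keep the pieces
  compact.\<close>

lemma besicovitch_projection_compact:
  assumes A: "compact A" "hausdorff1 A < \<infinity>" and pu: "purely_1_unrectifiable A"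
  shows "AE t in lborel. negligible (oblique t ` A)"
proof -
  obtain \<B> :: "(real^2) set set" where \<B>: "countable \<B>" "topological_basis \<B>"
    using ex_countable_basis by blast
  have "AE t in lborel. \<forall>U\<in>\<B>. negligible (oblique t ` isolated_along (A \<inter> closure U) t)"
  proof (rule AE_ball_countable'[OF _ \<B>(1)])
    fix U
    show "AE t in lborel. negligible (oblique t ` isolated_along (A \<inter> closure U) t)"
    proof (rule isolated_projection_null)
      show "compact (A \<inter> closure U)" using A(1) by (intro compact_Int_closed) auto
      show "hausdorff1 (A \<inter> closure U) < \<infinity>" using hausdorff1_mono[of "A \<inter> closure U" A] A(2) by auto
    qed (use purely_1_unrectifiable_subset[OF pu] in blast)
  qed
  then show ?thesis
  proof (rule AE_mp, intro AE_I2 impI)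
    fix t assume t: "\<forall>U\<in>\<B>. negligible (oblique t ` isolated_along (A \<inter> closure U) t)"
    define Inf where "Inf = {y. \<not> finite {x\<in>A. oblique t x = y}}"
    have "negligible Inf"
      using AE_finite_fibers[OF lipschitz_oblique A(2)] by (simp add: AE_lborel_iff_negligible Inf_def)
    moreover have "negligible (\<Union>U\<in>\<B>. oblique t ` isolated_along (A \<inter> closure U) t)"
      using t \<B>(1) by (intro negligible_countable_Union) auto
    moreover have "oblique t ` A \<subseteq> Inf \<union> (\<Union>U\<in>\<B>. oblique t ` isolated_along (A \<inter> closure U) t)"
    proof clarify
      fix a assume a: "a \<in> A" and no: "oblique t a \<notin> (\<Union>U\<in>\<B>. oblique t ` isolated_along (A \<inter> closure U) t)"
      show "oblique t a \<in> Inf"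
      proof (rule ccontr)
        assume "oblique t a \<notin> Inf"
        then have "finite {x\<in>A. oblique t x = oblique t a}" by (simp add: Inf_def)
        then obtain \<delta> where \<delta>: "0 < \<delta>" "\<And>x y. x \<in> {x\<in>A. oblique t x = oblique t a} \<Longrightarrow>
          y \<in> {x\<in>A. oblique t x = oblique t a} \<Longrightarrow> x \<noteq> y \<Longrightarrow> \<delta> \<le> dist x y"
          using finite_separated by blast
        obtain U where U: "U \<in> \<B>" "a \<in> U" "U \<subseteq> ball a (\<delta>/2)"
          using topological_basisE[OF \<B>(2), of "ball a (\<delta>/2)" a] \<delta>(1) by auto
        have cl: "closure U \<subseteq> cball a (\<delta>/2)"
          using U(3) ball_subset_cball by (intro closure_minimal) auto
        have "a \<in> isolated_along (A \<inter> closure U) t"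
          unfolding isolated_along_def
        proof (intro CollectI conjI ballI impI notI)
          show "a \<in> A \<inter> closure U" using a U(2) closure_subset by blast
          fix z assume z: "z \<in> A \<inter> closure U" "z $ 2 \<noteq> a $ 2" "(z $ 1 - a $ 1) / (z $ 2 - a $ 2) = t"
          then have "z $ 1 - a $ 1 = t * (z $ 2 - a $ 2)" by (auto simp: field_simps)
          then have "oblique t z - oblique t a = 0" by (simp add: oblique_diff)
          then have "\<delta> \<le> dist a z" using z a by (intro \<delta>(2)) auto
          moreover have "dist a z \<le> \<delta>/2" using cl z(1) by auto
          ultimately show False using \<delta>(1) by simp
        qed
        then show False using no U(1) by blast
      qed
    qed
    ultimately show "negligible (oblique t ` A)" by (meson negligible_Un negligible_subset)
  qed
qed

theorem besicovitch_projection: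
  fixes A :: "(real^2) set"
  assumes A: "hausdorff1_measurable A" "hausdorff1 A < \<infinity>" and pu: "purely_1_unrectifiable A"
  shows "AE t in lborel. negligible (oblique t ` A)"
proof -
  obtain K :: "nat \<Rightarrow> (real^2) set" where K: "\<And>n. compact (K n)" "\<And>n. K n \<subseteq> A" "hausdorff1 (A - (\<Union>n. K n)) = 0"
    using hausdorff1_measurable_compact_approx[OF A] by blast
  have "AE t in lborel. negligible (oblique t ` K n)" for n
  proof (rule besicovitch_projection_compact[OF K(1)])
    show "hausdorff1 (K n) < \<infinity>" using hausdorff1_mono[OF K(2)] A(2) by (metis order_le_less_trans)
  qed (rule purely_1_unrectifiable_subset[OF pu K(2)])
  then have "AE t in lborel. \<forall>n. negligible (oblique t ` K n)" by (simp only: AE_all_countable) blast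
  then show ?thesis
  proof eventually_elim
    case (elim t)
    have "oblique t ` A \<subseteq> oblique t ` (A - (\<Union>n. K n)) \<union> (\<Union>n. oblique t ` K n)" by blast
    moreover have "negligible (\<Union>n. oblique t ` K n)" using elim by (intro negligible_countable_Union) auto
    ultimately show ?case
      using lipschitz_image_negligible[OF lipschitz_oblique K(3), of t] by (meson negligible_Un negligible_subset)
  qed
qed

subsection \<open>Curves with two null projections\<close>

text \<open>For nonzero \<open>w\<close> the linear form with kernel spanned by \<open>w\<close>. If
  \<open>w $ 2 \<noteq> 0\<close> it is \<open>w $ 2\<close> times the oblique coordinate of slope
  \<open>w $ 1 / w $ 2\<close>, but horizontal \<open>w\<close> are allowed too.\<close>

definition cross2 :: "real^2 \<Rightarrow> real^2 \<Rightarrow> real" where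
  "cross2 w x = x $ 1 * w $ 2 - x $ 2 * w $ 1"

lemma cross2_diff: "cross2 w (x - y) = cross2 w x - cross2 w y"
  by (simp add: cross2_def algebra_simps)

lemma lipschitz_cross2: "(\<bar>w $ 2\<bar> + \<bar>w $ 1\<bar>)-lipschitz_on UNIV (cross2 w)"
proof (rule lipschitz_onI)
  fix x y :: "real^2"
  have "\<bar>(x - y) $ 1 * w $ 2 - (x - y) $ 2 * w $ 1\<bar> \<le> \<bar>(x - y) $ 1\<bar> * \<bar>w $ 2\<bar> + \<bar>(x - y) $ 2\<bar> * \<bar>w $ 1\<bar>"
    by (metis abs_mult abs_triangle_ineq4)
  also have "\<dots> \<le> norm (x - y) * \<bar>w $ 2\<bar> + norm (x - y) * \<bar>w $ 1\<bar>"
    by (intro add_mono mult_right_mono component_le_norm_cart) auto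
  finally show "dist (cross2 w x) (cross2 w y) \<le> (\<bar>w $ 2\<bar> + \<bar>w $ 1\<bar>) * dist x y"
    by (simp add: dist_real_def cross2_diff[symmetric] dist_norm algebra_simps cross2_def)
qed simp

text \<open>Two linear forms with different kernels are coordinates of the plane, and Cramer's rule
  recovers \<open>x\<close> from them.\<close>

lemma cross2_norm_bound:
  assumes "cross2 w w' \<noteq> 0"
  obtains c where "0 < c" "\<And>x. norm x \<le> c * (\<bar>cross2 w x\<bar> + \<bar>cross2 w' x\<bar>)"
proof -
  let ?D = "cross2 w w'"
  define S where "S = \<bar>w $ 1\<bar> + \<bar>w $ 2\<bar> + \<bar>w' $ 1\<bar> + \<bar>w' $ 2\<bar> + 1"
  have D: "0 < \<bar>?D\<bar>" using assms by simp
  have S: "0 < S" by (simp add: S_def)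
  have "norm x \<le> (2 * S / \<bar>?D\<bar>) * (\<bar>cross2 w x\<bar> + \<bar>cross2 w' x\<bar>)" for x
  proof -
    have comp: "\<bar>a * cross2 w x - b * cross2 w' x\<bar> \<le> S * (\<bar>cross2 w x\<bar> + \<bar>cross2 w' x\<bar>)"
      if "\<bar>a\<bar> \<le> S" "\<bar>b\<bar> \<le> S" for a b
    proof -
      have "\<bar>a * cross2 w x - b * cross2 w' x\<bar> \<le> \<bar>a\<bar> * \<bar>cross2 w x\<bar> + \<bar>b\<bar> * \<bar>cross2 w' x\<bar>"
        by (metis abs_mult abs_triangle_ineq4)
      also have "\<dots> \<le> S * \<bar>cross2 w x\<bar> + S * \<bar>cross2 w' x\<bar>" using that by (intro add_mono mult_right_mono) auto
      finally show ?thesis by (simp add: algebra_simps)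
    qed
    have 1: "w' $ 1 * cross2 w x - w $ 1 * cross2 w' x = x $ 1 * ?D"
      and 2: "w' $ 2 * cross2 w x - w $ 2 * cross2 w' x = x $ 2 * ?D"
      by (simp_all add: cross2_def algebra_simps)
    have "norm x * \<bar>?D\<bar> \<le> (\<bar>x $ 1\<bar> + \<bar>x $ 2\<bar>) * \<bar>?D\<bar>"
      using norm_le_l1_cart[of x] by (intro mult_right_mono) (auto simp: sum_2)
    also have "\<dots> = \<bar>x $ 1 * ?D\<bar> + \<bar>x $ 2 * ?D\<bar>" by (simp add: abs_mult algebra_simps)
    also have "\<dots> \<le> S * (\<bar>cross2 w x\<bar> + \<bar>cross2 w' x\<bar>) + S * (\<bar>cross2 w x\<bar> + \<bar>cross2 w' x\<bar>)"
      unfolding 1[symmetric] 2[symmetric] by (intro add_mono comp) (auto simp: S_def)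
    finally show ?thesis using D by (simp add: field_simps)
  qed
  then show ?thesis using D S by (intro that[of "2 * S / \<bar>?D\<bar>"]) auto
qed

text \<open>An open neighbourhood of \<open>S\<close> has measure at most \<open>2 * m\<close> and
  its image \<open>hausdorff1\<close> at most \<open>20 * L * m\<close>; an extra \<open>m\<close>
  makes the inequality strict, and passing from diameters to intervals doubles the total.\<close>

lemma lipschitz_real_image_cover:
  fixes g :: "real \<Rightarrow> real"
  assumes g: "L-lipschitz_on UNIV g" and S: "S \<in> sets borel" "emeasure lborel S \<le> ennreal m" and m: "0 < m"
  obtains V where "V \<in> sets borel" "g ` S \<subseteq> V" "emeasure lborel V \<le> ennreal ((40 * L + 2) * m)"
proof -
  have L: "0 \<le> L" using g by (rule lipschitz_on_nonneg)
  have "S \<in> sets lebesgue" using S(1) by (simp add: sets_completionI_sets)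
  then obtain U where U: "open U" "S \<subseteq> U" "U - S \<in> lmeasurable" "emeasure lebesgue (U - S) < ennreal m"
    using sets_lebesgue_outer_open m by metis
  have "emeasure lborel U = emeasure lebesgue U" using U(1) by simp
  also have "\<dots> \<le> emeasure lebesgue (U - S) + emeasure lebesgue S"
    using U \<open>S \<in> sets lebesgue\<close> by (intro order_trans[OF emeasure_mono emeasure_subadditive]) auto
  also have "\<dots> \<le> ennreal m + ennreal m" using U(4) S by (intro add_mono) auto
  finally have Um: "emeasure lborel U \<le> ennreal (2 * m)" using m by (simp add: ennreal_plus[symmetric] del: ennreal_plus)
  have "hausdorff1 (g ` S) \<le> ennreal (10 * L) * emeasure lborel U"
    by (rule hausdorff1_lipschitz_image_le[OF lipschitz_on_subset[OF g subset_UNIV] U(1,2)])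
  also have "\<dots> \<le> ennreal (10 * L) * ennreal (2 * m)" using Um by (intro mult_left_mono) auto
  also have "\<dots> = ennreal (20 * L * m)" using L m by (subst ennreal_mult[symmetric]) auto
  also have "\<dots> < ennreal ((20 * L + 1) * m)" using L m by (intro ennreal_lessI mult_strict_right_mono mult_pos_pos) auto
  finally have "hausdorff1 (g ` S) < ennreal ((20 * L + 1) * m)" .
  then obtain V where V: "V \<in> sets borel" "(\<lambda>x. x) ` (g ` S) \<subseteq> V"
    "emeasure lborel V \<le> ennreal (2 * 1) * ennreal ((20 * L + 1) * m)"
    by (rule lipschitz_image_cover[OF lipschitz_on_id])
  have "ennreal (2 * 1) * ennreal ((20 * L + 1) * m) = ennreal ((40 * L + 2) * m)"
    using L m by (subst ennreal_mult[symmetric]) (auto simp: algebra_simps)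
  then show ?thesis using V by (intro that[of V]) auto
qed

text \<open>The interval spanned by the values of \<open>g\<close> on a ball is covered by a null set and the
  image of the small part of the ball outside \<open>F\<close>.\<close>

lemma null_image_oscillation:
  fixes g :: "real \<Rightarrow> real"
  assumes g: "L-lipschitz_on UNIV g" and F: "F \<in> sets borel" "g ` F \<subseteq> G" "G \<in> null_sets lborel"
    and dens: "emeasure lborel (cball u s - F) \<le> ennreal m" and m: "0 < m" and v: "v \<in> cball u s" "v' \<in> cball u s"
  shows "\<bar>g v - g v'\<bar> \<le> (40 * L + 2) * m"
proof -
  have L: "0 \<le> L" using g by (rule lipschitz_on_nonneg)
  obtain V where V: "V \<in> sets borel" "g ` (cball u s - F) \<subseteq> V" "emeasure lborel V \<le> ennreal ((40 * L + 2) * m)"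
    using lipschitz_real_image_cover[OF g _ dens m] F(1) by auto
  have "connected (g ` cball u s)"
    by (intro connected_continuous_image continuous_on_subset[OF lipschitz_on_continuous_on[OF g]]) auto
  then have sub: "{min (g v) (g v')..max (g v) (g v')} \<subseteq> g ` cball u s"
    using v by (intro connected_contains_Icc) (auto simp: min_def max_def)
  have "ennreal \<bar>g v - g v'\<bar> = emeasure lborel {min (g v) (g v')..max (g v) (g v')}"
    by (simp add: min_def max_def abs_if)
  also have "\<dots> \<le> emeasure lborel (G \<union> V)"
  proof (rule emeasure_mono)
    have "g ` cball u s \<subseteq> G \<union> V" using V(2) F(2) by blast
    then show "{min (g v) (g v')..max (g v) (g v')} \<subseteq> G \<union> V" using sub by (rule order_trans[rotated])
  qed (use V(1) F(3) in auto)
  also have "\<dots> \<le> emeasure lborel G + emeasure lborel V" using F(3) V(1) by (intro emeasure_subadditive) auto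
  also have "\<dots> \<le> ennreal ((40 * L + 2) * m)" using F(3) V(3) by (simp add: null_setsD1)
  finally show ?thesis using L m by simp
qed

text \<open>At a density point of the parameters that both coordinates send into null sets, each
  coordinate oscillates little compared with the radius. Hence so does \<open>f\<close>, and
  \<open>hausdorff1_image_le\<close> applies with an arbitrarily small factor.\<close>

lemma curve_null_if_two_projections_null:
  fixes f :: "real \<Rightarrow> real^2"
  assumes f: "M-lipschitz_on UNIV f" and w: "cross2 w w' \<noteq> 0"
    and null: "negligible (cross2 w ` A)" "negligible (cross2 w' ` A)"
  shows "hausdorff1 (A \<inter> range f) = 0"
proof -
  obtain c where c: "0 < c" "\<And>x. norm x \<le> c * (\<bar>cross2 w x\<bar> + \<bar>cross2 w' x\<bar>)"
    using cross2_norm_bound[OF w] by blast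
  obtain G where G: "G \<in> null_sets lborel" "cross2 w ` A \<subseteq> G" using negligible_borel_superset[OF null(1)] .
  obtain G' where G': "G' \<in> null_sets lborel" "cross2 w' ` A \<subseteq> G'" using negligible_borel_superset[OF null(2)] .
  define g where "g u = cross2 w (f u)" for u
  define g' where "g' u = cross2 w' (f u)" for u
  obtain L where L: "L-lipschitz_on UNIV g" "L-lipschitz_on UNIV g'"
  proof -
    define L where "L = max ((\<bar>w $ 2\<bar> + \<bar>w $ 1\<bar>) * M) ((\<bar>w' $ 2\<bar> + \<bar>w' $ 1\<bar>) * M)"
    have "((\<bar>w $ 2\<bar> + \<bar>w $ 1\<bar>) * M)-lipschitz_on UNIV g" "((\<bar>w' $ 2\<bar> + \<bar>w' $ 1\<bar>) * M)-lipschitz_on UNIV g'"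
      unfolding g_def g'_def
      by (rule lipschitz_on_compose2[OF f lipschitz_on_subset[OF lipschitz_cross2 subset_UNIV]])+
    then have "L-lipschitz_on UNIV g" "L-lipschitz_on UNIV g'"
      by (auto simp: L_def intro: lipschitz_on_mono)
    then show ?thesis by (rule that)
  qed
  have L0: "0 \<le> L" using L(1) by (rule lipschitz_on_nonneg)
  have [measurable]: "g \<in> borel_measurable borel" "g' \<in> borel_measurable borel"
    using L by (auto intro!: borel_measurable_continuous_onI lipschitz_on_continuous_on)
  \<comment> \<open>Defined through the Borel hulls \<open>G\<close> and \<open>G'\<close>, so that
    \<open>F\<close> is Borel for arbitrary \<open>A\<close>; it contains every \<open>u\<close>
    with \<open>f u\<close> in \<open>A\<close>.\<close>
  define F where "F = {u. g u \<in> G \<and> g' u \<in> G'}"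
  have F[measurable]: "F \<in> sets borel"
  proof -
    have [measurable]: "G \<in> sets borel" "G' \<in> sets borel" using G(1) G'(1) by auto
    have "{u \<in> space borel. g u \<in> G \<and> g' u \<in> G'} \<in> sets borel" by measurable
    then show ?thesis by (simp add: F_def)
  qed
  define dense where "dense \<eta> t \<longleftrightarrow>
    (\<exists>s0>0. \<forall>s. 0 < s \<and> s \<le> s0 \<longrightarrow> emeasure lborel (cball t s - F) \<le> ennreal (\<eta> * s))" for \<eta> t
  define D where "D = {t\<in>F. \<forall>j. dense (1 / real (Suc j)) t}"
  have "AE t in lborel. \<forall>j. t \<in> F \<longrightarrow> dense (1 / real (Suc j)) t"
    unfolding dense_def AE_all_countable by (intro allI lebesgue_density[OF F]) simp
  then have "negligible (F - D)"
    unfolding AE_lborel_iff_negligible by (rule negligible_subset) (auto simp: D_def)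
  then have out: "hausdorff1 (f ` (F - D)) = 0"
    by (rule hausdorff1_lipschitz_image_negligible[OF lipschitz_on_subset[OF f subset_UNIV]])
  have inner: "hausdorff1 (f ` (D \<inter> cball 0 (real n))) = 0" for n
  proof -
    have est: "hausdorff1 (f ` (D \<inter> cball 0 (real n))) \<le> ennreal e * emeasure lborel (cball (0::real) (real n + 1))"
      if e: "0 < e" for e
    proof (rule hausdorff1_image_le)
      fix x \<epsilon> :: real assume x: "x \<in> D \<inter> cball 0 (real n)" and \<epsilon>: "0 < \<epsilon>"
      \<comment> \<open>The factor \<open>c\<close> passes from the coordinates to the norm,
        \<open>40 * L + 2\<close> is the oscillation constant, and 10 accounts for two coordinates
        on balls of radius \<open>5 * r\<close>.\<close>
      define Q where "Q = 10 * c * (40 * L + 2)"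
      have Q: "0 < Q" using c(1) L0 by (simp add: Q_def)
      obtain j where j: "1 / real (Suc j) < e / Q" using e Q nat_approx_posE[of "e / Q"] by auto
      obtain s0 where s0: "0 < s0"
        "\<And>s. 0 < s \<Longrightarrow> s \<le> s0 \<Longrightarrow> emeasure lborel (cball x s - F) \<le> ennreal (1 / real (Suc j) * s)"
        using x unfolding D_def dense_def by blast
      define r where "r = min (min (s0 / 5) 1) (\<epsilon> / e)"
      have r: "0 < r" "5 * r \<le> s0" "r \<le> 1" "r \<le> \<epsilon> / e" using s0(1) \<epsilon> e by (auto simp: r_def)
      have er: "e * r \<le> \<epsilon>" using r(4) e by (simp add: field_simps)
      have "dist (f u) (f v) \<le> e * r" if u: "u \<in> cball x (5 * r)" and v: "v \<in> cball x (5 * r)" for u v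
      proof -
        have dens: "emeasure lborel (cball x (5 * r) - F) \<le> ennreal (1 / real (Suc j) * (5 * r))"
          using r by (intro s0(2)) auto
        have osc: "\<bar>g u - g v\<bar> \<le> (40 * L + 2) * (1 / real (Suc j) * (5 * r))"
          by (rule null_image_oscillation[OF L(1) F _ G(1) dens _ u v]) (use r(1) in \<open>auto simp: F_def\<close>)
        have osc': "\<bar>g' u - g' v\<bar> \<le> (40 * L + 2) * (1 / real (Suc j) * (5 * r))"
          by (rule null_image_oscillation[OF L(2) F _ G'(1) dens _ u v]) (use r(1) in \<open>auto simp: F_def\<close>)
        have "dist (f u) (f v) \<le> c * (\<bar>g u - g v\<bar> + \<bar>g' u - g' v\<bar>)"
          using c(2)[of "f u - f v"] by (simp add: dist_norm g_def g'_def cross2_diff)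
        also have "\<dots> \<le> c * ((40 * L + 2) * (1 / real (Suc j) * (5 * r)) + (40 * L + 2) * (1 / real (Suc j) * (5 * r)))"
          using osc osc' c(1) by (intro mult_left_mono add_mono) auto
        also have "\<dots> = Q * (1 / real (Suc j)) * r" by (simp add: Q_def algebra_simps)
        also have "\<dots> \<le> Q * (e / Q) * r" using j Q r(1) by (intro mult_right_mono mult_left_mono) auto
        also have "\<dots> = e * r" using Q by simp
        finally show ?thesis .
      qed
      moreover have "cball x r \<subseteq> cball 0 (real n + 1)" using x r(3) by (auto simp: dist_real_def)
      ultimately show "\<exists>r. 0 < r \<and> r \<le> 1 \<and> cball x r \<subseteq> cball 0 (real n + 1) \<and>
        (\<forall>u\<in>cball x (5 * r) \<inter> (D \<inter> cball 0 (real n)). \<forall>v\<in>cball x (5 * r) \<inter> (D \<inter> cball 0 (real n)).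
          dist (f u) (f v) \<le> min \<epsilon> (e * r))"
        using r er by (intro exI[of _ r]) (auto intro: order_trans)
    qed (use e in auto)
    have "hausdorff1 (f ` (D \<inter> cball 0 (real n))) \<le> 0 + ennreal e" if e: "0 < e" for e
    proof -
      have "hausdorff1 (f ` (D \<inter> cball 0 (real n)))
          \<le> ennreal (e / (2 * (real n + 1))) * emeasure lborel (cball (0::real) (real n + 1))"
        using e by (intro est) auto
      also have "\<dots> = ennreal (e / (2 * (real n + 1))) * ennreal (2 * (real n + 1))"
        by (subst emeasure_lborel_cball_real) auto
      also have "\<dots> = ennreal e" using e by (subst ennreal_mult[symmetric]) auto
      finally show ?thesis by simp
    qed
    then have "hausdorff1 (f ` (D \<inter> cball 0 (real n))) \<le> 0" by (rule ennreal_le_epsilon)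
    then show ?thesis by simp
  qed
  have "hausdorff1 (f ` (F - D) \<union> (\<Union>n\<in>UNIV. f ` (D \<inter> cball 0 (real n)))) = 0"
    using hausdorff1_Un[of "f ` (F - D)" "\<Union>n\<in>UNIV. f ` (D \<inter> cball 0 (real n))"]
      hausdorff1_UN_null[of "UNIV :: nat set" "\<lambda>n. f ` (D \<inter> cball 0 (real n))"] out inner by simp
  moreover have "A \<inter> range f \<subseteq> f ` (F - D) \<union> (\<Union>n\<in>UNIV. f ` (D \<inter> cball 0 (real n)))"
  proof clarify
    fix u assume u: "f u \<in> A" "f u \<notin> (\<Union>n\<in>UNIV. f ` (D \<inter> cball 0 (real n)))"
    have "u \<in> F" using u(1) G(2) G'(2) by (auto simp: F_def g_def g'_def)
    moreover have "u \<notin> D"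
    proof
      assume "u \<in> D"
      moreover obtain n :: nat where "\<bar>u\<bar> \<le> real n" using real_arch_simple by blast
      ultimately have "f u \<in> f ` (D \<inter> cball 0 (real n))" by simp
      then show False using u(2) by blast
    qed
    ultimately show "f u \<in> f ` (F - D)" by blast
  qed
  ultimately show ?thesis by (rule hausdorff1_null_subset)
qed

subsection \<open>Norms on the plane\<close>

lemma is_normD:
  assumes "is_norm N"
  shows "0 \<le> N x" "N x = 0 \<longleftrightarrow> x = 0" "N (c *\<^sub>R x) = \<bar>c\<bar> * N x" "N (x + y) \<le> N x + N y" "N (- x) = N x"
proof -
  show *: "0 \<le> N x" "N x = 0 \<longleftrightarrow> x = 0" "N (c *\<^sub>R x) = \<bar>c\<bar> * N x" "N (x + y) \<le> N x + N y" for x y c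
    using assms by (auto simp: is_norm_def)
  show "N (- x) = N x" using *(3)[of "-1" x] by simp
qed

lemma is_norm_pos: "is_norm N \<Longrightarrow> x \<noteq> 0 \<Longrightarrow> 0 < N x"
  using is_normD(1,2)[of N x] by (metis less_eq_real_def)

lemma is_norm_abs_diff: "is_norm N \<Longrightarrow> \<bar>N x - N y\<bar> \<le> N (x - y)"
  using is_normD(4)[of N "x - y" y] is_normD(4)[of N "y - x" x] is_normD(5)[of N "x - y"] by simp

lemma continuous_is_norm:
  fixes N :: "real^2 \<Rightarrow> real"
  assumes N: "is_norm N" shows "continuous_on S N"
proof -
  define C where "C = N (axis 1 1) + N (axis 2 1)"
  have bound: "N x \<le> C * norm x" for x
  proof -
    have "N x = N (x $ 1 *\<^sub>R axis 1 1 + x $ 2 *\<^sub>R axis 2 1)"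
      by (rule arg_cong[of _ _ N]) (simp add: vec_eq_iff forall_2 axis_def)
    also have "\<dots> \<le> \<bar>x $ 1\<bar> * N (axis 1 1) + \<bar>x $ 2\<bar> * N (axis 2 1)"
      using is_normD(3,4)[OF N] by metis
    also have "\<dots> \<le> norm x * N (axis 1 1) + norm x * N (axis 2 1)"
      using is_normD(1)[OF N] by (intro add_mono mult_right_mono component_le_norm_cart) auto
    finally show ?thesis by (simp add: C_def algebra_simps)
  qed
  have "C-lipschitz_on S N"
    using is_norm_abs_diff[OF N] bound is_normD(1)[OF N]
    by (intro lipschitz_onI) (auto simp: dist_real_def dist_norm C_def intro: order_trans)
  then show ?thesis by (rule lipschitz_on_continuous_on)
qed

lemma frontier_unit_ball:
  fixes N :: "real^2 \<Rightarrow> real"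
  assumes N: "is_norm N" shows "frontier {x. N x \<le> 1} = {x. N x = 1}"
proof -
  have "closed {x. N x \<le> 1}" by (intro closed_Collect_le continuous_is_norm[OF N] continuous_on_const)
  moreover have "interior {x. N x \<le> 1} = {x. N x < 1}"
  proof (rule interior_unique)
    show "open {x. N x < 1}" by (intro open_Collect_less continuous_is_norm[OF N] continuous_on_const)
    fix T assume T: "T \<subseteq> {x. N x \<le> 1}" "open T"
    show "T \<subseteq> {x. N x < 1}"
    proof (rule ccontr)
      assume "\<not> ?thesis"
      then obtain x where x: "x \<in> T" "N x = 1" using T(1) by force
      then obtain e where e: "0 < e" "ball x e \<subseteq> T" using T(2) open_contains_ball by blast
      have x0: "0 < norm x" using x(2) is_normD(2)[OF N, of x] by auto
      define c where "c = e / (2 * norm x)"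
      have c: "0 < c" using e x0 by (simp add: c_def)
      have "dist x ((1 + c) *\<^sub>R x) = c * norm x" using c by (simp add: dist_norm scaleR_left_distrib)
      also have "\<dots> < e" using e x0 by (simp add: c_def)
      finally have "N ((1 + c) *\<^sub>R x) \<le> 1" using e(2) T(1) by (auto simp: subset_iff)
      then show False using c x(2) is_normD(3)[OF N, of "1 + c" x] by simp
    qed
  qed auto
  ultimately have "frontier {x. N x \<le> 1} = {x. N x \<le> 1} - {x. N x < 1}"
    unfolding frontier_def by (metis closure_closed)
  then show ?thesis by (simp only:) force
qed

lemma cross2_zero_imp_parallel:
  assumes "w \<noteq> 0" "cross2 w x = 0"
  shows "x = ((w \<bullet> x) / (w \<bullet> w)) *\<^sub>R w"
proof -
  have "w \<bullet> w \<noteq> 0" using assms(1) by simp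
  moreover have "(w \<bullet> w) *\<^sub>R x = (w \<bullet> x) *\<^sub>R w"
    using assms(2) by (simp add: vec_eq_iff forall_2 inner_vec_def sum_2 cross2_def) algebra
  ultimately show ?thesis by (simp add: vec_eq_iff field_simps)
qed

text \<open>On the cone over a segment in the unit circle \<open>N\<close> coincides with a linear functional, so the
  velocity and the acceleration of the boundary curve in an interior point of the segment are both
  parallel to the segment; as they are orthogonal, the acceleration vanishes.\<close>

lemma strictly_convex_norm:
  fixes N :: "real^2 \<Rightarrow> real"
  assumes N: "is_norm N" and curv: "strictly_positive_curvature (frontier {x. N x \<le> 1})"
    and xy: "N x = 1" "N y = 1" "x \<noteq> y"
  shows "N ((1/2) *\<^sub>R (x + y)) < 1"
proof (rule ccontr)
  assume contr: "\<not> ?thesis"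
  define D where "D = x $ 1 * y $ 2 - x $ 2 * y $ 1"
  have sum2: "2 \<le> N (x + y)" using contr is_normD(3)[OF N, of "1/2" "x + y"] by simp
  have D: "D \<noteq> 0"
  proof
    assume D0: "D = 0"
    have x0: "x \<noteq> 0" using xy(1) is_normD(2)[OF N, of x] by auto
    define c where "c = (x \<bullet> y) / (x \<bullet> x)"
    have y: "y = c *\<^sub>R x"
      using D0 unfolding c_def by (intro cross2_zero_imp_parallel[OF x0]) (simp add: D_def cross2_def mult.commute)
    then have "\<bar>c\<bar> = 1" using xy(1,2) is_normD(3)[OF N, of c x] by simp
    then have "y = - x" using y xy(3) by (auto simp: abs_if split: if_splits)
    then show False using sum2 is_normD(2)[OF N, of 0] by simp
  qed
  have cone: "a + b \<le> N (a *\<^sub>R x + b *\<^sub>R y)" if "0 < a" "0 < b" for a b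
  proof -
    \<comment> \<open>Raising the smaller coefficient to the larger one gives a multiple of
      \<open>x + y\<close>, whose norm is known to be large; the added vector \<open>z\<close> costs
      only the difference of the coefficients.\<close>
    have *: "c + c \<le> N (a *\<^sub>R x + b *\<^sub>R y) + N z"
      if "(a *\<^sub>R x + b *\<^sub>R y) + z = c *\<^sub>R (x + y)" "0 < c" for c z
    proof -
      have "c * 2 \<le> c * N (x + y)" using sum2 that(2) by (intro mult_left_mono) auto
      also have "\<dots> = N ((a *\<^sub>R x + b *\<^sub>R y) + z)" using that is_normD(3)[OF N, of c "x + y"] by simp
      also have "\<dots> \<le> N (a *\<^sub>R x + b *\<^sub>R y) + N z" by (rule is_normD(4)[OF N])
      finally show ?thesis by simp
    qed
    show ?thesis
    proof (cases "a \<le> b")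
      case True
      then show ?thesis using *[of "(b - a) *\<^sub>R x" b] that xy(1) is_normD(3)[OF N, of "b - a" x]
        by (simp add: algebra_simps)
    next
      case False
      then show ?thesis using *[of "(a - b) *\<^sub>R y" a] that xy(2) is_normD(3)[OF N, of "a - b" y]
        by (simp add: algebra_simps)
    qed
  qed
  have cone_eq: "N (a *\<^sub>R x + b *\<^sub>R y) = a + b" if "0 < a" "0 < b" for a b
    using cone[OF that] is_normD(4)[OF N, of "a *\<^sub>R x" "b *\<^sub>R y"] is_normD(3)[OF N] xy(1,2) that by simp
  obtain \<gamma> L where \<gamma>: "arc_length_param \<gamma> L {z. N z = 1}" "\<And>t. 0 < curvature_along \<gamma> t"
    using curv unfolding strictly_positive_curvature_def frontier_unit_ball[OF N] by blast
  define \<gamma>1 where "\<gamma>1 t = vector_derivative \<gamma> (at t)" for t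
  define \<gamma>2 where "\<gamma>2 t = vector_derivative \<gamma>1 (at t)" for t
  have d1: "(\<gamma> has_vector_derivative \<gamma>1 t) (at t)" for t
    using \<gamma>(1) unfolding arc_length_param_def C1_differentiable_on_eq \<gamma>1_def
    by (simp add: vector_derivative_works[symmetric])
  have d2: "(\<gamma>1 has_vector_derivative \<gamma>2 t) (at t)" for t
    using \<gamma>(1) unfolding arc_length_param_def C1_differentiable_on_eq \<gamma>2_def \<gamma>1_def[abs_def]
    by (simp add: vector_derivative_works[symmetric])
  have unit: "\<gamma>1 t \<bullet> \<gamma>1 t = 1" for t
    using \<gamma>(1) by (simp add: arc_length_param_def \<gamma>1_def dot_square_norm)
  have range: "range \<gamma> = {z. N z = 1}" using \<gamma>(1) by (simp add: arc_length_param_def)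
  have "N ((1/2) *\<^sub>R x + (1/2) *\<^sub>R y) = 1" using cone_eq[of "1/2" "1/2"] by simp
  then obtain t0 where t0: "\<gamma> t0 = (1/2) *\<^sub>R x + (1/2) *\<^sub>R y" using range by (metis (mono_tags) mem_Collect_eq imageE)
  define a where "a z = (z $ 1 * y $ 2 - z $ 2 * y $ 1) / D" for z :: "real^2"
  define b where "b z = (x $ 1 * z $ 2 - x $ 2 * z $ 1) / D" for z :: "real^2"
  have ab: "z = a z *\<^sub>R x + b z *\<^sub>R y" for z
  proof -
    have "D *\<^sub>R z = (D * a z) *\<^sub>R x + (D * b z) *\<^sub>R y"
      using D by (simp add: a_def b_def vec_eq_iff forall_2 D_def) (simp add: algebra_simps)
    then have "D *\<^sub>R z = D *\<^sub>R (a z *\<^sub>R x + b z *\<^sub>R y)" by (simp add: scaleR_right_distrib)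
    then show ?thesis by (rule scaleR_left_imp_eq[OF D])
  qed
  \<comment> \<open>Represents the functional that equals 1 at \<open>x\<close> and at
    \<open>y\<close>; it agrees with \<open>N\<close> on the open cone between them.\<close>
  define w :: "real^2" where "w = vector [(y $ 2 - x $ 2) / D, (x $ 1 - y $ 1) / D]"
  have w: "w \<bullet> z = a z + b z" for z
    by (simp add: w_def a_def b_def inner_vec_def sum_2 add_divide_distrib[symmetric] algebra_simps diff_divide_distrib)
  have w0: "w \<noteq> 0" using xy(3) D by (auto simp: w_def vec_eq_iff forall_2)
  have cont\<gamma>: "continuous_on UNIV \<gamma>"
    using d1 by (intro continuous_at_imp_continuous_on ballI has_vector_derivative_continuous)
  define T where "T = {t. 0 < a (\<gamma> t)} \<inter> {t. 0 < b (\<gamma> t)}"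
  have "open T" unfolding T_def a_def b_def
    using D by (intro open_Int open_Collect_less continuous_intros cont\<gamma>) auto
  have "a (\<gamma> t0) = 1/2" "b (\<gamma> t0) = 1/2" unfolding t0 a_def b_def using D by (auto simp: D_def field_simps)
  then have "t0 \<in> T" by (simp add: T_def)
  have w\<gamma>: "w \<bullet> \<gamma> t = 1" if "t \<in> T" for t
  proof -
    have "N (\<gamma> t) = 1" using range by auto
    moreover have "N (\<gamma> t) = a (\<gamma> t) + b (\<gamma> t)" using cone_eq[of "a (\<gamma> t)" "b (\<gamma> t)"] ab[of "\<gamma> t"] that by (simp add: T_def)
    ultimately show ?thesis by (simp add: w)
  qed
  have w1: "w \<bullet> \<gamma>1 t = 0" if "t \<in> T" for t
  proof -
    have "((\<lambda>t. w \<bullet> \<gamma> t) has_vector_derivative w \<bullet> \<gamma>1 t) (at t)"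
      by (rule bounded_linear.has_vector_derivative[OF bounded_linear_inner_right d1])
    then have "((\<lambda>t. 1) has_vector_derivative w \<bullet> \<gamma>1 t) (at t)"
      by (rule has_vector_derivative_transform_within_open[OF _ \<open>open T\<close> that w\<gamma>])
    then show ?thesis by (rule vector_derivative_unique_at[OF _ has_vector_derivative_const])
  qed
  have w2: "w \<bullet> \<gamma>2 t0 = 0"
  proof -
    have "((\<lambda>t. w \<bullet> \<gamma>1 t) has_vector_derivative w \<bullet> \<gamma>2 t0) (at t0)"
      by (rule bounded_linear.has_vector_derivative[OF bounded_linear_inner_right d2])
    then have "((\<lambda>t. 0) has_vector_derivative w \<bullet> \<gamma>2 t0) (at t0)"
      by (rule has_vector_derivative_transform_within_open[OF _ \<open>open T\<close> \<open>t0 \<in> T\<close> w1])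
    then show ?thesis by (rule vector_derivative_unique_at[OF _ has_vector_derivative_const])
  qed
  have orth: "\<gamma>1 t0 \<bullet> \<gamma>2 t0 = 0"
  proof -
    have "((\<lambda>t. \<gamma>1 t \<bullet> \<gamma>1 t) has_vector_derivative \<gamma>1 t0 \<bullet> \<gamma>2 t0 + \<gamma>2 t0 \<bullet> \<gamma>1 t0) (at t0)"
      by (rule bounded_bilinear.has_vector_derivative[OF bounded_bilinear_inner d2 d2])
    then have "\<gamma>1 t0 \<bullet> \<gamma>2 t0 + \<gamma>2 t0 \<bullet> \<gamma>1 t0 = 0"
      unfolding unit by (rule vector_derivative_unique_at[OF _ has_vector_derivative_const])
    then show ?thesis by (simp add: inner_commute)
  qed
  have "\<gamma>2 t0 = 0"
  proof -
    define p q u v where "p = \<gamma>1 t0 $ 1" and "q = \<gamma>1 t0 $ 2" and "u = \<gamma>2 t0 $ 1" and "v = \<gamma>2 t0 $ 2"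
    \<comment> \<open>The cross product of \<open>w\<close> and the velocity, which are orthogonal
      and nonzero; the acceleration is orthogonal to both, so it must vanish.\<close>
    define e where "e = w $ 1 * q - w $ 2 * p"
    have eqs: "w $ 1 * p + w $ 2 * q = 0" "w $ 1 * u + w $ 2 * v = 0" "p * u + q * v = 0" "p * p + q * q = 1"
      using w1[OF \<open>t0 \<in> T\<close>] w2 orth unit[of t0]
      by (simp_all add: inner_vec_def sum_2 p_def q_def u_def v_def)
    have "(w $ 1)\<^sup>2 + (w $ 2)\<^sup>2 \<noteq> 0" using w0 by (auto simp: vec_eq_iff forall_2 sum_power2_eq_zero_iff)
    moreover have "e\<^sup>2 = (w $ 1)\<^sup>2 + (w $ 2)\<^sup>2" using eqs(1,4) unfolding e_def by algebra
    ultimately have "e \<noteq> 0" by auto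
    moreover have "e * u = 0" "e * v = 0" using eqs unfolding e_def by algebra+
    ultimately show ?thesis by (simp add: vec_eq_iff forall_2 u_def v_def)
  qed
  moreover have "curvature_along \<gamma> t0 = norm (\<gamma>2 t0)"
    by (simp add: curvature_along_def \<gamma>2_def \<gamma>1_def[abs_def])
  ultimately show False using \<gamma>(2)[of t0] by simp
qed

text \<open>\<open>m\<close> is the dual norm of \<open>v\<close>, attained at \<open>w\<close> by
  compactness: the unit ball of \<open>N\<close> has outer normal \<open>v\<close> at
  \<open>w\<close>.\<close>

lemma norm_support_vector:
  fixes N :: "real^2 \<Rightarrow> real"
  assumes N: "is_norm N" and v: "v \<noteq> 0"
  obtains w m where "0 < m" "N w = 1" "v \<bullet> w = m" "\<And>z. \<bar>v \<bullet> z\<bar> \<le> m * N z"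
proof -
  let ?S = "sphere (0::real^2) 1"
  have Npos: "0 < N z" if "z \<in> ?S" for z using that by (intro is_norm_pos[OF N]) auto
  have "?S \<noteq> {}" by (simp add: sphere_eq_empty)
  moreover have "continuous_on ?S (\<lambda>z. (v \<bullet> z) / N z)"
    using Npos by (intro continuous_intros continuous_is_norm[OF N]) fastforce
  ultimately obtain z0 where z0: "z0 \<in> ?S" "\<And>z. z \<in> ?S \<Longrightarrow> (v \<bullet> z) / N z \<le> (v \<bullet> z0) / N z0"
    using continuous_attains_sup[OF compact_sphere] by blast
  define m where "m = (v \<bullet> z0) / N z0"
  have le: "v \<bullet> z \<le> m * N z" for z
  proof (cases "z = 0")
    case False
    then have "(1 / norm z) *\<^sub>R z \<in> ?S" by simp
    from z0(2)[OF this] have "(v \<bullet> z) / N z \<le> m" using False is_normD(3)[OF N] by (simp add: m_def)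
    then show ?thesis using is_norm_pos[OF N False] by (simp add: pos_divide_le_eq)
  qed (use is_normD(2)[OF N, of 0] in simp)
  have le': "\<bar>v \<bullet> z\<bar> \<le> m * N z" for z using le[of z] le[of "- z"] is_normD(5)[OF N, of z] by simp
  have "0 < v \<bullet> v" using v by simp
  then have "0 < m * N v" using le[of v] by linarith
  then have "0 < m" using is_norm_pos[OF N v] by (simp add: zero_less_mult_iff)
  moreover have "N ((1 / N z0) *\<^sub>R z0) = 1" using Npos[OF z0(1)] is_normD(3)[OF N] by simp
  moreover have "v \<bullet> ((1 / N z0) *\<^sub>R z0) = m" by (simp add: m_def)
  ultimately show ?thesis using le' that by blast
qed

text \<open>For \<open>q\<close> on the line, \<open>v \<bullet> (x - q)\<close> does not depend on
  \<open>q\<close>, so the support inequality bounds \<open>N (x - q)\<close> from below, with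
  equality for displacement along \<open>w\<close>. Two minimizers, scaled to the unit circle, would
  have a midpoint inside, giving a closer point.\<close>

lemma closest_point_proj_eq:
  fixes N :: "real^2 \<Rightarrow> real"
  assumes N: "is_norm N" and convex: "\<And>x y. N x = 1 \<Longrightarrow> N y = 1 \<Longrightarrow> x \<noteq> y \<Longrightarrow> N ((1/2) *\<^sub>R (x + y)) < 1"
    and w: "0 < m" "N w = 1" "v \<bullet> w = m" "\<And>z. \<bar>v \<bullet> z\<bar> \<le> m * N z"
  shows "closest_point_proj N v x = x - ((v \<bullet> x) / m) *\<^sub>R w"
proof -
  define p where "p = x - ((v \<bullet> x) / m) *\<^sub>R w"
  define \<rho> where "\<rho> = \<bar>v \<bullet> x\<bar> / m"
  have p: "p \<in> orth_line v" using w(1,3) by (simp add: p_def orth_line_def inner_diff_right)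
  have Np: "N (x - p) = \<rho>" using w(1,2) is_normD(3)[OF N] by (simp add: p_def \<rho>_def)
  have lower: "\<rho> \<le> N (x - q)" if "q \<in> orth_line v" for q
    using w(4)[of "x - q"] that w(1) by (simp add: \<rho>_def orth_line_def inner_diff_right field_simps)
  have uniq: "q = p" if q: "q \<in> orth_line v" "N (x - q) = \<rho>" for q
  proof (rule ccontr)
    assume ne: "q \<noteq> p"
    have "\<rho> \<noteq> 0" using ne q(2) Np is_normD(2)[OF N, of "x - q"] is_normD(2)[OF N, of "x - p"] by auto
    then have \<rho>: "0 < \<rho>" using w(1) by (simp add: \<rho>_def)
    let ?mid = "(1/2) *\<^sub>R ((1/\<rho>) *\<^sub>R (x - p) + (1/\<rho>) *\<^sub>R (x - q))"
    define z where "z = x - (1/2) *\<^sub>R (p + q)"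
    have "N ?mid < 1"
      using \<rho> ne q(2) Np is_normD(3)[OF N] by (intro convex) auto
    moreover have "?mid = (1/\<rho>) *\<^sub>R z"
      using \<rho> by (simp add: vec_eq_iff field_simps z_def)
    ultimately have "(1/\<rho>) * N z < 1" using \<rho> is_normD(3)[OF N, of "1/\<rho>" z] by (simp only:) simp
    moreover have "\<rho> \<le> N z"
      unfolding z_def using p q(1) by (intro lower) (simp add: orth_line_def inner_add_right)
    ultimately show False using \<rho> by (simp add: field_simps)
  qed
  have "closest_point_proj N v x = p"
    unfolding closest_point_proj_def
  proof (rule the_equality)
    show "is_arg_min (\<lambda>q. N (x - q)) (\<lambda>q. q \<in> orth_line v) p"
      using p lower Np by (auto simp: is_arg_min_def not_less)
    fix q assume "is_arg_min (\<lambda>q. N (x - q)) (\<lambda>q. q \<in> orth_line v) q"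
    then have "q \<in> orth_line v" "\<not> N (x - p) < N (x - q)" using p by (auto simp: is_arg_min_def)
    then show "q = p" using lower[of q] Np by (intro uniq) auto
  qed
  then show ?thesis by (simp add: p_def)
qed

text \<open>Modulo \<open>w\<close> every \<open>x\<close> is its oblique coordinate times the first
  axis vector, so the projection is a linear function of that coordinate.\<close>

lemma proj_image_null_if_oblique_null:
  fixes v w :: "real^2"
  assumes w: "w $ 2 \<noteq> 0" "m \<noteq> 0" "v \<bullet> w = m" and null: "negligible (oblique (w $ 1 / w $ 2) ` A)"
  shows "hausdorff1 ((\<lambda>x. x - ((v \<bullet> x) / m) *\<^sub>R w) ` A) = 0"
proof -
  define P where "P x = x - ((v \<bullet> x) / m) *\<^sub>R w" for x :: "real^2"
  define e where "e = P (axis 1 1)"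
  have P: "P x = oblique (w $ 1 / w $ 2) x *\<^sub>R e" for x
  proof -
    have "x = oblique (w $ 1 / w $ 2) x *\<^sub>R axis 1 1 + (x $ 2 / w $ 2) *\<^sub>R w"
      using w(1) by (simp add: vec_eq_iff forall_2 oblique_def axis_def)
    then obtain a b where ab: "x = a *\<^sub>R axis 1 1 + b *\<^sub>R w" "a = oblique (w $ 1 / w $ 2) x" by blast
    have "(v \<bullet> (a *\<^sub>R axis 1 1 + b *\<^sub>R w)) / m = a * ((v \<bullet> axis 1 1) / m) + b"
      using w(2,3) by (simp add: inner_add_right field_simps)
    then have "P (a *\<^sub>R axis 1 1 + b *\<^sub>R w) = a *\<^sub>R e"
      unfolding P_def e_def by (simp only:) (simp add: algebra_simps)
    then have "P x = a *\<^sub>R e" by (simp only: ab(1)[symmetric])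
    then show ?thesis by (simp only: ab(2))
  qed
  have "(norm e)-lipschitz_on (oblique (w $ 1 / w $ 2) ` A) (\<lambda>u. u *\<^sub>R e)"
    by (rule lipschitz_onI) (simp_all add: dist_norm scaleR_left_diff_distrib[symmetric] mult.commute)
  then have "hausdorff1 ((\<lambda>u. u *\<^sub>R e) ` (oblique (w $ 1 / w $ 2) ` A)) = 0"
    using null by (rule hausdorff1_lipschitz_image_negligible)
  then show ?thesis by (simp add: image_image P[symmetric] P_def[symmetric])
qed

lemma cross2_null_if_proj_image_null:
  fixes v w :: "real^2"
  assumes "hausdorff1 ((\<lambda>x. x - ((v \<bullet> x) / m) *\<^sub>R w) ` A) = 0"
  shows "negligible (cross2 w ` A)"
proof -
  have "cross2 w (x - ((v \<bullet> x) / m) *\<^sub>R w) = cross2 w x" for x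
    by (simp add: cross2_def algebra_simps)
  then have "cross2 w ` A = cross2 w ` ((\<lambda>x. x - ((v \<bullet> x) / m) *\<^sub>R w) ` A)"
    by (simp add: image_image)
  then show ?thesis using lipschitz_image_negligible[OF lipschitz_cross2 assms] by simp
qed

text \<open>First component of the normalized gradient. It is defined off the unit circle as well,
  so any representative of a direction may be inserted.\<close>

definition gauss1 :: "(real^2 \<Rightarrow> real) \<Rightarrow> real^2 \<Rightarrow> real" where
  "gauss1 N x = partial_deriv (axis 1 1) N x /
     sqrt ((partial_deriv (axis 1 1) N x)\<^sup>2 + (partial_deriv (axis 2 1) N x)\<^sup>2)"

text \<open>\<open>N\<close> minus the signed supporting functional is nonnegative and vanishes at
  \<open>x\<close>, so its derivative there is zero and the gradient is a multiple of
  \<open>v\<close>. As \<open>x\<close> may lie opposite to \<open>w\<close>, only a result up to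
  sign is available.\<close>

lemma normal_eq_gauss1:
  fixes N :: "real^2 \<Rightarrow> real"
  assumes N: "is_norm N" and diff: "N differentiable (at x)"
    and v: "norm v = 1" and w: "0 < m" "N w = 1" "v \<bullet> w = m" "\<And>z. \<bar>v \<bullet> z\<bar> \<le> m * N z"
    and x: "w = l *\<^sub>R x"
  shows "v $ 1 = gauss1 N x \<or> v $ 1 = - gauss1 N x"
    "(partial_deriv (axis 1 1) N x)\<^sup>2 + (partial_deriv (axis 2 1) N x)\<^sup>2 > 0"
proof -
  have l0: "l \<noteq> 0" using x w(2) is_normD(2)[OF N, of w] by auto
  define \<sigma> where "\<sigma> = sgn l"
  have \<sigma>: "\<sigma> = 1 \<or> \<sigma> = -1" using l0 by (auto simp: \<sigma>_def sgn_if)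
  have Nx: "N x = \<sigma> * (v \<bullet> x) / m"
  proof -
    have "\<bar>l\<bar> * N x = 1" using w(2) x is_normD(3)[OF N, of l x] by simp
    moreover have "l * (v \<bullet> x) = m" using w(3) x by simp
    ultimately have "N x = 1 / \<bar>l\<bar>" "v \<bullet> x = m / l" using l0 by (simp_all add: field_simps)
    then show ?thesis using w(1) l0 by (simp add: \<sigma>_def sgn_if)
  qed
  have le: "\<sigma> * (v \<bullet> z) / m \<le> N z" for z
    using w(4)[of z] w(1) \<sigma> by (auto simp: pos_divide_le_eq mult.commute)
  have pd: "partial_deriv b N x = \<sigma> * (v \<bullet> b) / m" for b
  proof -
    obtain N' where N': "(N has_derivative N') (at x)" using diff by (auto simp: differentiable_def)
    have line: "((\<lambda>t. x + t *\<^sub>R b) has_derivative (\<lambda>t. t *\<^sub>R b)) (at 0)"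
      by (auto intro!: derivative_eq_intros)
    have comp: "((\<lambda>t. N (x + t *\<^sub>R b)) has_derivative (\<lambda>t. N' (t *\<^sub>R b))) (at 0)"
      using has_derivative_compose[OF line, of N N'] N' by simp
    have lin: "N' (t *\<^sub>R b) = t *\<^sub>R N' b" for t
      using has_derivative_bounded_linear[OF N'] by (simp add: linear_simps(5))
    have hv: "((\<lambda>t. N (x + t *\<^sub>R b)) has_vector_derivative N' b) (at 0)"
      using comp unfolding has_vector_derivative_def lin .
    then have pdN: "partial_deriv b N x = N' b"
      unfolding partial_deriv_def by (rule vector_derivative_at)
    have "((\<lambda>t. N (x + t *\<^sub>R b) - \<sigma> * (v \<bullet> (x + t *\<^sub>R b)) / m) has_real_derivative N' b - \<sigma> * (v \<bullet> b) / m) (at 0)"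
    proof (rule DERIV_diff)
      show "((\<lambda>t. N (x + t *\<^sub>R b)) has_real_derivative N' b) (at 0)"
        using hv by (simp add: has_real_derivative_iff_has_vector_derivative)
      show "((\<lambda>t. \<sigma> * (v \<bullet> (x + t *\<^sub>R b)) / m) has_real_derivative \<sigma> * (v \<bullet> b) / m) (at 0)"
        unfolding inner_add_right inner_scaleR_right
        using w(1) by (auto intro!: derivative_eq_intros)
    qed
    then have "N' b - \<sigma> * (v \<bullet> b) / m = 0"
      by (rule DERIV_local_min[of _ _ _ 1]) (use le Nx in auto)
    then show ?thesis using pdN by simp
  qed
  define p q where "p = partial_deriv (axis 1 1) N x" and "q = partial_deriv (axis 2 1) N x"
  have p: "p = \<sigma> * v $ 1 / m" and q: "q = \<sigma> * v $ 2 / m"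
    unfolding p_def q_def pd by (simp_all add: inner_axis)
  have v1: "(v $ 1)\<^sup>2 + (v $ 2)\<^sup>2 = 1"
    using v by (simp add: norm_vec_def L2_set_def sum_2)
  have "\<sigma>\<^sup>2 = 1" using \<sigma> by auto
  then have "p\<^sup>2 + q\<^sup>2 = ((v $ 1)\<^sup>2 + (v $ 2)\<^sup>2) / m\<^sup>2"
    unfolding p q power_mult_distrib power_divide by (simp add: add_divide_distrib)
  then have pq: "p\<^sup>2 + q\<^sup>2 = (1 / m)\<^sup>2" using v1 by (simp add: power_divide)
  then show "(partial_deriv (axis 1 1) N x)\<^sup>2 + (partial_deriv (axis 2 1) N x)\<^sup>2 > 0"
    using w(1) by (simp add: p_def q_def)
  have "gauss1 N x = p / (1 / m)"
    unfolding gauss1_def p_def[symmetric] q_def[symmetric] pq real_sqrt_abs using w(1) by simp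
  then have "gauss1 N x = \<sigma> * v $ 1" using w(1) by (simp add: p)
  then show "v $ 1 = gauss1 N x \<or> v $ 1 = - gauss1 N x" using \<sigma> by auto
qed

subsection \<open>The measure on the circle\<close>

lemma measurable_circle_param:
  "(\<lambda>\<theta>. vector [cos \<theta>, sin \<theta>] :: real^2) \<in>
    measurable (restrict_space lborel {0..<2 * pi}) (restrict_space borel (sphere 0 1))"
proof (rule measurable_restrict_space2)
  have "continuous_on UNIV (\<lambda>\<theta>. vector [cos \<theta>, sin \<theta>] :: real^2)"
  proof -
    have "vector [cos \<theta>, sin \<theta>] = cos \<theta> *\<^sub>R axis 1 1 + sin \<theta> *\<^sub>R (axis 2 1 :: real^2)" for \<theta> :: real
      by (simp add: vec_eq_iff forall_2 axis_def)
    then show ?thesis by (simp only:) (intro continuous_intros)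
  qed
  then have "(\<lambda>\<theta>. vector [cos \<theta>, sin \<theta>] :: real^2) \<in> borel_measurable borel"
    by (rule borel_measurable_continuous_onI)
  then show "(\<lambda>\<theta>. vector [cos \<theta>, sin \<theta>] :: real^2) \<in> borel_measurable (restrict_space lborel {0..<2 * pi})"
    by (intro measurable_restrict_space1) simp
qed (auto simp: norm_vec_def L2_set_def sum_2)

lemma negligible_reflection:
  assumes "negligible S" shows "negligible ((\<lambda>x::real. c - x) ` S)"
  by (rule negligible_differentiable_image_negligible[OF _ assms])
    (auto intro!: derivative_intros simp: differentiable_on_def)

text \<open>On each open half circle the angle is \<open>arccos\<close> of the first coordinate or
  its reflection; \<open>arccos\<close> is differentiable on the open interval, so null sets stay
  null. The values 1 and -1 belong to only two angles.\<close>

lemma AE_circle_measure_first_component: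
  assumes "negligible Y"
  shows "AE v in circle_measure. v $ 1 \<notin> Y"
proof -
  obtain G where G: "G \<in> null_sets lborel" "Y \<subseteq> G" using negligible_borel_superset[OF assms] .
  have Gneg: "negligible G"
    using null_sets_completionI[OF G(1)] by (simp add: negligible_iff_null_sets)
  have [measurable]: "G \<in> sets borel" using G(1) by auto
  have arccos_null: "negligible (arccos ` (G \<inter> {-1<..<1}))"
  proof (rule negligible_differentiable_image_negligible)
    show "negligible (G \<inter> {-1<..<1})" using Gneg by (rule negligible_subset) auto
    show "arccos differentiable_on (G \<inter> {-1<..<1})"
      unfolding differentiable_on_def
    proof
      fix x assume "x \<in> G \<inter> {-1<..<1}"
      then have "(arccos has_real_derivative inverse (- sqrt (1 - x\<^sup>2))) (at x)" by (intro DERIV_arccos) auto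
      then show "arccos differentiable at x within G \<inter> {-1<..<1}"
        by (meson differentiable_at_withinI real_differentiable_def)
    qed
  qed simp
  have neg: "negligible ({0, pi} \<union> arccos ` (G \<inter> {-1<..<1}) \<union> (\<lambda>x. 2 * pi - x) ` arccos ` (G \<inter> {-1<..<1}))"
    using arccos_null by (intro negligible_Un negligible_reflection) (auto intro: negligible_finite)
  have "{\<theta>. \<not> (\<theta> \<in> {0..<2*pi} \<longrightarrow> cos \<theta> \<notin> G)} \<subseteq>
    {0, pi} \<union> arccos ` (G \<inter> {-1<..<1}) \<union> (\<lambda>x. 2 * pi - x) ` arccos ` (G \<inter> {-1<..<1})"
  proof
    fix \<theta> assume "\<theta> \<in> {\<theta>. \<not> (\<theta> \<in> {0..<2*pi} \<longrightarrow> cos \<theta> \<notin> G)}"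
    then have \<theta>: "0 \<le> \<theta>" "\<theta> < 2 * pi" "cos \<theta> \<in> G" by auto
    consider "\<theta> = 0" | "\<theta> = pi" | "0 < \<theta>" "\<theta> < pi" | "pi < \<theta>" using \<theta> by linarith
    then show "\<theta> \<in> {0, pi} \<union> arccos ` (G \<inter> {-1<..<1}) \<union> (\<lambda>x. 2 * pi - x) ` arccos ` (G \<inter> {-1<..<1})"
    proof cases
      case 3
      then have "arccos (cos \<theta>) = \<theta>" "cos \<theta> < 1" "- 1 < cos \<theta>"
        using cos_monotone_0_pi[of 0 \<theta>] cos_monotone_0_pi[of \<theta> pi] by (simp_all add: arccos_cos)
      then have "\<theta> \<in> arccos ` (G \<inter> {-1<..<1})" using \<theta>(3) by (intro image_eqI[of _ _ "cos \<theta>"]) auto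
      then show ?thesis by blast
    next
      case 4
      define \<phi> where "\<phi> = 2 * pi - \<theta>"
      have \<phi>: "0 < \<phi>" "\<phi> < pi" "cos \<phi> = cos \<theta>" using 4 \<theta> by (auto simp: \<phi>_def cos_diff)
      then have "arccos (cos \<phi>) = \<phi>" "cos \<phi> < 1" "- 1 < cos \<phi>"
        using cos_monotone_0_pi[of 0 \<phi>] cos_monotone_0_pi[of \<phi> pi] arccos_cos[of \<phi>] by simp_all
      then have "\<phi> \<in> arccos ` (G \<inter> {-1<..<1})" using \<theta>(3) \<phi>(3) by (intro image_eqI[of _ _ "cos \<phi>"]) auto
      moreover have "\<theta> = 2 * pi - \<phi>" by (simp add: \<phi>_def)
      ultimately show ?thesis by blast
    qed auto
  qed
  then have "AE \<theta> in lborel. \<theta> \<in> {0..<2*pi} \<longrightarrow> cos \<theta> \<notin> G"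
    unfolding AE_lborel_iff_negligible by (rule negligible_subset[OF neg])
  then have AE: "AE \<theta> in restrict_space lborel {0..<2*pi}. (vector [cos \<theta>, sin \<theta>] :: real^2) $ 1 \<notin> G"
    by (subst AE_restrict_space_iff) auto
  have "{v \<in> space borel. v $ 1 \<notin> G} \<in> sets (borel :: (real^2) measure)" by measurable
  then have "sphere 0 1 \<inter> {v. v $ 1 \<notin> G} \<in> sets (restrict_space (borel :: (real^2) measure) (sphere 0 1))"
    by (auto simp: sets_restrict_space)
  then have "{v \<in> space (restrict_space (borel :: (real^2) measure) (sphere 0 1)). v $ 1 \<notin> G}
      \<in> sets (restrict_space borel (sphere 0 1))"
    by (simp add: space_restrict_space Int_def)
  then have "AE v in circle_measure. v $ 1 \<notin> G"
    unfolding circle_measure_def using AE by (subst AE_distr_iff[OF measurable_circle_param])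
  then show ?thesis by eventually_elim (use G(2) in auto)
qed

lemma AE_circle_measure_ex:
  assumes "AE v in circle_measure. P v"
  obtains v where "norm v = 1" "P v"
proof -
  have "AE \<theta> in restrict_space lborel {0..<2*pi}. P (vector [cos \<theta>, sin \<theta>])"
    using AE_distrD[OF measurable_circle_param] assms unfolding circle_measure_def by blast
  then have "AE \<theta> in lborel. \<theta> \<in> {0..<2*pi} \<longrightarrow> P (vector [cos \<theta>, sin \<theta>])"
    by (subst (asm) AE_restrict_space_iff) auto
  then have neg: "negligible {\<theta>. \<not> (\<theta> \<in> {0..<2*pi} \<longrightarrow> P (vector [cos \<theta>, sin \<theta>]))}"
    unfolding AE_lborel_iff_negligible .
  have "\<exists>\<theta>. P (vector [cos \<theta>, sin \<theta>])"
  proof (rule ccontr)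
    assume "\<not> ?thesis"
    moreover have "x < 2 * pi" if "x \<le> pi" for x using that pi_gt_zero by linarith
    ultimately have "negligible {0..pi}" by (intro negligible_subset[OF neg]) auto
    then show False using negligible_interval(1)[of 0 pi] pi_gt_zero by (simp add: not_le[symmetric])
  qed
  then obtain \<theta> where "P (vector [cos \<theta>, sin \<theta>])" ..
  moreover have "norm (vector [cos \<theta>, sin \<theta>] :: real^2) = 1" by (simp add: norm_vec_def L2_set_def sum_2)
  ultimately show ?thesis by (rule that[rotated])
qed

subsection \<open>Closest-point projections\<close>

lemma times_cont_diff_on_2D:
  assumes "times_cont_diff_on 2 f U" "x \<in> U"
  shows "f differentiable (at x)" "b \<in> Basis \<Longrightarrow> partial_deriv b f differentiable (at x)"
  using assms by (auto simp: numeral_2_eq_2)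

text \<open>The line at height 1 meets every non-horizontal direction once. Along it the first
  partial derivatives are differentiable, and positivity keeps the square root in the denominator
  differentiable and nonzero.\<close>

lemma gauss1_differentiable:
  fixes N :: "real^2 \<Rightarrow> real"
  assumes N: "times_cont_diff_on 2 N (UNIV - {0})"
    and pos: "(partial_deriv (axis 1 1) N (t *\<^sub>R axis 1 1 + axis 2 1))\<^sup>2 +
      (partial_deriv (axis 2 1) N (t *\<^sub>R axis 1 1 + axis 2 1))\<^sup>2 > 0"
  shows "(\<lambda>t. gauss1 N (t *\<^sub>R axis 1 1 + axis 2 1)) differentiable (at t)"
proof -
  let ?q = "\<lambda>t::real. t *\<^sub>R axis 1 1 + axis 2 1 :: real^2"
  have q0: "?q t \<noteq> 0" by (simp add: vec_eq_iff forall_2 axis_def)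
  have q: "?q differentiable (at t)" by (intro derivative_intros)
  have pd: "(\<lambda>t. partial_deriv (axis i 1) N (?q t)) differentiable (at t)" for i
  proof (rule differentiable_compose[OF _ q])
    show "partial_deriv (axis i 1) N differentiable (at (?q t))"
      using q0 by (intro times_cont_diff_on_2D(2)[OF N]) (auto simp: axis_in_Basis_iff)
  qed
  obtain p' where p': "((\<lambda>t. partial_deriv (axis 1 1) N (?q t)) has_real_derivative p') (at t)"
    using pd[of 1] by (auto simp: real_differentiable_def)
  obtain q' where q': "((\<lambda>t. partial_deriv (axis 2 1) N (?q t)) has_real_derivative q') (at t)"
    using pd[of 2] by (auto simp: real_differentiable_def)
  have norm': "((\<lambda>t. sqrt ((partial_deriv (axis 1 1) N (?q t))\<^sup>2 + (partial_deriv (axis 2 1) N (?q t))\<^sup>2)) has_real_derivative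
      inverse (sqrt ((partial_deriv (axis 1 1) N (?q t))\<^sup>2 + (partial_deriv (axis 2 1) N (?q t))\<^sup>2)) / 2 *
      (2 * partial_deriv (axis 1 1) N (?q t) * p' + 2 * partial_deriv (axis 2 1) N (?q t) * q')) (at t)"
    using pos p' q' by (auto intro!: derivative_eq_intros DERIV_chain2[OF DERIV_real_sqrt])
  have "sqrt ((partial_deriv (axis 1 1) N (?q t))\<^sup>2 + (partial_deriv (axis 2 1) N (?q t))\<^sup>2) \<noteq> 0"
    using pos by (simp only: real_sqrt_eq_zero_cancel_iff)
  from DERIV_divide[OF p' norm' this] show ?thesis
    unfolding gauss1_def real_differentiable_def by (rule exI)
qed

theorem theorem1p2:
  fixes N :: "real^2 \<Rightarrow> real" and A :: "(real^2) set" and \<delta> :: real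
  assumes "is_norm N"
    and "0 < \<delta>" and "\<delta> \<le> 1" and "class_C_holder 2 \<delta> N (UNIV - {0})"
    and "strictly_positive_curvature (frontier {x. N x \<le> 1})"
    and "hausdorff1_measurable A" and "hausdorff1 A < \<infinity>"
  shows "purely_1_unrectifiable A \<longleftrightarrow>
    (AE v in circle_measure. hausdorff1 (closest_point_proj N v ` A) = 0)"
proof -
  note N = \<open>is_norm N\<close>
  have C2: "times_cont_diff_on 2 N (UNIV - {0})"
    using assms(4) by (simp add: class_C_holder_def)
  have diff: "N differentiable (at x)" if "x \<noteq> 0" for x
    using that by (intro times_cont_diff_on_2D(1)[OF C2]) auto
  have proj: "\<exists>w m. 0 < m \<and> N w = 1 \<and> v \<bullet> w = m \<and> (\<forall>z. \<bar>v \<bullet> z\<bar> \<le> m * N z) \<and>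
      closest_point_proj N v = (\<lambda>x. x - ((v \<bullet> x) / m) *\<^sub>R w)" if v: "norm v = 1" for v
  proof -
    have "v \<noteq> 0" using v by auto
    then obtain w m where wm: "0 < m" "N w = 1" "v \<bullet> w = m" "\<And>z. \<bar>v \<bullet> z\<bar> \<le> m * N z"
      using norm_support_vector[OF N] by blast
    have "closest_point_proj N v = (\<lambda>x. x - ((v \<bullet> x) / m) *\<^sub>R w)"
      by (intro ext closest_point_proj_eq[OF N strictly_convex_norm[OF N assms(5)] wm])
    then show ?thesis using wm by blast
  qed
  have gauss: "v $ 1 \<in> {gauss1 N x, - gauss1 N x}"
    if "norm v = 1" "0 < m" "N w = 1" "v \<bullet> w = m" "\<forall>z. \<bar>v \<bullet> z\<bar> \<le> m * N z" "w = l *\<^sub>R x" "x \<noteq> 0" for v m w l x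
    using normal_eq_gauss1(1)[OF N diff[OF that(7)] that(1-4) _ that(6)] that(5) by auto
  show ?thesis
  proof
    assume pu: "purely_1_unrectifiable A"
    let ?q = "\<lambda>t::real. t *\<^sub>R axis 1 1 + axis 2 1 :: real^2"
    define Z where "Z = {t. \<not> negligible (oblique t ` A)}"
    \<comment> \<open>The gradient condition is what \<open>gauss1_differentiable\<close> requires;
      at the slope of a support vector \<open>w\<close> it holds by
      \<open>normal_eq_gauss1\<close>.\<close>
    define T where "T = {t\<in>Z. (partial_deriv (axis 1 1) N (?q t))\<^sup>2 + (partial_deriv (axis 2 1) N (?q t))\<^sup>2 > 0}"
    \<comment> \<open>Both signs occur because the normal is known only up to sign; the last two
      values belong to horizontal \<open>w\<close>, which have no slope.\<close>
    define Y where "Y = (\<lambda>t. gauss1 N (?q t)) ` T \<union> uminus ` (\<lambda>t. gauss1 N (?q t)) ` T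
      \<union> {gauss1 N (axis 1 1), - gauss1 N (axis 1 1)}"
    have "negligible Z"
      using besicovitch_projection[OF assms(6,7) pu] by (simp add: AE_lborel_iff_negligible Z_def)
    then have "negligible T" by (rule negligible_subset) (auto simp: T_def)
    then have gT: "negligible ((\<lambda>t. gauss1 N (?q t)) ` T)"
      by (rule negligible_differentiable_image_negligible[rotated])
        (auto simp: differentiable_on_def T_def intro!: differentiable_at_withinI gauss1_differentiable[OF C2])
    have "negligible (uminus ` (\<lambda>t. gauss1 N (?q t)) ` T)"
      using negligible_reflection[OF gT, of 0] by simp
    then have "negligible Y" unfolding Y_def using gT by (intro negligible_Un) (auto intro: negligible_finite)
    then have "AE v in circle_measure. v $ 1 \<notin> Y" by (rule AE_circle_measure_first_component)
    moreover have "AE v in circle_measure. norm v = 1"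
      by (rule AE_I2) (simp add: circle_measure_def space_restrict_space)
    ultimately show "AE v in circle_measure. hausdorff1 (closest_point_proj N v ` A) = 0"
    proof eventually_elim
      case (elim v)
      obtain w m where wm: "0 < m" "N w = 1" "v \<bullet> w = m" "\<forall>z. \<bar>v \<bullet> z\<bar> \<le> m * N z"
        "closest_point_proj N v = (\<lambda>x. x - ((v \<bullet> x) / m) *\<^sub>R w)" using proj[OF elim(2)] by blast
      have w2: "w $ 2 \<noteq> 0"
      proof
        assume "w $ 2 = 0"
        then have "w = w $ 1 *\<^sub>R axis 1 1" by (simp add: vec_eq_iff forall_2 axis_def)
        from gauss[OF elim(2) wm(1-4) this] elim(1) show False by (auto simp: Y_def axis_eq_0_iff)
      qed
      define t where "t = w $ 1 / w $ 2"
      have wq: "w = w $ 2 *\<^sub>R ?q t" using w2 by (simp add: vec_eq_iff forall_2 axis_def t_def)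
      have q0: "?q t \<noteq> 0" by (simp add: vec_eq_iff forall_2 axis_def)
      have pos: "(partial_deriv (axis 1 1) N (?q t))\<^sup>2 + (partial_deriv (axis 2 1) N (?q t))\<^sup>2 > 0"
        using normal_eq_gauss1(2)[OF N diff[OF q0] elim(2) wm(1-3) _ wq] wm(4) by blast
      have "t \<notin> T"
      proof
        assume "t \<in> T"
        then have "gauss1 N (?q t) \<in> Y" "- gauss1 N (?q t) \<in> Y" unfolding Y_def by blast+
        then show False using gauss[OF elim(2) wm(1-4) wq q0] elim(1) by auto
      qed
      then have "negligible (oblique t ` A)" using pos by (simp add: T_def Z_def)
      then show ?case
        unfolding wm(5) t_def using w2 wm(1,3) by (intro proj_image_null_if_oblique_null) auto
    qed
  next
    assume AE: "AE v in circle_measure. hausdorff1 (closest_point_proj N v ` A) = 0"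
    obtain v where v: "norm v = 1" "hausdorff1 (closest_point_proj N v ` A) = 0"
      using AE_circle_measure_ex[OF AE] .
    obtain w m where wm: "0 < m" "N w = 1" "v \<bullet> w = m" "\<forall>z. \<bar>v \<bullet> z\<bar> \<le> m * N z"
      "closest_point_proj N v = (\<lambda>x. x - ((v \<bullet> x) / m) *\<^sub>R w)" using proj[OF v(1)] by blast
    have w0: "w \<noteq> 0" using wm(2) is_normD(2)[OF N, of w] by auto
    \<comment> \<open>A support vector parallel to \<open>w\<close> would force one of these first
      coordinates on its normal. Almost every direction avoids them, and so a second support vector
      independent of \<open>w\<close> exists.\<close>
    have "negligible {gauss1 N w, - gauss1 N w}" by (intro negligible_finite) auto
    then have "AE v' in circle_measure. v' $ 1 \<notin> {gauss1 N w, - gauss1 N w}"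
      by (rule AE_circle_measure_first_component)
    with AE have "AE v' in circle_measure.
        hausdorff1 (closest_point_proj N v' ` A) = 0 \<and> v' $ 1 \<notin> {gauss1 N w, - gauss1 N w}"
      by eventually_elim blast
    then obtain v' where v': "norm v' = 1" "hausdorff1 (closest_point_proj N v' ` A) = 0"
      "v' $ 1 \<notin> {gauss1 N w, - gauss1 N w}" by (rule AE_circle_measure_ex) blast
    obtain w' m' where wm': "0 < m'" "N w' = 1" "v' \<bullet> w' = m'" "\<forall>z. \<bar>v' \<bullet> z\<bar> \<le> m' * N z"
      "closest_point_proj N v' = (\<lambda>x. x - ((v' \<bullet> x) / m') *\<^sub>R w')" using proj[OF v'(1)] by blast
    have cross: "cross2 w w' \<noteq> 0"
    proof
      assume "cross2 w w' = 0"
      then have l: "w' = ((w \<bullet> w') / (w \<bullet> w)) *\<^sub>R w" by (rule cross2_zero_imp_parallel[OF w0])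
      from gauss[OF v'(1) wm'(1-4) l w0] v'(3) show False by (rule notE[rotated])
    qed
    have "negligible (cross2 w ` A)" "negligible (cross2 w' ` A)"
      using v(2) v'(2) cross2_null_if_proj_image_null[of v m w A] cross2_null_if_proj_image_null[of v' m' w' A]
      unfolding wm(5) wm'(5) by blast+
    then show "purely_1_unrectifiable A"
      unfolding purely_1_unrectifiable_def using curve_null_if_two_projections_null[OF _ cross] by blast
  qed
qed

end
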